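(* Let $E=(E^0,E^1,r,s)$ be a finite directed graph with no sinks and no sources, and let $n\ge 1$. Then the algebra $\mathcal{A}(n)$ is $*$-isomorphic to $\mathcal{O}(E[n])$.
   Context: Graphs and paths. No sinks and no sources means every vertex is $s(e)$ for some edge $e$ and $r(e')$ for some edge $e'$. $E^*$ is the set of all finite paths in $E$, vertices included as paths of length $0$; paths compose right to left ($w_2w_1$, defined when $s(w_2)=r(w_1)$, is $w_1$ followed by $w_2$); $|w|$ is length; $E^{=n}$, $E^{<n}$ are the paths of length $n$, respectively less than $n$. Every $w\in E^*$ factors uniquely as $w=w(n)\,v_k\cdots v_1$ with $v_i\in E^{=n}$, $w(n)\in E^{<n}$; this defines $w(n)$. The algebra $\mathcal{A}(n)$. $\mathcal{H}_E=\ell^2(E^* )$ has orthonormal basis $\{\xi_w\}_{w\in E^*}$. A weighted shift on $\mathcal{H}_E$ is a family $(T_e)_{e\in E^1}$ with $T_e\xi_w=\lambda(ew)\xi_{ew}$ (zero if $s(e)\neq r(w)$) for scalars $\lambda(u)$, $u\in E^*\setminus E^0$; it is of period $n$ if the weight $\lambda(ew)$ depends only on $e$ and $w(n)$. $\mathcal{A}(n)$ is the $C^*$-algebra generated by all $T_e$, $e\in E^1$, from all period $n$ weighted shifts on $\mathcal{H}_E$. Equivalently, $\mathcal{A}(n)$ is generated by the operators $T_{(e,w)}$ ($e\in E^1$, $w\in E^{<n}$, $s(e)=r(w)$) with $T_{(e,w)}\xi_{w'}=\xi_{ew'}$ if $w'(n)=w$ and $0$ otherwise. The graph $E(n)$.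 $E(n)^0=E^{<n}$; $E(n)^1=\{(e,w)\in E^1\times E^{<n}:s_E(e)=r_E(w)\}$; $s_{E(n)}(e,w)=w$; $r_{E(n)}(e,w)=ew$ if $|w|<n-1$, and $=r_E(e)$ if $|w|=n-1$. The graph $E[n]$. Let $c(E^0)=\{c(v):v\in E^0\}$ be a disjoint copy of $E^0$. $E[n]^0=E(n)^0\sqcup c(E^0)$ and $E[n]^1=E(n)^1\sqcup\{(e,c(v)):e\in E^1,\ v\in E^0,\ s_E(e)=v\}$. The maps $s_{E[n]},r_{E[n]}$ agree with $s_{E(n)},r_{E(n)}$ on $E(n)^1$, while $s_{E[n]}(e,c(v))=c(v)$ and $r_{E[n]}(e,c(v))=e\in E(n)^0$ if $n>1$, $=r_E(e)$ if $n=1$. Cuntz-Krieger algebra. For a finite graph $F$, $\mathcal{O}(F)$ is the universal $C^*$-algebra generated by mutually orthogonal projections $P_x$ ($x\in F^0$) and partial isometries $S_f$ ($f\in F^1$) with $S_f^*S_g=0$ for $f\ne g$, $S_f^*S_f=P_{s(f)}$, $\sum_{r(f)=x}S_fS_f^*\le P_x$, with equality whenever $r^{-1}(x)\neq\emptyset$. *)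

theory Defs
  imports "HOL-Analysis.Analysis" "HOL-Algebra.FiniteProduct" "Graph_Theory.Arc_Walk"
begin

section \<open>C*-algebras\<close>

text \<open>C*-algebras are not assumed to have a unit.\<close>

record 'a cstar = "'a partial_object" +
  czero :: 'a
  cadd :: "'a \<Rightarrow> 'a \<Rightarrow> 'a"
  csmul :: "complex \<Rightarrow> 'a \<Rightarrow> 'a"
  cmul :: "'a \<Rightarrow> 'a \<Rightarrow> 'a"
  cadj :: "'a \<Rightarrow> 'a"
  cnorm :: "'a \<Rightarrow> real"

definition additive :: "'a cstar \<Rightarrow> 'a monoid" where
  "additive A = \<lparr>carrier = carrier A, mult = cadd A, one = czero A\<rparr>"

definition csub :: "'a cstar \<Rightarrow> 'a \<Rightarrow> 'a \<Rightarrow> 'a" where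
  "csub A x y = cadd A x (csmul A (- 1) y)"

definition csum :: "'a cstar \<Rightarrow> ('i \<Rightarrow> 'a) \<Rightarrow> 'i set \<Rightarrow> 'a" where
  "csum A = finprod (additive A)"

definition cconv :: "'a cstar \<Rightarrow> (nat \<Rightarrow> 'a) \<Rightarrow> 'a \<Rightarrow> bool" where
  "cconv A X l \<longleftrightarrow> (\<lambda>k. cnorm A (csub A (X k) l)) \<longlonglongrightarrow> 0"

locale cstar_algebra =
  fixes A :: "'a cstar"
  assumes add_comm_group: "comm_group (additive A)"
    and smul_closed: "x \<in> carrier A \<Longrightarrow> csmul A a x \<in> carrier A"
    and smul_one: "x \<in> carrier A \<Longrightarrow> csmul A 1 x = x"
    and smul_smul: "x \<in> carrier A \<Longrightarrow> csmul A a (csmul A b x) = csmul A (a * b) x"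
    and smul_add_left: "x \<in> carrier A \<Longrightarrow> csmul A (a + b) x = cadd A (csmul A a x) (csmul A b x)"
    and smul_add_right: "x \<in> carrier A \<Longrightarrow> y \<in> carrier A \<Longrightarrow>
      csmul A a (cadd A x y) = cadd A (csmul A a x) (csmul A a y)"
    and mul_closed: "x \<in> carrier A \<Longrightarrow> y \<in> carrier A \<Longrightarrow> cmul A x y \<in> carrier A"
    and mul_assoc: "x \<in> carrier A \<Longrightarrow> y \<in> carrier A \<Longrightarrow> z \<in> carrier A \<Longrightarrow>
      cmul A (cmul A x y) z = cmul A x (cmul A y z)"
    and mul_add_left: "x \<in> carrier A \<Longrightarrow> y \<in> carrier A \<Longrightarrow> z \<in> carrier A \<Longrightarrow>
      cmul A (cadd A x y) z = cadd A (cmul A x z) (cmul A y z)"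
    and mul_add_right: "x \<in> carrier A \<Longrightarrow> y \<in> carrier A \<Longrightarrow> z \<in> carrier A \<Longrightarrow>
      cmul A x (cadd A y z) = cadd A (cmul A x y) (cmul A x z)"
    and mul_smul_left: "x \<in> carrier A \<Longrightarrow> y \<in> carrier A \<Longrightarrow>
      cmul A (csmul A a x) y = csmul A a (cmul A x y)"
    and mul_smul_right: "x \<in> carrier A \<Longrightarrow> y \<in> carrier A \<Longrightarrow>
      cmul A x (csmul A a y) = csmul A a (cmul A x y)"
    and adj_closed: "x \<in> carrier A \<Longrightarrow> cadj A x \<in> carrier A"
    and adj_adj: "x \<in> carrier A \<Longrightarrow> cadj A (cadj A x) = x"
    and adj_add: "x \<in> carrier A \<Longrightarrow> y \<in> carrier A \<Longrightarrow>
      cadj A (cadd A x y) = cadd A (cadj A x) (cadj A y)"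
    and adj_smul: "x \<in> carrier A \<Longrightarrow> cadj A (csmul A a x) = csmul A (cnj a) (cadj A x)"
    and adj_mul: "x \<in> carrier A \<Longrightarrow> y \<in> carrier A \<Longrightarrow>
      cadj A (cmul A x y) = cmul A (cadj A y) (cadj A x)"
    and norm_nonneg: "x \<in> carrier A \<Longrightarrow> 0 \<le> cnorm A x"
    and norm_eq_zero: "x \<in> carrier A \<Longrightarrow> cnorm A x = 0 \<Longrightarrow> x = czero A"
    and norm_triangle: "x \<in> carrier A \<Longrightarrow> y \<in> carrier A \<Longrightarrow>
      cnorm A (cadd A x y) \<le> cnorm A x + cnorm A y"
    and norm_smul: "x \<in> carrier A \<Longrightarrow> cnorm A (csmul A a x) = cmod a * cnorm A x"
    and norm_mul: "x \<in> carrier A \<Longrightarrow> y \<in> carrier A \<Longrightarrow>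
      cnorm A (cmul A x y) \<le> cnorm A x * cnorm A y"
    and norm_cstar: "x \<in> carrier A \<Longrightarrow> cnorm A (cmul A (cadj A x) x) = (cnorm A x)\<^sup>2"
    and norm_complete: "\<lbrakk>\<And>k. X k \<in> carrier A;
        \<And>e. e > 0 \<Longrightarrow> \<exists>N. \<forall>m\<ge>N. \<forall>k\<ge>N. cnorm A (csub A (X m) (X k)) < e\<rbrakk>
      \<Longrightarrow> \<exists>l\<in>carrier A. cconv A X l"

definition star_hom :: "'a cstar \<Rightarrow> 'b cstar \<Rightarrow> ('a \<Rightarrow> 'b) \<Rightarrow> bool" where
  "star_hom A B \<phi> \<longleftrightarrow> \<phi> ` carrier A \<subseteq> carrier B \<and>
    (\<forall>x\<in>carrier A. \<forall>y\<in>carrier A. \<phi> (cadd A x y) = cadd B (\<phi> x) (\<phi> y)) \<and>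
    (\<forall>a. \<forall>x\<in>carrier A. \<phi> (csmul A a x) = csmul B a (\<phi> x)) \<and>
    (\<forall>x\<in>carrier A. \<forall>y\<in>carrier A. \<phi> (cmul A x y) = cmul B (\<phi> x) (\<phi> y)) \<and>
    (\<forall>x\<in>carrier A. \<phi> (cadj A x) = cadj B (\<phi> x))"

definition star_isomorphic :: "'a cstar \<Rightarrow> 'b cstar \<Rightarrow> bool" where
  "star_isomorphic A B \<longleftrightarrow> (\<exists>\<phi>. star_hom A B \<phi> \<and> bij_betw \<phi> (carrier A) (carrier B))"

definition cstar_closed :: "'a cstar \<Rightarrow> 'a set \<Rightarrow> bool" where
  "cstar_closed A M \<longleftrightarrow> M \<subseteq> carrier A \<and> czero A \<in> M \<and>
    (\<forall>x\<in>M. \<forall>y\<in>M. cadd A x y \<in> M) \<and> (\<forall>a. \<forall>x\<in>M. csmul A a x \<in> M) \<and>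
    (\<forall>x\<in>M. \<forall>y\<in>M. cmul A x y \<in> M) \<and> (\<forall>x\<in>M. cadj A x \<in> M) \<and>
    (\<forall>X l. (\<forall>k. X k \<in> M) \<longrightarrow> l \<in> carrier A \<longrightarrow> cconv A X l \<longrightarrow> l \<in> M)"

definition cstar_generated :: "'a cstar \<Rightarrow> 'a set \<Rightarrow> 'a cstar" where
  "cstar_generated A G = A\<lparr>carrier := \<Inter>{M. cstar_closed A M \<and> G \<subseteq> M}\<rparr>"

definition cpositive :: "'a cstar \<Rightarrow> 'a \<Rightarrow> bool" where
  "cpositive A x \<longleftrightarrow> (\<exists>y\<in>carrier A. x = cmul A (cadj A y) y)"

definition cle :: "'a cstar \<Rightarrow> 'a \<Rightarrow> 'a \<Rightarrow> bool" where
  "cle A x y \<longleftrightarrow> cpositive A (csub A y x)"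

definition cproj :: "'a cstar \<Rightarrow> 'a \<Rightarrow> bool" where
  "cproj A p \<longleftrightarrow> p \<in> carrier A \<and> cadj A p = p \<and> cmul A p p = p"

definition cpartial_isometry :: "'a cstar \<Rightarrow> 'a \<Rightarrow> bool" where
  "cpartial_isometry A s \<longleftrightarrow> s \<in> carrier A \<and> cmul A (cmul A s (cadj A s)) s = s"

text \<open>The C*-product of a family: bounded families with the supremum norm.\<close>

definition cstar_prod :: "'i set \<Rightarrow> ('i \<Rightarrow> 'a cstar) \<Rightarrow> ('i \<Rightarrow> 'a) cstar" where
  "cstar_prod I B =
    \<lparr>carrier = {x \<in> \<Pi>\<^sub>E i\<in>I. carrier (B i). bdd_above ((\<lambda>i. cnorm (B i) (x i)) ` I)},
     czero = (\<lambda>i\<in>I. czero (B i)),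
     cadd = (\<lambda>x y. \<lambda>i\<in>I. cadd (B i) (x i) (y i)),
     csmul = (\<lambda>a x. \<lambda>i\<in>I. csmul (B i) a (x i)),
     cmul = (\<lambda>x y. \<lambda>i\<in>I. cmul (B i) (x i) (y i)),
     cadj = (\<lambda>x. \<lambda>i\<in>I. cadj (B i) (x i)),
     cnorm = (\<lambda>x. Sup (insert 0 ((\<lambda>i. cnorm (B i) (x i)) ` I)))\<rparr>"


section \<open>Cuntz-Krieger algebras of finite graphs\<close>

text \<open>The source and range maps of a graph are \<^const>\<open>tail\<close> and \<^const>\<open>head\<close>.\<close>

definition CK_family ::
  "('v,'e) pre_digraph \<Rightarrow> 'a cstar \<Rightarrow> ('v \<Rightarrow> 'a) \<Rightarrow> ('e \<Rightarrow> 'a) \<Rightarrow> bool" where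
  "CK_family F A P S \<longleftrightarrow>
    (\<forall>x\<in>verts F. cproj A (P x)) \<and>
    (\<forall>x\<in>verts F. \<forall>y\<in>verts F. x \<noteq> y \<longrightarrow> cmul A (P x) (P y) = czero A) \<and>
    (\<forall>f\<in>arcs F. cpartial_isometry A (S f)) \<and>
    (\<forall>f\<in>arcs F. \<forall>g\<in>arcs F. f \<noteq> g \<longrightarrow> cmul A (cadj A (S f)) (S g) = czero A) \<and>
    (\<forall>f\<in>arcs F. cmul A (cadj A (S f)) (S f) = P (tail F f)) \<and>
    (\<forall>x\<in>verts F. cle A (csum A (\<lambda>f. cmul A (S f) (cadj A (S f))) {f\<in>arcs F. head F f = x}) (P x)) \<and>
    (\<forall>x\<in>verts F. {f\<in>arcs F. head F f = x} \<noteq> {} \<longrightarrow>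
      csum A (\<lambda>f. cmul A (S f) (cadj A (S f))) {f\<in>arcs F. head F f = x} = P x)"

text \<open>
  The universal C*-algebra of a set of relations is realised in the usual way, as the
  C*-algebra generated by the direct sum of all representations of the relations. To have a
  set of representations, their C*-algebras are taken with carriers in the type
  \<^typ>\<open>nat \<Rightarrow> real\<close>, which has the cardinality of the continuum. This is no restriction: the
  C*-algebra generated by a countable family is separable and so has a copy there
  (its elements are determined by their distances to a countable dense set). The universal
  property with respect to C*-algebras with carriers in arbitrary types is proved in
  \<open>CK_algebra_universal\<close> below.
\<close>

type_synonym ('v,'e) CK_rep = "(nat \<Rightarrow> real) cstar \<times> ('v \<Rightarrow> nat \<Rightarrow> real) \<times> ('e \<Rightarrow> nat \<Rightarrow> real)"

definition CK_reps :: "('v,'e) pre_digraph \<Rightarrow> ('v,'e) CK_rep set" where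
  "CK_reps F = {(B,P,S). cstar_algebra B \<and> CK_family F B P S}"

definition CK_P :: "('v,'e) pre_digraph \<Rightarrow> 'v \<Rightarrow> ('v,'e) CK_rep \<Rightarrow> nat \<Rightarrow> real" where
  "CK_P F x = (\<lambda>(B,P,S)\<in>CK_reps F. P x)"

definition CK_S :: "('v,'e) pre_digraph \<Rightarrow> 'e \<Rightarrow> ('v,'e) CK_rep \<Rightarrow> nat \<Rightarrow> real" where
  "CK_S F f = (\<lambda>(B,P,S)\<in>CK_reps F. S f)"

definition CK_algebra ::
  "('v,'e) pre_digraph \<Rightarrow> (('v,'e) CK_rep \<Rightarrow> nat \<Rightarrow> real) cstar" where
  "CK_algebra F = cstar_generated (cstar_prod (CK_reps F) fst) (CK_P F ` verts F \<union> CK_S F ` arcs F)"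


section \<open>Bounded operators on \<open>\<ell>\<^sup>2\<close>-spaces\<close>

text \<open>
  \<open>\<ell>\<^sup>2(X)\<close> consists of functions on the whole type that vanish off \<open>X\<close>, and a bounded operator
  on \<open>\<ell>\<^sup>2(X)\<close> is extended by the value 0 off \<open>\<ell>\<^sup>2(X)\<close>, so that operators are equal iff they
  agree on \<open>\<ell>\<^sup>2(X)\<close>. The inner product is linear in its second argument.
\<close>

definition ell2 :: "'p set \<Rightarrow> ('p \<Rightarrow> complex) set" where
  "ell2 X = {f. (\<forall>w. w \<notin> X \<longrightarrow> f w = 0) \<and> (\<lambda>w. (cmod (f w))\<^sup>2) summable_on X}"

definition ell2_inner :: "'p set \<Rightarrow> ('p \<Rightarrow> complex) \<Rightarrow> ('p \<Rightarrow> complex) \<Rightarrow> complex" where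
  "ell2_inner X f g = (\<Sum>\<^sub>\<infinity>w\<in>X. cnj (f w) * g w)"

definition ell2_norm :: "'p set \<Rightarrow> ('p \<Rightarrow> complex) \<Rightarrow> real" where
  "ell2_norm X f = sqrt (\<Sum>\<^sub>\<infinity>w\<in>X. (cmod (f w))\<^sup>2)"

definition basis_vec :: "'p \<Rightarrow> 'p \<Rightarrow> complex" where
  "basis_vec w = (\<lambda>u. if u = w then 1 else 0)"

definition bounded_ops :: "'p set \<Rightarrow> (('p \<Rightarrow> complex) \<Rightarrow> 'p \<Rightarrow> complex) set" where
  "bounded_ops X = {T.
    (\<forall>f\<in>ell2 X. T f \<in> ell2 X) \<and> (\<forall>f. f \<notin> ell2 X \<longrightarrow> T f = (\<lambda>_. 0)) \<and>
    (\<forall>f\<in>ell2 X. \<forall>g\<in>ell2 X. T (\<lambda>w. f w + g w) = (\<lambda>w. T f w + T g w)) \<and>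
    (\<forall>a. \<forall>f\<in>ell2 X. T (\<lambda>w. a * f w) = (\<lambda>w. a * T f w)) \<and>
    (\<exists>K. \<forall>f\<in>ell2 X. ell2_norm X (T f) \<le> K * ell2_norm X f)}"

definition B_ell2 :: "'p set \<Rightarrow> (('p \<Rightarrow> complex) \<Rightarrow> 'p \<Rightarrow> complex) cstar" where
  "B_ell2 X =
    \<lparr>carrier = bounded_ops X,
     czero = (\<lambda>f w. 0),
     cadd = (\<lambda>S T f w. S f w + T f w),
     csmul = (\<lambda>a T f w. a * T f w),
     cmul = (\<lambda>S T f. S (T f)),
     cadj = (\<lambda>T. THE S. S \<in> bounded_ops X \<and>
       (\<forall>f\<in>ell2 X. \<forall>g\<in>ell2 X. ell2_inner X (S f) g = ell2_inner X f (T g))),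
     cnorm = (\<lambda>T. Sup {ell2_norm X (T f) |f. f \<in> ell2 X \<and> ell2_norm X f \<le> 1})\<rparr>"


section \<open>Paths and periodic weighted shifts\<close>

text \<open>
  A path is a pair of its source and the list of its edges in the order in which they are
  traversed: the path \<open>e\<^sub>k \<dots> e\<^sub>1\<close> (composed from right to left) with source \<open>u\<close> is
  \<open>(u, [e\<^sub>1, \<dots>, e\<^sub>k])\<close>, and the vertex \<open>u\<close> is \<open>(u, [])\<close>.
\<close>

type_synonym ('v,'e) path = "'v \<times> 'e list"

definition paths :: "('v,'e) pre_digraph \<Rightarrow> ('v,'e) path set" where
  "paths E = {(u,p). \<exists>v. pre_digraph.awalk E u p v}"

definition plen :: "('v,'e) path \<Rightarrow> nat" where
  "plen w = length (snd w)"

definition prange :: "('v,'e) pre_digraph \<Rightarrow> ('v,'e) path \<Rightarrow> 'v" where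
  "prange E w = pre_digraph.awlast E (fst w) (snd w)"

definition vpath :: "'v \<Rightarrow> ('v,'e) path" where
  "vpath v = (v, [])"

text \<open>The path \<open>e w\<close>, that is \<open>w\<close> followed by \<open>e\<close>.\<close>

definition pext :: "'e \<Rightarrow> ('v,'e) path \<Rightarrow> ('v,'e) path" where
  "pext e w = (fst w, snd w @ [e])"

text \<open>
  The path \<open>w(n)\<close> in the factorisation \<open>w = w(n) v\<^sub>k \<dots> v\<^sub>1\<close> with \<open>|v\<^sub>i| = n\<close> and \<open>|w(n)| < n\<close>:
  the first \<open>k n\<close> traversed edges, \<open>k = |w| div n\<close>, are removed.
\<close>

definition residue :: "('v,'e) pre_digraph \<Rightarrow> nat \<Rightarrow> ('v,'e) path \<Rightarrow> ('v,'e) path" where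
  "residue E n w = (let m = n * (plen w div n)
     in (prange E (fst w, take m (snd w)), drop m (snd w)))"

definition weighted_shift :: "('v,'e) pre_digraph \<Rightarrow> (('v,'e) path \<Rightarrow> complex) \<Rightarrow>
    ('e \<Rightarrow> (('v,'e) path \<Rightarrow> complex) \<Rightarrow> ('v,'e) path \<Rightarrow> complex) \<Rightarrow> bool" where
  "weighted_shift E lam T \<longleftrightarrow> (\<forall>e\<in>arcs E. T e \<in> bounded_ops (paths E) \<and>
    (\<forall>w\<in>paths E. T e (basis_vec w) =
      (if tail E e = prange E w then (\<lambda>u. lam (pext e w) * basis_vec (pext e w) u) else (\<lambda>u. 0))))"

definition period :: "('v,'e) pre_digraph \<Rightarrow> nat \<Rightarrow> (('v,'e) path \<Rightarrow> complex) \<Rightarrow> bool" where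
  "period E n lam \<longleftrightarrow> (\<forall>e\<in>arcs E. \<forall>w\<in>paths E. \<forall>w'\<in>paths E.
    tail E e = prange E w \<longrightarrow> tail E e = prange E w' \<longrightarrow> residue E n w = residue E n w' \<longrightarrow>
    lam (pext e w) = lam (pext e w'))"

definition shift_algebra ::
  "('v,'e) pre_digraph \<Rightarrow> nat \<Rightarrow> ((('v,'e) path \<Rightarrow> complex) \<Rightarrow> ('v,'e) path \<Rightarrow> complex) cstar" where
  "shift_algebra E n = cstar_generated (B_ell2 (paths E))
    {T e |T lam e. weighted_shift E lam T \<and> period E n lam \<and> e \<in> arcs E}"


section \<open>The graphs \<open>E(n)\<close> and \<open>E[n]\<close>\<close>

definition no_sinks_no_sources :: "('v,'e) pre_digraph \<Rightarrow> bool" where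
  "no_sinks_no_sources E \<longleftrightarrow> verts E \<subseteq> tail E ` arcs E \<and> verts E \<subseteq> head E ` arcs E"

definition graph_paren ::
  "('v,'e) pre_digraph \<Rightarrow> nat \<Rightarrow> (('v,'e) path, 'e \<times> ('v,'e) path) pre_digraph" where
  "graph_paren E n =
    \<lparr>verts = {w \<in> paths E. plen w < n},
     arcs = {(e,w). e \<in> arcs E \<and> w \<in> paths E \<and> plen w < n \<and> tail E e = prange E w},
     tail = (\<lambda>(e,w). w),
     head = (\<lambda>(e,w). if plen w < n - 1 then pext e w else vpath (head E e))\<rparr>"

text \<open>In \<open>E[n]\<close> the vertex \<open>w\<close> of \<open>E(n)\<close> is \<open>Inl w\<close>, and the new vertex \<open>c(v)\<close> is \<open>Inr v\<close>.\<close>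

definition graph_bracket ::
  "('v,'e) pre_digraph \<Rightarrow> nat \<Rightarrow> (('v,'e) path + 'v, 'e \<times> (('v,'e) path + 'v)) pre_digraph" where
  "graph_bracket E n =
    \<lparr>verts = Inl ` verts (graph_paren E n) \<union> Inr ` verts E,
     arcs = {(e, Inl w) |e w. (e,w) \<in> arcs (graph_paren E n)} \<union>
            {(e, Inr v) |e v. e \<in> arcs E \<and> v \<in> verts E \<and> tail E e = v},
     tail = (\<lambda>(e,x). case x of Inl w \<Rightarrow> Inl (tail (graph_paren E n) (e,w)) | Inr v \<Rightarrow> Inr v),
     head = (\<lambda>(e,x). case x of Inl w \<Rightarrow> Inl (head (graph_paren E n) (e,w))
        | Inr v \<Rightarrow> Inl (if n > 1 then pext e (vpath v) else vpath (head E e)))\<rparr>"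


section \<open>The universal property of \<open>CK_algebra\<close>\<close>

context cstar_algebra
begin

lemma additive_simps [simp]:
  "carrier (additive A) = carrier A" "mult (additive A) = cadd A" "one (additive A) = czero A"
  by (simp_all add: additive_def)

lemmas add_group_facts = comm_groupE[OF add_comm_group, unfolded additive_simps]

lemma add_closed: "x \<in> carrier A \<Longrightarrow> y \<in> carrier A \<Longrightarrow> cadd A x y \<in> carrier A"
  and zero_closed: "czero A \<in> carrier A"
  and add_assoc: "x \<in> carrier A \<Longrightarrow> y \<in> carrier A \<Longrightarrow> z \<in> carrier A \<Longrightarrow>
    cadd A (cadd A x y) z = cadd A x (cadd A y z)"
  and add_commute: "x \<in> carrier A \<Longrightarrow> y \<in> carrier A \<Longrightarrow> cadd A x y = cadd A y x"
  and zero_add: "x \<in> carrier A \<Longrightarrow> cadd A (czero A) x = x"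
  using add_group_facts by blast+

lemma add_zero: "x \<in> carrier A \<Longrightarrow> cadd A x (czero A) = x"
  using add_commute zero_add zero_closed by metis

lemma add_self_zero:
  assumes "x \<in> carrier A" "cadd A x x = x" shows "x = czero A"
proof -
  obtain y where y: "y \<in> carrier A" "cadd A y x = czero A"
    using add_group_facts(6)[OF assms(1)] by blast
  have "cadd A y (cadd A x x) = x" using y assms(1) add_assoc zero_add by metis
  then show ?thesis using assms(2) y by metis
qed

lemma smul_0: "x \<in> carrier A \<Longrightarrow> csmul A 0 x = czero A"
  using add_self_zero[of "csmul A 0 x"] smul_add_left[of x 0 0] smul_closed by simp

lemma add_neg: "x \<in> carrier A \<Longrightarrow> cadd A x (csmul A (- 1) x) = czero A"
  using smul_add_left[of x 1 "- 1"] smul_one smul_0 by simp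

lemma smul_zero: "csmul A a (czero A) = czero A"
  using smul_0[OF zero_closed] smul_smul[OF zero_closed, of a 0] by simp

lemma norm_zero: "cnorm A (czero A) = 0"
  using norm_smul[OF zero_closed, of 0] smul_zero by simp

lemma adj_zero: "cadj A (czero A) = czero A"
  using adj_smul[OF zero_closed, of 0] smul_zero[of 0] smul_0 adj_closed zero_closed by simp

lemma mul_zero_left: "x \<in> carrier A \<Longrightarrow> cmul A (czero A) x = czero A"
  using mul_smul_left[OF zero_closed, of x 0] smul_0 smul_zero mul_closed zero_closed by metis

lemma mul_zero_right: "x \<in> carrier A \<Longrightarrow> cmul A x (czero A) = czero A"
  using mul_smul_right[OF _ zero_closed, of x 0] smul_0 smul_zero mul_closed zero_closed by metis

lemma sub_closed: "x \<in> carrier A \<Longrightarrow> y \<in> carrier A \<Longrightarrow> csub A x y \<in> carrier A"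
  by (simp add: csub_def add_closed smul_closed)

lemma sub_self: "x \<in> carrier A \<Longrightarrow> csub A x x = czero A"
  by (simp add: csub_def add_neg)

lemma sub_zero: "x \<in> carrier A \<Longrightarrow> csub A x (czero A) = x"
  by (simp add: csub_def smul_zero add_zero)

lemma add_4:
  assumes "x \<in> carrier A" "y \<in> carrier A" "z \<in> carrier A" "w \<in> carrier A"
  shows "cadd A (cadd A x y) (cadd A z w) = cadd A (cadd A x z) (cadd A y w)"
proof -
  have "cadd A y (cadd A z w) = cadd A z (cadd A y w)"
    using assms add_assoc add_commute by metis
  then show ?thesis using assms by (simp add: add_assoc add_closed)
qed

lemma sub_add_sub:
  assumes "x \<in> carrier A" "y \<in> carrier A" "z \<in> carrier A"
  shows "cadd A (csub A x y) (csub A y z) = csub A x z"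
proof -
  have n: "csmul A (-1) y \<in> carrier A" "csmul A (-1) z \<in> carrier A" using assms smul_closed by auto
  have "cadd A (csmul A (-1) y) (cadd A y (csmul A (-1) z)) = csmul A (-1) z"
    using n assms add_assoc[of "csmul A (-1) y" y "csmul A (-1) z"] add_neg[of y]
      add_commute[of y "csmul A (-1) y"] zero_add by simp
  then show ?thesis unfolding csub_def using assms n add_assoc add_closed by simp
qed

lemma sub_add_add:
  assumes "x \<in> carrier A" "y \<in> carrier A" "x' \<in> carrier A" "y' \<in> carrier A"
  shows "csub A (cadd A x y) (cadd A x' y') = cadd A (csub A x x') (csub A y y')"
  unfolding csub_def using assms by (simp add: smul_add_right smul_closed add_4)

lemma sub_smul: "x \<in> carrier A \<Longrightarrow> y \<in> carrier A \<Longrightarrow>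
    csub A (csmul A a x) (csmul A a y) = csmul A a (csub A x y)"
  unfolding csub_def by (simp add: smul_add_right smul_closed smul_smul mult.commute)

lemma sub_adj: "x \<in> carrier A \<Longrightarrow> y \<in> carrier A \<Longrightarrow>
    csub A (cadj A x) (cadj A y) = cadj A (csub A x y)"
  unfolding csub_def by (simp add: adj_add smul_closed adj_smul)

lemma sub_mul_left: "x \<in> carrier A \<Longrightarrow> y \<in> carrier A \<Longrightarrow> z \<in> carrier A \<Longrightarrow>
    csub A (cmul A x z) (cmul A y z) = cmul A (csub A x y) z"
  unfolding csub_def by (simp add: mul_add_left smul_closed mul_smul_left)

lemma sub_mul_right: "x \<in> carrier A \<Longrightarrow> y \<in> carrier A \<Longrightarrow> z \<in> carrier A \<Longrightarrow>
    csub A (cmul A z x) (cmul A z y) = cmul A z (csub A x y)"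
  unfolding csub_def by (simp add: mul_add_right smul_closed mul_smul_right)

lemma norm_sub_commute:
  assumes "x \<in> carrier A" "y \<in> carrier A"
  shows "cnorm A (csub A x y) = cnorm A (csub A y x)"
proof -
  have "csub A x y = csmul A (-1) (csub A y x)"
    unfolding csub_def using assms
    by (simp add: smul_add_right smul_closed smul_smul smul_one add_commute)
  then show ?thesis using norm_smul[OF sub_closed[of y x], of "-1"] assms by simp
qed

lemma norm_sub_triangle:
  assumes "x \<in> carrier A" "y \<in> carrier A" "z \<in> carrier A"
  shows "cnorm A (csub A x z) \<le> cnorm A (csub A x y) + cnorm A (csub A y z)"
  using norm_triangle[of "csub A x y" "csub A y z"] sub_add_sub assms sub_closed by metis

lemma sub_eq_zero:
  assumes "x \<in> carrier A" "y \<in> carrier A" "csub A x y = czero A"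
  shows "x = y"
proof -
  have "x = cadd A (csub A x y) (csub A y (czero A))"
    using sub_add_sub[OF assms(1,2) zero_closed] sub_zero assms by simp
  also have "\<dots> = y" using assms sub_zero zero_add by simp
  finally show ?thesis .
qed

lemma norm_sub_eq_zero: "x \<in> carrier A \<Longrightarrow> y \<in> carrier A \<Longrightarrow> cnorm A (csub A x y) = 0 \<Longrightarrow> x = y"
  using sub_eq_zero norm_eq_zero sub_closed by blast

lemma norm_le_norm_sub:
  assumes "x \<in> carrier A" "y \<in> carrier A"
  shows "cnorm A x \<le> cnorm A y + cnorm A (csub A x y)"
  using norm_sub_triangle[of x y "czero A"] assms zero_closed sub_zero by simp

lemma norm_adj_le: assumes "x \<in> carrier A" shows "cnorm A x \<le> cnorm A (cadj A x)"
proof (cases "cnorm A x = 0")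
  case False
  then have "cnorm A x > 0" using norm_nonneg[OF assms] by simp
  moreover have "cnorm A x * cnorm A x \<le> cnorm A (cadj A x) * cnorm A x"
    using norm_cstar[OF assms] norm_mul[OF adj_closed[OF assms] assms] by (simp add: power2_eq_square)
  ultimately show ?thesis by simp
qed (use norm_nonneg adj_closed assms in simp)

lemma norm_adj: "x \<in> carrier A \<Longrightarrow> cnorm A (cadj A x) = cnorm A x"
  using norm_adj_le[of x] norm_adj_le[of "cadj A x"] adj_closed adj_adj by fastforce

lemma conv_iff: "cconv A X l \<longleftrightarrow> (\<lambda>k. cnorm A (csub A (X k) l)) \<longlonglongrightarrow> 0"
  by (rule cconv_def)

lemma conv_add:
  assumes "\<And>k. X k \<in> carrier A" "\<And>k. Y k \<in> carrier A" "l \<in> carrier A" "m \<in> carrier A"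
    "cconv A X l" "cconv A Y m"
  shows "cconv A (\<lambda>k. cadd A (X k) (Y k)) (cadd A l m)"
  unfolding conv_iff
proof (rule tendsto_sandwich[OF _ _ tendsto_const])
  show "(\<lambda>k. cnorm A (csub A (X k) l) + cnorm A (csub A (Y k) m)) \<longlonglongrightarrow> 0"
    using tendsto_add[OF assms(5,6)[unfolded conv_iff]] by simp
qed (auto intro!: always_eventually norm_nonneg norm_triangle sub_closed add_closed assms(1-4)
    simp: sub_add_add assms(1-4))

lemma conv_smul:
  assumes "\<And>k. X k \<in> carrier A" "l \<in> carrier A" "cconv A X l"
  shows "cconv A (\<lambda>k. csmul A a (X k)) (csmul A a l)"
  unfolding conv_iff using tendsto_mult_left[OF assms(3)[unfolded conv_iff], of "cmod a"]
  by (simp add: sub_smul norm_smul sub_closed assms(1,2))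

lemma conv_adj:
  assumes "\<And>k. X k \<in> carrier A" "l \<in> carrier A" "cconv A X l"
  shows "cconv A (\<lambda>k. cadj A (X k)) (cadj A l)"
  using assms(3) unfolding conv_iff by (simp add: sub_adj norm_adj sub_closed assms(1,2))

lemma conv_norm:
  assumes "\<And>k. X k \<in> carrier A" "l \<in> carrier A" "cconv A X l"
  shows "(\<lambda>k. cnorm A (X k)) \<longlonglongrightarrow> cnorm A l"
proof -
  have "(\<lambda>k. cnorm A (X k) - cnorm A l) \<longlonglongrightarrow> 0"
  proof (rule tendsto_rabs_zero_cancel, rule tendsto_sandwich[OF _ _ tendsto_const])
    show "\<forall>\<^sub>F k in sequentially. \<bar>cnorm A (X k) - cnorm A l\<bar> \<le> cnorm A (csub A (X k) l)"
      using norm_le_norm_sub[of "X k" l for k] norm_le_norm_sub[of l "X k" for k]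
        norm_sub_commute assms(1,2) by (intro always_eventually allI) (smt (verit))
  qed (use assms(3) in \<open>auto simp: conv_iff\<close>)
  then show ?thesis by (simp add: LIM_zero_iff)
qed

lemma conv_mul:
  assumes "\<And>k. X k \<in> carrier A" "\<And>k. Y k \<in> carrier A" "l \<in> carrier A" "m \<in> carrier A"
    "cconv A X l" "cconv A Y m"
  shows "cconv A (\<lambda>k. cmul A (X k) (Y k)) (cmul A l m)"
  unfolding conv_iff
proof (rule tendsto_sandwich[OF _ _ tendsto_const])
  show "(\<lambda>k. cnorm A (csub A (X k) l) * cnorm A (Y k) + cnorm A l * cnorm A (csub A (Y k) m)) \<longlonglongrightarrow> 0"
    using tendsto_add[OF tendsto_mult[OF assms(5)[unfolded conv_iff] conv_norm[OF assms(2,4,6)]]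
        tendsto_mult_left[OF assms(6)[unfolded conv_iff], of "cnorm A l"]] by simp
  show "\<forall>\<^sub>F k in sequentially. cnorm A (csub A (cmul A (X k) (Y k)) (cmul A l m))
    \<le> cnorm A (csub A (X k) l) * cnorm A (Y k) + cnorm A l * cnorm A (csub A (Y k) m)"
  proof (intro always_eventually allI)
    fix k
    have "cnorm A (csub A (cmul A (X k) (Y k)) (cmul A l m)) \<le>
      cnorm A (csub A (cmul A (X k) (Y k)) (cmul A l (Y k))) +
      cnorm A (csub A (cmul A l (Y k)) (cmul A l m))"
      by (intro norm_sub_triangle mul_closed assms(1-4))
    also have "\<dots> = cnorm A (cmul A (csub A (X k) l) (Y k)) + cnorm A (cmul A l (csub A (Y k) m))"
      by (simp add: sub_mul_left sub_mul_right assms(1-4))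
    also have "\<dots> \<le> cnorm A (csub A (X k) l) * cnorm A (Y k) + cnorm A l * cnorm A (csub A (Y k) m)"
      by (intro add_mono norm_mul sub_closed assms(1-4))
    finally show "cnorm A (csub A (cmul A (X k) (Y k)) (cmul A l m))
      \<le> cnorm A (csub A (X k) l) * cnorm A (Y k) + cnorm A l * cnorm A (csub A (Y k) m)" .
  qed
qed (auto intro!: always_eventually norm_nonneg sub_closed mul_closed assms(1-4))

lemma conv_unique:
  assumes "\<And>k. X k \<in> carrier A" "l \<in> carrier A" "m \<in> carrier A" "cconv A X l" "cconv A X m"
  shows "l = m"
proof -
  have "(\<lambda>k. cnorm A (csub A (X k) l) + cnorm A (csub A (X k) m)) \<longlonglongrightarrow> 0"
    using tendsto_add[OF assms(4,5)[unfolded conv_iff]] by simp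
  moreover have "cnorm A (csub A l m) \<le> cnorm A (csub A (X k) l) + cnorm A (csub A (X k) m)" for k
    using norm_sub_triangle[of l "X k" m] norm_sub_commute[of l "X k"] assms(1-3) by simp
  ultimately have "cnorm A (csub A l m) \<le> 0"
    by (intro LIMSEQ_le_const) auto
  then show ?thesis using norm_sub_eq_zero norm_nonneg sub_closed assms(2,3) by (meson order_antisym)
qed

lemma cstar_closed_carrier: "cstar_closed A (carrier A)"
  unfolding cstar_closed_def
  by (auto intro: zero_closed add_closed smul_closed mul_closed adj_closed)

lemma subalgebra:
  assumes "cstar_closed A M"
  shows "cstar_algebra (A\<lparr>carrier := M\<rparr>)" (is "cstar_algebra ?M")
proof -
  have sub: "M \<subseteq> carrier A" and cl: "czero A \<in> M" "\<And>x y. x \<in> M \<Longrightarrow> y \<in> M \<Longrightarrow> cadd A x y \<in> M"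
    "\<And>a x. x \<in> M \<Longrightarrow> csmul A a x \<in> M" "\<And>x y. x \<in> M \<Longrightarrow> y \<in> M \<Longrightarrow> cmul A x y \<in> M"
    "\<And>x. x \<in> M \<Longrightarrow> cadj A x \<in> M"
    and lim: "\<And>X l. (\<And>k. X k \<in> M) \<Longrightarrow> l \<in> carrier A \<Longrightarrow> cconv A X l \<Longrightarrow> l \<in> M"
    using assms unfolding cstar_closed_def by (auto, blast)
  have in_A: "x \<in> carrier A" if "x \<in> M" for x using that sub by blast
  have csub: "csub ?M = csub A" by (intro ext) (simp add: csub_def)
  have conv: "cconv ?M = cconv A" by (intro ext) (simp add: cconv_def csub)
  have grp: "comm_group (additive ?M)"
  proof (rule comm_groupI)
    fix x assume "x \<in> carrier (additive ?M)"
    then have x: "x \<in> M" by (simp add: additive_def)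
    then have "cadd A (csmul A (-1) x) x = czero A"
      using add_neg[of x] add_commute[of x "csmul A (-1) x"] in_A cl(3) by metis
    then show "\<exists>y\<in>carrier (additive ?M). y \<otimes>\<^bsub>additive ?M\<^esub> x = \<one>\<^bsub>additive ?M\<^esub>"
      using cl(3)[OF x] by (auto simp: additive_def)
  qed (auto simp: additive_def cl in_A add_assoc zero_add intro: add_commute)
  show ?thesis
  proof (rule cstar_algebra.intro, goal_cases)
    case (24 X)
    obtain l where l: "l \<in> carrier A" "cconv A X l"
      using norm_complete[of X] 24 in_A by (auto simp: csub)
    then have "l \<in> M" using lim[of X l] 24(1) by simp
    then show ?case using l by (auto simp: conv)
  qed (use grp in \<open>simp_all add: cl in_A smul_one smul_smul smul_add_left smul_add_right mul_assoc
      mul_add_left mul_add_right mul_smul_left mul_smul_right adj_adj adj_add adj_smul adj_mul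
      norm_nonneg norm_eq_zero norm_triangle norm_smul norm_mul norm_cstar\<close>)
qed

lemma generated_closed:
  assumes "G \<subseteq> carrier A"
  shows "cstar_closed A (carrier (cstar_generated A G))"
proof -
  have m: "carrier A \<in> {M. cstar_closed A M \<and> G \<subseteq> M}" using cstar_closed_carrier assms by simp
  show ?thesis
    using m unfolding cstar_generated_def cstar_closed_def
    by (simp) (intro conjI; blast)
qed

lemma generated_superset: "G \<subseteq> carrier (cstar_generated A G)"
  by (auto simp: cstar_generated_def)

lemma generated_least: "cstar_closed A M \<Longrightarrow> G \<subseteq> M \<Longrightarrow> carrier (cstar_generated A G) \<subseteq> M"
  by (auto simp: cstar_generated_def)

lemma generated_cstar_algebra:
  "G \<subseteq> carrier A \<Longrightarrow> cstar_algebra (cstar_generated A G)"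
  using subalgebra[OF generated_closed] by (simp add: cstar_generated_def)

end

lemma star_hom_zero:
  assumes "cstar_algebra A" "cstar_algebra B" "star_hom A B \<phi>"
  shows "\<phi> (czero A) = czero B"
proof -
  interpret A: cstar_algebra A by fact
  interpret B: cstar_algebra B by fact
  have "\<phi> (czero A) = csmul B 0 (\<phi> (czero A))"
    using assms(3) A.zero_closed A.smul_zero[of 0] unfolding star_hom_def by metis
  then show ?thesis using B.smul_0 A.zero_closed assms(3) unfolding star_hom_def by auto
qed

lemma (in cstar_algebra) csum_empty: "csum A f {} = czero A"
proof -
  interpret add: comm_group "additive A" by (rule add_comm_group)
  show ?thesis by (simp add: csum_def)
qed

lemma (in cstar_algebra) csum_closed:
  assumes "\<And>k. k \<in> K \<Longrightarrow> f k \<in> carrier A"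
  shows "csum A f K \<in> carrier A"
proof -
  interpret add: comm_group "additive A" by (rule add_comm_group)
  have "finprod (additive A) f K \<in> carrier (additive A)"
    by (rule add.finprod_closed) (use assms in \<open>auto simp: additive_def\<close>)
  then show ?thesis by (simp add: csum_def)
qed

lemma (in cstar_algebra) csum_insert:
  assumes "finite K" "k \<notin> K" "\<And>i. i \<in> insert k K \<Longrightarrow> f i \<in> carrier A"
  shows "csum A f (insert k K) = cadd A (f k) (csum A f K)"
proof -
  interpret add: comm_group "additive A" by (rule add_comm_group)
  have "finprod (additive A) f (insert k K) = f k \<otimes>\<^bsub>additive A\<^esub> finprod (additive A) f K"
    by (rule add.finprod_insert) (use assms in \<open>auto simp: additive_def\<close>)
  then show ?thesis by (simp add: csum_def)
qed

lemma star_hom_csum: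
  assumes A: "cstar_algebra A" and B: "cstar_algebra B" and hom: "star_hom A B \<phi>"
    and "finite K" "\<And>k. k \<in> K \<Longrightarrow> f k \<in> carrier A"
  shows "\<phi> (csum A f K) = csum B (\<lambda>k. \<phi> (f k)) K"
  using assms(4,5)
proof (induction K)
  case empty
  show ?case using star_hom_zero[OF A B hom]
    by (simp add: cstar_algebra.csum_empty[OF A] cstar_algebra.csum_empty[OF B])
next
  case (insert k K)
  interpret A: cstar_algebra A by fact
  interpret B: cstar_algebra B by fact
  have "\<phi> (f i) \<in> carrier B" if "i \<in> insert k K" for i
    using that insert.prems hom unfolding star_hom_def by blast
  have "\<phi> (cadd A (f k) (csum A f K)) = cadd B (\<phi> (f k)) (\<phi> (csum A f K))"
    using hom A.csum_closed[of K f] insert.prems[of k] insert.prems unfolding star_hom_def by simp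
  moreover have "\<phi> (csum A f K) = csum B (\<lambda>k. \<phi> (f k)) K" using insert.IH insert.prems by simp
  moreover have "csum A f (insert k K) = cadd A (f k) (csum A f K)"
    by (rule A.csum_insert) (use insert in auto)
  moreover have "csum B (\<lambda>k. \<phi> (f k)) (insert k K) = cadd B (\<phi> (f k)) (csum B (\<lambda>k. \<phi> (f k)) K)"
    by (rule B.csum_insert) (use insert \<open>\<And>i. i \<in> insert k K \<Longrightarrow> \<phi> (f i) \<in> carrier B\<close> in auto)
  ultimately show ?case by simp
qed

lemma (in cstar_algebra) CK_familyI:
  assumes "\<And>x. x \<in> verts F \<Longrightarrow> cproj A (P x)"
    and "\<And>x y. x \<in> verts F \<Longrightarrow> y \<in> verts F \<Longrightarrow> x \<noteq> y \<Longrightarrow> cmul A (P x) (P y) = czero A"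
    and "\<And>f. f \<in> arcs F \<Longrightarrow> cpartial_isometry A (S f)"
    and "\<And>f g. f \<in> arcs F \<Longrightarrow> g \<in> arcs F \<Longrightarrow> f \<noteq> g \<Longrightarrow> cmul A (cadj A (S f)) (S g) = czero A"
    and "\<And>f. f \<in> arcs F \<Longrightarrow> cmul A (cadj A (S f)) (S f) = P (tail F f)"
    and sum: "\<And>x. x \<in> verts F \<Longrightarrow> {f\<in>arcs F. head F f = x} \<noteq> {} \<Longrightarrow>
      csum A (\<lambda>f. cmul A (S f) (cadj A (S f))) {f\<in>arcs F. head F f = x} = P x"
  shows "CK_family F A P S"
proof -
  have "cle A (csum A (\<lambda>f. cmul A (S f) (cadj A (S f))) {f\<in>arcs F. head F f = x}) (P x)"
    if x: "x \<in> verts F" for x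
  proof (cases "{f\<in>arcs F. head F f = x} = {}")
    case True
    have p: "cproj A (P x)" using assms(1) x .
    then have "csub A (P x) (czero A) = cmul A (cadj A (P x)) (P x)" by (simp add: cproj_def sub_zero)
    then show ?thesis using p unfolding True cle_def cpositive_def csum_empty cproj_def by metis
  next
    case False
    have "csub A (P x) (P x) = cmul A (cadj A (czero A)) (czero A)"
      using assms(1)[OF x] by (simp add: cproj_def sub_self adj_zero mul_zero_left zero_closed)
    then show ?thesis unfolding sum[OF x False] cle_def cpositive_def using zero_closed by blast
  qed
  then show ?thesis unfolding CK_family_def by (intro conjI ballI impI assms) simp_all
qed

lemma CK_familyD:
  assumes "CK_family F A P S"
  shows "x \<in> verts F \<Longrightarrow> cadj A (P x) = P x" "x \<in> verts F \<Longrightarrow> cmul A (P x) (P x) = P x"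
    "x \<in> verts F \<Longrightarrow> y \<in> verts F \<Longrightarrow> x \<noteq> y \<Longrightarrow> cmul A (P x) (P y) = czero A"
    "f \<in> arcs F \<Longrightarrow> cmul A (cmul A (S f) (cadj A (S f))) (S f) = S f"
    "f \<in> arcs F \<Longrightarrow> g \<in> arcs F \<Longrightarrow> f \<noteq> g \<Longrightarrow> cmul A (cadj A (S f)) (S g) = czero A"
    "f \<in> arcs F \<Longrightarrow> cmul A (cadj A (S f)) (S f) = P (tail F f)"
    "x \<in> verts F \<Longrightarrow> {f\<in>arcs F. head F f = x} \<noteq> {} \<Longrightarrow>
      csum A (\<lambda>f. cmul A (S f) (cadj A (S f))) {f\<in>arcs F. head F f = x} = P x"
  using assms unfolding CK_family_def cproj_def cpartial_isometry_def by simp_all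

lemma CK_family_closed:
  assumes "CK_family F A P S"
  shows "x \<in> verts F \<Longrightarrow> P x \<in> carrier A" "f \<in> arcs F \<Longrightarrow> S f \<in> carrier A"
  using assms unfolding CK_family_def cproj_def cpartial_isometry_def by simp_all

lemma CK_family_reflect:
  assumes A: "cstar_algebra A" and fin: "finite (arcs F)"
    and P: "\<And>x. x \<in> verts F \<Longrightarrow> P x \<in> carrier A" and S: "\<And>f. f \<in> arcs F \<Longrightarrow> S f \<in> carrier A"
    and wf: "\<And>f. f \<in> arcs F \<Longrightarrow> tail F f \<in> verts F"
    and inj: "\<And>x y. x \<in> carrier A \<Longrightarrow> y \<in> carrier A \<Longrightarrow> (\<And>i. i \<in> I \<Longrightarrow> \<phi> i x = \<phi> i y) \<Longrightarrow> x = y"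
    and B: "\<And>i. i \<in> I \<Longrightarrow> cstar_algebra (B i)" and hom: "\<And>i. i \<in> I \<Longrightarrow> star_hom A (B i) (\<phi> i)"
    and CK: "\<And>i. i \<in> I \<Longrightarrow> CK_family F (B i) (\<lambda>x. \<phi> i (P x)) (\<lambda>f. \<phi> i (S f))"
  shows "CK_family F A P S"
proof -
  interpret A: cstar_algebra A by fact
  have hom': "\<And>i x y. i \<in> I \<Longrightarrow> x \<in> carrier A \<Longrightarrow> y \<in> carrier A \<Longrightarrow>
      \<phi> i (cmul A x y) = cmul (B i) (\<phi> i x) (\<phi> i y)"
    "\<And>i x. i \<in> I \<Longrightarrow> x \<in> carrier A \<Longrightarrow> \<phi> i (cadj A x) = cadj (B i) (\<phi> i x)"
    "\<And>i x. i \<in> I \<Longrightarrow> x \<in> carrier A \<Longrightarrow> \<phi> i x \<in> carrier (B i)"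
    "\<And>i. i \<in> I \<Longrightarrow> \<phi> i (czero A) = czero (B i)"
    using hom star_hom_zero[OF A B hom] unfolding star_hom_def by (simp_all add: image_subset_iff)
  note cl = A.mul_closed A.adj_closed A.zero_closed P S A.csum_closed wf
  show ?thesis
  proof (rule A.CK_familyI, goal_cases)
    case (1 x)
    show ?case unfolding cproj_def
    proof (intro conjI)
      show "cadj A (P x) = P x" by (rule inj) (simp_all add: 1 hom' cl CK_familyD(1)[OF CK])
      show "cmul A (P x) (P x) = P x" by (rule inj) (simp_all add: 1 hom' cl CK_familyD(2)[OF CK])
    qed (simp add: 1 P)
  next
    case (2 x y)
    show ?case by (rule inj) (simp_all add: 2 hom' cl CK_familyD(3)[OF CK])
  next
    case (3 f)
    show ?case unfolding cpartial_isometry_def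
    proof
      show "cmul A (cmul A (S f) (cadj A (S f))) (S f) = S f"
        by (rule inj) (simp_all add: 3 hom' cl CK_familyD(4)[OF CK])
    qed (simp add: 3 S)
  next
    case (4 f g)
    show ?case by (rule inj) (simp_all add: 4 hom' cl CK_familyD(5)[OF CK])
  next
    case (5 f)
    show ?case by (rule inj) (simp_all add: 5 hom' cl CK_familyD(6)[OF CK])
  next
    case (6 x)
    show ?case
    proof (rule inj)
      fix i assume i: "i \<in> I"
      have "\<phi> i (csum A (\<lambda>f. cmul A (S f) (cadj A (S f))) {f \<in> arcs F. head F f = x}) =
        csum (B i) (\<lambda>f. \<phi> i (cmul A (S f) (cadj A (S f)))) {f \<in> arcs F. head F f = x}"
        by (rule star_hom_csum[OF A B[OF i] hom[OF i]]) (use fin cl in auto)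
      also have "\<dots> = csum (B i) (\<lambda>f. cmul (B i) (\<phi> i (S f)) (cadj (B i) (\<phi> i (S f)))) {f \<in> arcs F. head F f = x}"
      proof -
        interpret B: cstar_algebra "B i" using B[OF i] .
        interpret add: comm_group "additive (B i)" by (rule B.add_comm_group)
        show ?thesis unfolding csum_def
          by (rule add.finprod_cong')
            (auto simp: hom' cl i additive_def intro!: B.mul_closed B.adj_closed)
      qed
      also have "\<dots> = \<phi> i (P x)" by (rule CK_familyD(7)[OF CK[OF i] 6])
      finally show "\<phi> i (csum A (\<lambda>f. cmul A (S f) (cadj A (S f))) {f \<in> arcs F. head F f = x}) = \<phi> i (P x)" .
    qed (use 6 in \<open>auto intro!: A.csum_closed A.mul_closed A.adj_closed S P\<close>)
  qed
qed

text \<open>Images of CK-families under *-homomorphisms.\<close>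

lemma CK_family_image:
  assumes A: "cstar_algebra A" and B: "cstar_algebra B" and fin: "finite (arcs F)"
    and wf: "\<And>f. f \<in> arcs F \<Longrightarrow> tail F f \<in> verts F"
    and hom: "star_hom A B \<phi>" and CK: "CK_family F A P S"
  shows "CK_family F B (\<lambda>x. \<phi> (P x)) (\<lambda>f. \<phi> (S f))"
proof -
  interpret A: cstar_algebra A by fact
  interpret B: cstar_algebra B by fact
  note cl = CK_family_closed[OF CK]
  have hom': "\<And>x y. x \<in> carrier A \<Longrightarrow> y \<in> carrier A \<Longrightarrow> \<phi> (cmul A x y) = cmul B (\<phi> x) (\<phi> y)"
    "\<And>x. x \<in> carrier A \<Longrightarrow> \<phi> (cadj A x) = cadj B (\<phi> x)"
    "\<And>x. x \<in> carrier A \<Longrightarrow> \<phi> x \<in> carrier B"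
    using hom unfolding star_hom_def by (simp_all add: image_subset_iff)
  have z: "\<phi> (czero A) = czero B" by (rule star_hom_zero[OF A B hom])
  show ?thesis
  proof (rule B.CK_familyI, goal_cases)
    case (1 x)
    have "cproj A (P x)" using CK 1 by (simp add: CK_family_def)
    then show ?case unfolding cproj_def using hom' by metis
  next
    case (2 x y)
    then have "cmul A (P x) (P y) = czero A" using CK by (simp add: CK_family_def)
    then show ?case using hom' z cl 2 by metis
  next
    case (3 f)
    have "cpartial_isometry A (S f)" using CK 3 by (simp add: CK_family_def)
    then show ?case unfolding cpartial_isometry_def using hom' A.mul_closed A.adj_closed by metis
  next
    case (4 f g)
    then have "cmul A (cadj A (S f)) (S g) = czero A" using CK by (simp add: CK_family_def)
    then show ?case using hom' z cl 4 A.adj_closed by metis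
  next
    case (5 f)
    then have "cmul A (cadj A (S f)) (S f) = P (tail F f)" using CK by (simp add: CK_family_def)
    then show ?case using hom' cl 5 A.adj_closed by metis
  next
    case (6 x)
    let ?K = "{f \<in> arcs F. head F f = x}"
    interpret add: comm_group "additive B" by (rule B.add_comm_group)
    have "csum B (\<lambda>f. cmul B (\<phi> (S f)) (cadj B (\<phi> (S f)))) ?K =
      csum B (\<lambda>f. \<phi> (cmul A (S f) (cadj A (S f)))) ?K"
      unfolding csum_def
      by (rule add.finprod_cong')
        (auto simp: hom' cl additive_def A.adj_closed A.mul_closed intro!: B.mul_closed B.adj_closed)
    also have "\<dots> = \<phi> (csum A (\<lambda>f. cmul A (S f) (cadj A (S f))) ?K)"
      by (rule star_hom_csum[OF A B hom, symmetric]) (use fin cl A.adj_closed A.mul_closed in auto)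
    also have "\<dots> = \<phi> (P x)" using CK 6 by (simp add: CK_family_def)
    finally show ?case .
  qed
qed

lemma (in cstar_algebra) norm_proj_le: 
  assumes "cproj A p" shows "cnorm A p \<le> 1"
proof (rule ccontr)
  assume "\<not> ?thesis"
  moreover have "(cnorm A p)\<^sup>2 = cnorm A p"
    using norm_cstar[of p] assms by (simp add: cproj_def)
  ultimately show False by (simp add: power2_eq_square)
qed

lemma (in cstar_algebra) CK_family_norm_le:
  assumes "CK_family F A P S" "\<And>f. f \<in> arcs F \<Longrightarrow> tail F f \<in> verts F"
  shows "x \<in> verts F \<Longrightarrow> cnorm A (P x) \<le> 1" "f \<in> arcs F \<Longrightarrow> cnorm A (S f) \<le> 1"
proof -
  show P: "cnorm A (P x) \<le> 1" if "x \<in> verts F" for x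
    using that norm_proj_le assms(1) by (simp add: CK_family_def)
  show "cnorm A (S f) \<le> 1" if f: "f \<in> arcs F"
  proof -
    have "(cnorm A (S f))\<^sup>2 = cnorm A (P (tail F f))"
      using norm_cstar[of "S f"] CK_family_closed(2)[OF assms(1) f] assms(1) f
      by (simp add: CK_family_def)
    also have "\<dots> \<le> 1\<^sup>2" using P assms(2) f by simp
    finally show ?thesis by (rule power2_le_imp_le) simp
  qed
qed

lemma cstar_prod_simps [simp]:
  "carrier (cstar_prod I B) = {x \<in> \<Pi>\<^sub>E i\<in>I. carrier (B i). bdd_above ((\<lambda>i. cnorm (B i) (x i)) ` I)}"
  "czero (cstar_prod I B) = (\<lambda>i\<in>I. czero (B i))"
  "cadd (cstar_prod I B) x y = (\<lambda>i\<in>I. cadd (B i) (x i) (y i))"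
  "csmul (cstar_prod I B) a x = (\<lambda>i\<in>I. csmul (B i) a (x i))"
  "cmul (cstar_prod I B) x y = (\<lambda>i\<in>I. cmul (B i) (x i) (y i))"
  "cadj (cstar_prod I B) x = (\<lambda>i\<in>I. cadj (B i) (x i))"
  "csub (cstar_prod I B) x y = (\<lambda>i\<in>I. csub (B i) (x i) (y i))"
  by (auto simp: cstar_prod_def csub_def)

lemma cstar_prod_norm_ge:
  assumes "x \<in> carrier (cstar_prod I B)" "i \<in> I"
  shows "cnorm (B i) (x i) \<le> cnorm (cstar_prod I B) x"
  using assms by (auto simp: cstar_prod_def intro!: cSup_upper)

lemma cstar_prod_norm_nonneg:
  assumes "x \<in> carrier (cstar_prod I B)"
  shows "0 \<le> cnorm (cstar_prod I B) x"
  using assms by (auto simp: cstar_prod_def intro!: cSup_upper)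

lemma cstar_prod_norm_le:
  assumes "\<And>i. i \<in> I \<Longrightarrow> cnorm (B i) (x i) \<le> c" "0 \<le> c"
  shows "cnorm (cstar_prod I B) x \<le> c"
  unfolding cstar_prod_def using assms by (auto intro!: cSup_least)

lemma cstar_prod_carrierI:
  assumes "\<And>i. i \<in> I \<Longrightarrow> x i \<in> carrier (B i)" "\<And>i. i \<notin> I \<Longrightarrow> x i = undefined"
    and "\<And>i. i \<in> I \<Longrightarrow> cnorm (B i) (x i) \<le> c"
  shows "x \<in> carrier (cstar_prod I B)"
  using assms by (auto intro!: bdd_aboveI[of _ c])

lemma cstar_prod_carrierD:
  assumes "x \<in> carrier (cstar_prod I B)" "i \<in> I" shows "x i \<in> carrier (B i)"
  using assms by auto

lemma cstar_prod_eqI: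
  assumes "x \<in> carrier (cstar_prod I B)" "y \<in> carrier (cstar_prod I B)" "\<And>i. i \<in> I \<Longrightarrow> x i = y i"
  shows "x = y"
  using assms by (auto intro: PiE_ext)

lemma cstar_prod_algebra:
  assumes B: "\<And>i. i \<in> I \<Longrightarrow> cstar_algebra (B i)"
  shows "cstar_algebra (cstar_prod I B)" (is "cstar_algebra ?A")
proof -
  note ax = cstar_algebra.zero_closed[OF B] cstar_algebra.add_closed[OF B]
    cstar_algebra.smul_closed[OF B] cstar_algebra.mul_closed[OF B] cstar_algebra.adj_closed[OF B]
  note D = cstar_prod_carrierD and ge = cstar_prod_norm_ge and nn = cstar_prod_norm_nonneg
  have zero: "czero ?A \<in> carrier ?A"
    by (rule cstar_prod_carrierI[where c = 0]) (auto simp: ax cstar_algebra.norm_zero[OF B])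
  have add: "cadd ?A x y \<in> carrier ?A" if "x \<in> carrier ?A" "y \<in> carrier ?A" for x y
  proof (rule cstar_prod_carrierI[where c = "cnorm ?A x + cnorm ?A y"])
    fix i assume i: "i \<in> I"
    show "cnorm (B i) (cadd ?A x y i) \<le> cnorm ?A x + cnorm ?A y"
      using cstar_algebra.norm_triangle[OF B[OF i] D[OF that(1) i] D[OF that(2) i]]
        ge[OF that(1) i] ge[OF that(2) i] i by simp
  qed (use that in \<open>simp_all add: ax PiE_iff\<close>)
  have smul: "csmul ?A a x \<in> carrier ?A" if "x \<in> carrier ?A" for a x
  proof (rule cstar_prod_carrierI[where c = "cmod a * cnorm ?A x"])
    fix i assume i: "i \<in> I"
    show "cnorm (B i) (csmul ?A a x i) \<le> cmod a * cnorm ?A x"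
      using cstar_algebra.norm_smul[OF B[OF i] D[OF that i], of a]
        mult_left_mono[OF ge[OF that i], of "cmod a"] i by simp
  qed (use that in \<open>simp_all add: ax PiE_iff\<close>)
  have mul_bound: "cnorm (B i) (cmul ?A x y i) \<le> cnorm ?A x * cnorm ?A y"
    if "x \<in> carrier ?A" "y \<in> carrier ?A" and i: "i \<in> I" for x y i
  proof -
    have "cnorm (B i) (x i) * cnorm (B i) (y i) \<le> cnorm ?A x * cnorm ?A y"
      by (intro mult_mono ge that nn cstar_algebra.norm_nonneg[OF B[OF i]] D[OF that(2) i])
    then show ?thesis
      using cstar_algebra.norm_mul[OF B[OF i] D[OF that(1) i] D[OF that(2) i]] i by simp
  qed
  have mul: "cmul ?A x y \<in> carrier ?A" if "x \<in> carrier ?A" "y \<in> carrier ?A" for x y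
    by (rule cstar_prod_carrierI[where c = "cnorm ?A x * cnorm ?A y"])
      (use that mul_bound[OF that] in \<open>simp_all add: ax PiE_iff\<close>)
  have adj: "cadj ?A x \<in> carrier ?A" if "x \<in> carrier ?A" for x
    by (rule cstar_prod_carrierI[where c = "cnorm ?A x"])
      (use that ge[OF that] in \<open>simp_all add: ax PiE_iff cstar_algebra.norm_adj[OF B]\<close>)
  have sub: "csub ?A x y \<in> carrier ?A" if "x \<in> carrier ?A" "y \<in> carrier ?A" for x y
    unfolding csub_def using add smul that by blast
  note cl = zero add smul mul adj
  note eqI = cstar_prod_eqI[where I = I and B = B]
  have grp: "comm_group (additive ?A)"
  proof (rule comm_groupI; unfold additive_def partial_object.simps monoid.simps)
    fix x assume x: "x \<in> carrier ?A"
    have "cadd ?A (csmul ?A (- 1) x) x = czero ?A"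
    proof (rule eqI)
      fix i assume i: "i \<in> I"
      interpret cstar_algebra "B i" by (rule B[OF i])
      show "cadd ?A (csmul ?A (- 1) x) x i = czero ?A i"
        using add_neg[OF D[OF x i]] add_commute[OF D[OF x i] smul_closed[OF D[OF x i]]] i by simp
    qed (intro cl x)+
    then show "\<exists>y\<in>carrier ?A. cadd ?A y x = czero ?A" using smul[OF x] by blast
  next
    fix x y z assume "x \<in> carrier ?A" "y \<in> carrier ?A" "z \<in> carrier ?A"
    then show "cadd ?A (cadd ?A x y) z = cadd ?A x (cadd ?A y z)"
      by (intro eqI cl) (auto simp: cstar_algebra.add_assoc[OF B] PiE_iff)
  next
    fix x y assume "x \<in> carrier ?A" "y \<in> carrier ?A"
    then show "cadd ?A x y = cadd ?A y x"
      by (intro eqI cl) (auto simp: PiE_iff intro: cstar_algebra.add_commute[OF B])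
  next
    fix x assume "x \<in> carrier ?A"
    then show "cadd ?A (czero ?A) x = x"
      by (intro eqI cl) (auto simp: PiE_iff cstar_algebra.zero_add[OF B])
  qed (fact zero add)+
  show ?thesis
  proof (rule cstar_algebra.intro, goal_cases)
    case 1 show ?case by (rule grp)
  next
    case (2 x a) then show ?case by (rule smul)
  next
    case (3 x) then show ?case
      by (intro eqI cl) (auto simp: PiE_iff cstar_algebra.smul_one[OF B])
  next
    case (4 x a b) then show ?case
      by (intro eqI cl) (auto simp: PiE_iff cstar_algebra.smul_smul[OF B])
  next
    case (5 x a b) then show ?case
      by (intro eqI cl) (auto simp: PiE_iff cstar_algebra.smul_add_left[OF B])
  next
    case (6 x y a) then show ?case
      by (intro eqI cl) (auto simp: PiE_iff cstar_algebra.smul_add_right[OF B])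
  next
    case (7 x y) then show ?case by (rule mul)
  next
    case (8 x y z) then show ?case
      by (intro eqI cl) (auto simp: PiE_iff cstar_algebra.mul_assoc[OF B])
  next
    case (9 x y z) then show ?case
      by (intro eqI cl) (auto simp: PiE_iff cstar_algebra.mul_add_left[OF B])
  next
    case (10 x y z) then show ?case
      by (intro eqI cl) (auto simp: PiE_iff cstar_algebra.mul_add_right[OF B])
  next
    case (11 x y a) then show ?case
      by (intro eqI cl) (auto simp: PiE_iff cstar_algebra.mul_smul_left[OF B])
  next
    case (12 x y a) then show ?case
      by (intro eqI cl) (auto simp: PiE_iff cstar_algebra.mul_smul_right[OF B])
  next
    case (13 x) then show ?case by (rule adj)
  next
    case (14 x) then show ?case
      by (intro eqI cl) (auto simp: PiE_iff cstar_algebra.adj_adj[OF B])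
  next
    case (15 x y) then show ?case
      by (intro eqI cl) (auto simp: PiE_iff cstar_algebra.adj_add[OF B])
  next
    case (16 x a) then show ?case
      by (intro eqI cl) (auto simp: PiE_iff cstar_algebra.adj_smul[OF B])
  next
    case (17 x y) then show ?case
      by (intro eqI cl) (auto simp: PiE_iff cstar_algebra.adj_mul[OF B])
  next
    case (18 x) then show ?case by (rule nn)
  next
    case (19 x)
    show ?case
    proof (rule eqI)
      fix i assume i: "i \<in> I"
      have "cnorm (B i) (x i) = 0"
        using ge[OF 19(1) i] 19(2) cstar_algebra.norm_nonneg[OF B[OF i] D[OF 19(1) i]] by simp
      then show "x i = czero ?A i"
        using cstar_algebra.norm_eq_zero[OF B[OF i] D[OF 19(1) i]] i by simp
    qed (intro cl 19)+
  next
    case (20 x y)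
    show ?case
    proof (rule cstar_prod_norm_le)
      fix i assume i: "i \<in> I"
      show "cnorm (B i) (cadd ?A x y i) \<le> cnorm ?A x + cnorm ?A y"
        using cstar_algebra.norm_triangle[OF B[OF i] D[OF 20(1) i] D[OF 20(2) i]]
          ge[OF 20(1) i] ge[OF 20(2) i] i by simp
    qed (use nn[OF 20(1)] nn[OF 20(2)] in simp)
  next
    case (21 x a)
    have le: "cnorm ?A (csmul ?A a x) \<le> cmod a * cnorm ?A x" if x: "x \<in> carrier ?A" for a x
    proof (rule cstar_prod_norm_le)
      fix i assume i: "i \<in> I"
      show "cnorm (B i) (csmul ?A a x i) \<le> cmod a * cnorm ?A x"
        using cstar_algebra.norm_smul[OF B[OF i] D[OF x i], of a]
          mult_left_mono[OF ge[OF x i], of "cmod a"] i by simp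
    qed (use nn[OF x] in simp)
    show ?case
    proof (cases "a = 0")
      case True
      then show ?thesis using le[OF 21, of 0] nn[OF smul[OF 21, of 0]] by (simp del: cstar_prod_simps)
    next
      case False
      have "csmul ?A (inverse a) (csmul ?A a x) = x"
        using 21 False
        by (intro eqI cl) (auto simp: PiE_iff cstar_algebra.smul_smul[OF B] cstar_algebra.smul_one[OF B])
      then have "cnorm ?A x \<le> cmod (inverse a) * cnorm ?A (csmul ?A a x)"
        using le[OF smul[OF 21, of a], of "inverse a"] by (simp del: cstar_prod_simps)
      then have "cmod a * cnorm ?A x \<le> cmod a * (cmod (inverse a) * cnorm ?A (csmul ?A a x))"
        by (rule mult_left_mono) simp
      also have "\<dots> = cnorm ?A (csmul ?A a x)"
        unfolding mult.assoc[symmetric] norm_mult[symmetric] using False by simp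
      finally show ?thesis using le[OF 21, of a] by linarith
    qed
  next
    case (22 x y)
    show ?case
      by (rule cstar_prod_norm_le) (auto intro: mul_bound[OF 22] mult_nonneg_nonneg nn[OF 22(1)] nn[OF 22(2)] simp del: cstar_prod_simps)
  next
    case (23 x)
    let ?y = "cmul ?A (cadj ?A x) x"
    have y: "?y \<in> carrier ?A" using mul adj 23 by blast
    have eq: "cnorm (B i) (?y i) = (cnorm (B i) (x i))\<^sup>2" if i: "i \<in> I" for i
      using cstar_algebra.norm_cstar[OF B[OF i] D[OF 23 i]] i by simp
    have "cnorm ?A ?y \<le> (cnorm ?A x)\<^sup>2"
    proof (rule cstar_prod_norm_le)
      fix i assume i: "i \<in> I"
      show "cnorm (B i) (?y i) \<le> (cnorm ?A x)\<^sup>2"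
        unfolding eq[OF i]
        by (intro power_mono ge[OF 23 i] cstar_algebra.norm_nonneg[OF B[OF i]] D[OF 23 i])
    qed simp
    moreover have "cnorm ?A x \<le> sqrt (cnorm ?A ?y)"
    proof (rule cstar_prod_norm_le)
      fix i assume i: "i \<in> I"
      show "cnorm (B i) (x i) \<le> sqrt (cnorm ?A ?y)"
        using ge[OF y i] unfolding eq[OF i] by (intro real_le_rsqrt)
    qed (use nn[OF y] in simp)
    then have "(cnorm ?A x)\<^sup>2 \<le> cnorm ?A ?y"
      using power_mono[OF _ nn[OF 23], of "sqrt (cnorm ?A ?y)" 2] nn[OF y] by simp
    ultimately show ?case by linarith
  next
    case (24 X)
    have "\<exists>l\<in>carrier (B i). cconv (B i) (\<lambda>k. X k i) l" if i: "i \<in> I" for i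
    proof (rule cstar_algebra.norm_complete[OF B[OF i]])
      show "X k i \<in> carrier (B i)" for k by (rule D[OF 24(1) i])
      fix e :: real assume "e > 0"
      then obtain N where N: "\<And>m k. m \<ge> N \<Longrightarrow> k \<ge> N \<Longrightarrow> cnorm ?A (csub ?A (X m) (X k)) < e"
        using 24(2) by blast
      have "cnorm (B i) (csub (B i) (X m i) (X k i)) < e" if "m \<ge> N" "k \<ge> N" for m k
        using N[OF that] ge[OF sub[OF 24(1) 24(1)] i, of m k] i by simp
      then show "\<exists>N. \<forall>m\<ge>N. \<forall>k\<ge>N. cnorm (B i) (csub (B i) (X m i) (X k i)) < e" by blast
    qed
    then obtain l0 where l0: "\<And>i. i \<in> I \<Longrightarrow> l0 i \<in> carrier (B i)"
      "\<And>i. i \<in> I \<Longrightarrow> cconv (B i) (\<lambda>k. X k i) (l0 i)" by metis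
    define l where "l = restrict l0 I"
    have tail: "cnorm (B i) (csub (B i) (X m i) (l i)) \<le> e"
      if i: "i \<in> I" and N: "\<And>k. k \<ge> N \<Longrightarrow> cnorm ?A (csub ?A (X m) (X k)) < e" for i m N e
    proof -
      interpret cstar_algebra "B i" by (rule B[OF i])
      have lim: "(\<lambda>k. e + cnorm (B i) (csub (B i) (X k i) (l i))) \<longlonglongrightarrow> e + 0"
        using l0(2)[OF i] i by (intro tendsto_intros) (simp add: l_def conv_iff)
      have "\<forall>k\<ge>N. cnorm (B i) (csub (B i) (X m i) (l i)) \<le> e + cnorm (B i) (csub (B i) (X k i) (l i))"
      proof (intro allI impI)
        fix k assume "k \<ge> N"
        then have "cnorm (B i) (csub (B i) (X m i) (X k i)) \<le> e"
          using N[of k] ge[OF sub[OF 24(1) 24(1)] i, of m k] i by simp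
        then show "cnorm (B i) (csub (B i) (X m i) (l i)) \<le> e + cnorm (B i) (csub (B i) (X k i) (l i))"
          using norm_sub_triangle[of "X m i" "X k i" "l i"] D[OF 24(1) i] l0(1)[OF i] i
          by (auto simp: l_def simp del: cstar_prod_simps)
      qed
      then show ?thesis using LIMSEQ_le_const[OF lim] by auto
    qed
    have l: "l \<in> carrier ?A"
    proof -
      obtain N where N: "\<And>m k. m \<ge> N \<Longrightarrow> k \<ge> N \<Longrightarrow> cnorm ?A (csub ?A (X m) (X k)) < 1"
        using 24(2)[of 1] by auto
      show ?thesis
      proof (rule cstar_prod_carrierI[where c = "cnorm ?A (X N) + 1"])
        fix i assume i: "i \<in> I"
        interpret cstar_algebra "B i" by (rule B[OF i])
        show li: "l i \<in> carrier (B i)" using l0(1) i by (simp add: l_def)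
        show "cnorm (B i) (l i) \<le> cnorm ?A (X N) + 1"
          using norm_le_norm_sub[OF li D[OF 24(1) i], of N] norm_sub_commute[OF li D[OF 24(1) i], of N]
            tail[OF i, of N N 1] N ge[OF 24(1) i, of N] by (auto simp del: cstar_prod_simps)
      qed (simp add: l_def)
    qed
    have "cconv ?A X l"
      unfolding cconv_def
    proof (rule LIMSEQ_I)
      fix e :: real assume e: "e > 0"
      then obtain N where N: "\<And>m k. m \<ge> N \<Longrightarrow> k \<ge> N \<Longrightarrow> cnorm ?A (csub ?A (X m) (X k)) < e / 2"
        using 24(2)[of "e / 2"] by auto
      have "cnorm ?A (csub ?A (X m) l) \<le> e / 2" if "m \<ge> N" for m
        by (rule cstar_prod_norm_le) (use tail[of _ N m "e / 2"] N[OF that] e in auto)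
      then show "\<exists>no. \<forall>m\<ge>no. norm (cnorm ?A (csub ?A (X m) l) - 0) < e"
        using e nn[OF sub[OF 24(1) l]] by (intro exI[of _ N]) (force simp del: cstar_prod_simps)
    qed
    then show ?case using l by blast
  qed
qed

lemma cstar_prod_proj_hom: "i \<in> I \<Longrightarrow> star_hom (cstar_prod I B) (B i) (\<lambda>x. x i)"
  unfolding star_hom_def by auto

text \<open>Transport of structure along an injection.\<close>

definition cstar_transport :: "('a \<Rightarrow> 'b) \<Rightarrow> 'a cstar \<Rightarrow> 'b cstar" where
  "cstar_transport j A = (let i = inv_into (carrier A) j in
    \<lparr>carrier = j ` carrier A,
     czero = j (czero A),
     cadd = (\<lambda>x y. j (cadd A (i x) (i y))),
     csmul = (\<lambda>a x. j (csmul A a (i x))),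
     cmul = (\<lambda>x y. j (cmul A (i x) (i y))),
     cadj = (\<lambda>x. j (cadj A (i x))),
     cnorm = (\<lambda>x. cnorm A (i x))\<rparr>)"

lemma cstar_transport_algebra:
  assumes A: "cstar_algebra A" and inj: "inj_on j (carrier A)"
  shows "cstar_algebra (cstar_transport j A)" (is "cstar_algebra ?B")
proof -
  interpret cstar_algebra A by fact
  note cl = zero_closed add_closed smul_closed mul_closed adj_closed sub_closed
  have [simp]: "carrier ?B = j ` carrier A" "czero ?B = j (czero A)"
    by (simp_all add: cstar_transport_def Let_def)
  have [simp]: "cadd ?B (j x) (j y) = j (cadd A x y)" "cmul ?B (j x) (j y) = j (cmul A x y)"
    if "x \<in> carrier A" "y \<in> carrier A" for x y
    using that inj by (simp_all add: cstar_transport_def Let_def)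
  have [simp]: "csmul ?B a (j x) = j (csmul A a x)" "cadj ?B (j x) = j (cadj A x)"
      "cnorm ?B (j x) = cnorm A x" if "x \<in> carrier A" for x a
    using that inj by (simp_all add: cstar_transport_def Let_def)
  have [simp]: "csub ?B (j x) (j y) = j (csub A x y)" if "x \<in> carrier A" "y \<in> carrier A" for x y
    using that by (simp add: csub_def smul_closed)
  have grp: "comm_group (additive ?B)"
  proof (rule comm_groupI; unfold additive_def partial_object.simps monoid.simps)
    fix x assume "x \<in> carrier ?B"
    then obtain u where u: "u \<in> carrier A" "x = j u" by auto
    have "cadd A (csmul A (- 1) u) u = czero A"
      using add_neg[OF u(1)] add_commute u(1) smul_closed by metis
    then have "cadd ?B (j (csmul A (- 1) u)) x = czero ?B" using u smul_closed by simp
    then show "\<exists>y\<in>carrier ?B. cadd ?B y x = czero ?B" using u(1) smul_closed by auto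
  qed (auto simp: cl add_assoc zero_add intro!: arg_cong[where f = j] add_commute)
  show ?thesis
  proof (rule cstar_algebra.intro, goal_cases)
    case (24 X)
    have "\<forall>k. X k \<in> j ` carrier A" using 24(1) by simp
    then have "\<forall>k. \<exists>u\<in>carrier A. X k = j u" by blast
    then obtain Y where Y: "\<And>k. Y k \<in> carrier A" "\<And>k. X k = j (Y k)" by metis
    have "\<exists>l\<in>carrier A. cconv A Y l"
      by (rule norm_complete) (use 24(2) Y in \<open>simp_all add: cl\<close>)
    then obtain l where "l \<in> carrier A" "cconv A Y l" by blast
    then show ?case by (auto simp: cconv_def Y cl)
  qed (use grp in \<open>auto simp: cl smul_one smul_smul smul_add_left smul_add_right mul_assoc
      mul_add_left mul_add_right mul_smul_left mul_smul_right adj_adj adj_add adj_smul adj_mul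
      norm_nonneg norm_triangle norm_smul norm_mul norm_cstar
      dest: norm_eq_zero\<close>)
qed

lemma cstar_transport_hom:
  assumes A: "cstar_algebra A" and inj: "inj_on j (carrier A)"
  shows "star_hom A (cstar_transport j A) j"
    and "star_hom (cstar_transport j A) A (inv_into (carrier A) j)"
    and "x \<in> carrier A \<Longrightarrow> cnorm (cstar_transport j A) (j x) = cnorm A x"
proof -
  interpret cstar_algebra A by fact
  show "star_hom A (cstar_transport j A) j" "star_hom (cstar_transport j A) A (inv_into (carrier A) j)"
    "x \<in> carrier A \<Longrightarrow> cnorm (cstar_transport j A) (j x) = cnorm A x"
    using inj unfolding star_hom_def cstar_transport_def Let_def
    by (auto simp: add_closed smul_closed mul_closed adj_closed)
qed

text \<open>Countably generated C*-algebras are separable.\<close>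

fun dense_steps :: "'a cstar \<Rightarrow> complex set \<Rightarrow> 'a set \<Rightarrow> nat \<Rightarrow> 'a set" where
  "dense_steps A Q G 0 = insert (czero A) G"
| "dense_steps A Q G (Suc n) = dense_steps A Q G n \<union>
    (\<lambda>(x, y). cadd A x y) ` (dense_steps A Q G n \<times> dense_steps A Q G n) \<union>
    (\<lambda>(x, y). cmul A x y) ` (dense_steps A Q G n \<times> dense_steps A Q G n) \<union>
    (\<lambda>(a, x). csmul A a x) ` (Q \<times> dense_steps A Q G n) \<union>
    cadj A ` dense_steps A Q G n"

lemma countable_dense_steps: "countable Q \<Longrightarrow> countable G \<Longrightarrow> countable (dense_steps A Q G n)"
  by (induction n) auto

lemma dense_steps_mono: "m \<le> n \<Longrightarrow> dense_steps A Q G m \<subseteq> dense_steps A Q G n"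
  by (rule lift_Suc_mono_le[of "dense_steps A Q G"]) auto

lemma (in cstar_algebra) separable_generated:
  assumes G: "G \<subseteq> carrier A" "countable G"
  shows "\<exists>D. countable D \<and> D \<subseteq> carrier A \<and> D \<noteq> {} \<and>
    (\<forall>x\<in>carrier (cstar_generated A G). \<forall>e>0. \<exists>d\<in>D. cnorm A (csub A x d) < e)"
proof -
  obtain Q :: "complex set" where Q: "countable Q" "\<And>X. open X \<Longrightarrow> X \<noteq> {} \<Longrightarrow> \<exists>q\<in>Q. q \<in> X"
    using countable_dense_exists[where 'a = complex] by blast
  define D where "D = (\<Union>n. dense_steps A Q G n)"
  have "dense_steps A Q G n \<subseteq> carrier A" for n
  proof (induction n)
    case (Suc n)
    then show ?case by (auto simp: subset_iff intro: add_closed mul_closed smul_closed adj_closed)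
  qed (use G in \<open>simp add: zero_closed\<close>)
  then have DA: "x \<in> carrier A" if "x \<in> D" for x using that by (auto simp: D_def)
  have DI: "x \<in> dense_steps A Q G n \<Longrightarrow> x \<in> D" for x n by (auto simp: D_def)
  have D2: "\<exists>n. x \<in> dense_steps A Q G n \<and> y \<in> dense_steps A Q G n" if "x \<in> D" "y \<in> D" for x y
  proof -
    obtain m n where "x \<in> dense_steps A Q G m" "y \<in> dense_steps A Q G n" using \<open>x \<in> D\<close> \<open>y \<in> D\<close> by (auto simp: D_def)
    then show ?thesis
      using dense_steps_mono[of m "max m n" A Q G] dense_steps_mono[of n "max m n" A Q G] by auto
  qed
  have D_add: "cadd A x y \<in> D" and D_mul: "cmul A x y \<in> D" if xy: "x \<in> D" "y \<in> D" for x y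
  proof -
    obtain n where "x \<in> dense_steps A Q G n" "y \<in> dense_steps A Q G n" using D2[OF xy] by blast
    then have "cadd A x y \<in> dense_steps A Q G (Suc n)" "cmul A x y \<in> dense_steps A Q G (Suc n)" by force+
    then show "cadd A x y \<in> D" "cmul A x y \<in> D" using DI by blast+
  qed
  have D_smul: "csmul A q x \<in> D" if qx: "q \<in> Q" "x \<in> D" for q x
  proof -
    obtain n where "x \<in> dense_steps A Q G n" using qx(2) by (auto simp: D_def)
    then have "csmul A q x \<in> dense_steps A Q G (Suc n)" using qx(1) by force
    then show ?thesis by (rule DI)
  qed
  have D_adj: "cadj A x \<in> D" if x: "x \<in> D" for x
  proof -
    obtain n where "x \<in> dense_steps A Q G n" using x by (auto simp: D_def)
    then have "cadj A x \<in> dense_steps A Q G (Suc n)" by simp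
    then show ?thesis by (rule DI)
  qed
  define M where "M = {x \<in> carrier A. \<forall>e>0. \<exists>d\<in>D. cnorm A (csub A x d) < e}"
  have seq: "\<exists>X. (\<forall>k. X k \<in> D) \<and> cconv A X x" if "x \<in> M" for x
  proof -
    have "\<forall>k. \<exists>d\<in>D. cnorm A (csub A x d) < 1 / real (Suc k)" using that by (simp add: M_def)
    then obtain X where X: "\<And>k. X k \<in> D" "\<And>k. cnorm A (csub A x (X k)) < 1 / real (Suc k)" by metis
    have xA: "x \<in> carrier A" using that by (simp add: M_def)
    have "cconv A X x"
      unfolding conv_iff
    proof (rule tendsto_sandwich[OF _ _ tendsto_const])
      show "(\<lambda>k. 1 / real (Suc k)) \<longlonglongrightarrow> 0" using LIMSEQ_inverse_real_of_nat by (simp add: inverse_eq_divide)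
      show "\<forall>\<^sub>F k in sequentially. cnorm A (csub A (X k) x) \<le> 1 / real (Suc k)"
        using X(2) norm_sub_commute[OF xA DA[OF X(1)]] by (intro always_eventually allI) (simp add: less_imp_le)
      show "\<forall>\<^sub>F k in sequentially. 0 \<le> cnorm A (csub A (X k) x)"
        by (intro always_eventually allI norm_nonneg sub_closed DA[OF X(1)] xA)
    qed
    then show ?thesis using X by blast
  qed
  have MI: "x \<in> M" if x: "x \<in> carrier A" and X: "\<And>k. X k \<in> M" and c: "cconv A X x" for x X
    unfolding M_def
  proof (intro CollectI conjI x allI impI)
    fix e :: real assume e: "e > 0"
    obtain k where "norm (cnorm A (csub A (X k) x) - 0) < e / 2"
      using LIMSEQ_D[OF c[unfolded conv_iff], of "e / 2"] e by auto
    then have k: "cnorm A (csub A (X k) x) < e / 2" by simp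
    obtain d where d: "d \<in> D" "cnorm A (csub A (X k) d) < e / 2"
      using X[of k] half_gt_zero[OF e] unfolding M_def by blast
    have Xk: "X k \<in> carrier A" using X by (simp add: M_def)
    have "cnorm A (csub A x d) < e"
      using norm_sub_triangle[OF x Xk DA[OF d(1)]] norm_sub_commute[OF x Xk] k d(2) by linarith
    then show "\<exists>d\<in>D. cnorm A (csub A x d) < e" using d(1) by blast
  qed
  have DM: "x \<in> M" if "x \<in> D" for x
    unfolding M_def using that DA[OF that] by (auto intro!: bexI[of _ x] simp: sub_self norm_zero)
  have MA: "x \<in> carrier A" if "x \<in> M" for x using that by (simp add: M_def)
  have "cstar_closed A M"
    unfolding cstar_closed_def
  proof (intro conjI ballI allI impI)
    show "czero A \<in> M" by (rule DM, rule DI[of _ 0]) simp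
  next
    fix x y assume xy: "x \<in> M" "y \<in> M"
    obtain X Y where X: "\<And>k. X k \<in> D" "cconv A X x" and Y: "\<And>k. Y k \<in> D" "cconv A Y y"
      using seq[OF xy(1)] seq[OF xy(2)] by blast
    note A = DA[OF X(1)] DA[OF Y(1)] MA[OF xy(1)] MA[OF xy(2)]
    show "cadd A x y \<in> M"
      by (rule MI[OF add_closed[OF A(3,4)] _ conv_add[OF A X(2) Y(2)]]) (intro DM D_add X(1) Y(1))
    show "cmul A x y \<in> M"
      by (rule MI[OF mul_closed[OF A(3,4)] _ conv_mul[OF A X(2) Y(2)]]) (intro DM D_mul X(1) Y(1))
  next
    fix x assume x: "x \<in> M"
    obtain X where X: "\<And>k. X k \<in> D" "cconv A X x" using seq[OF x] by blast
    note A = DA[OF X(1)] MA[OF x]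
    show "cadj A x \<in> M"
      by (rule MI[OF adj_closed[OF A(2)] _ conv_adj[OF A X(2)]]) (intro DM D_adj X(1))
    show "csmul A a x \<in> M" for a
    proof -
    have q: "csmul A q x \<in> M" if "q \<in> Q" for q
      by (rule MI[OF smul_closed[OF A(2)] _ conv_smul[OF A X(2)]]) (intro DM D_smul X(1) that)
    have "\<forall>k. \<exists>q\<in>Q. q \<in> ball a (1 / real (Suc k))" using Q(2)[OF open_ball] by simp
    then obtain q where q': "\<And>k. q k \<in> Q" "\<And>k. dist a (q k) < 1 / real (Suc k)" by (metis mem_ball)
    have "csub A (csmul A b x) (csmul A a x) = csmul A (b - a) x" for b
      using smul_add_left[OF MA[OF x], of b "- a"] smul_smul[OF MA[OF x], of "- 1" a]
      by (simp add: csub_def)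
    then have n: "cnorm A (csub A (csmul A b x) (csmul A a x)) = dist a b * cnorm A x" for b
      by (simp add: norm_smul MA x dist_norm norm_minus_commute)
    have "(\<lambda>k. dist a (q k)) \<longlonglongrightarrow> 0"
    proof (rule tendsto_sandwich[OF _ _ tendsto_const])
      show "(\<lambda>k. 1 / real (Suc k)) \<longlonglongrightarrow> 0" using LIMSEQ_inverse_real_of_nat by (simp add: inverse_eq_divide)
    qed (use q'(2) in \<open>auto intro!: always_eventually less_imp_le\<close>)
    then have c: "cconv A (\<lambda>k. csmul A (q k) x) (csmul A a x)"
      unfolding conv_iff n by (rule tendsto_mult_left_zero)
    show ?thesis by (rule MI[OF smul_closed[OF A(2)] q[OF q'(1)] c])
    qed
  next
    fix X l assume "\<forall>k. X k \<in> M" "l \<in> carrier A" "cconv A X l"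
    then show "l \<in> M" by (intro MI[of l X]) auto
  qed (use MA in blast)
  moreover have "G \<subseteq> M"
  proof
    fix g assume "g \<in> G"
    then have "g \<in> dense_steps A Q G 0" by simp
    then show "g \<in> M" using DI DM by blast
  qed
  ultimately have "carrier (cstar_generated A G) \<subseteq> M" by (rule generated_least)
  moreover have "countable D" unfolding D_def using countable_dense_steps[OF Q(1) G(2)] by auto
  moreover have "czero A \<in> D" by (rule DI[of _ 0]) simp
  ultimately show ?thesis using DA by (intro exI[of _ D]) (auto simp: M_def subset_iff)
qed

lemma (in cstar_algebra) generated_inj_real_seq:
  assumes G: "G \<subseteq> carrier A" "countable G"
  shows "\<exists>j :: 'a \<Rightarrow> nat \<Rightarrow> real. inj_on j (carrier (cstar_generated A G))"
proof -
  obtain D where D: "countable D" "D \<subseteq> carrier A" "D \<noteq> {}"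
    "\<And>x e. x \<in> carrier (cstar_generated A G) \<Longrightarrow> e > 0 \<Longrightarrow> \<exists>d\<in>D. cnorm A (csub A x d) < e"
    using separable_generated[OF G] by blast
  define j where "j x = (\<lambda>k. cnorm A (csub A x (from_nat_into D k)))" for x
  have "inj_on j (carrier (cstar_generated A G))"
  proof (rule inj_onI, rule ccontr)
    fix x y assume x: "x \<in> carrier (cstar_generated A G)" and y: "y \<in> carrier (cstar_generated A G)"
      and eq: "j x = j y" and ne: "x \<noteq> y"
    have xy: "x \<in> carrier A" "y \<in> carrier A"
      using x y generated_least[OF cstar_closed_carrier G(1)] by auto
    have pos: "cnorm A (csub A x y) > 0"
      using norm_sub_eq_zero[OF xy] norm_nonneg[OF sub_closed[OF xy]] ne by fastforce
    then obtain d where d: "d \<in> D" "cnorm A (csub A x d) < cnorm A (csub A x y) / 2"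
      using D(4)[OF x, of "cnorm A (csub A x y) / 2"] by auto
    obtain k where k: "d = from_nat_into D k" using from_nat_into_surj[OF D(1) d(1)] by metis
    have "cnorm A (csub A x d) = cnorm A (csub A y d)" using fun_cong[OF eq, of k] by (simp add: j_def k)
    moreover have dA: "d \<in> carrier A" using d D by blast
    ultimately show False
      using norm_sub_triangle[OF xy(1) dA xy(2)] norm_sub_commute[OF xy(2) dA] d(2) by linarith
  qed
  then show ?thesis by blast
qed

lemma generated_hom_restrict:
  assumes "cstar_algebra A" "G \<subseteq> carrier A" "star_hom A B \<phi>"
  shows "star_hom (cstar_generated A G) B \<phi>"
proof -
  have "carrier (cstar_generated A G) \<subseteq> carrier A"
    using cstar_algebra.generated_least[OF assms(1) cstar_algebra.cstar_closed_carrier[OF assms(1)] assms(2)] .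
  moreover have "cadd (cstar_generated A G) = cadd A" "csmul (cstar_generated A G) = csmul A"
    "cmul (cstar_generated A G) = cmul A" "cadj (cstar_generated A G) = cadj A"
    by (simp_all add: cstar_generated_def)
  ultimately show ?thesis using assms(3) unfolding star_hom_def by (simp add: subset_iff) blast
qed

lemma CK_gen_closed:
  assumes "fin_digraph F"
  shows "x \<in> verts F \<Longrightarrow> CK_P F x \<in> carrier (cstar_prod (CK_reps F) fst)"
    and "f \<in> arcs F \<Longrightarrow> CK_S F f \<in> carrier (cstar_prod (CK_reps F) fst)"
proof -
  interpret fin_digraph F by fact
  show "CK_P F x \<in> carrier (cstar_prod (CK_reps F) fst)" if x: "x \<in> verts F"
  proof (rule cstar_prod_carrierI[where c = 1])
    fix i assume i: "i \<in> CK_reps F"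
    obtain B P S where r: "i = (B, P, S)" by (cases i)
    then have B: "cstar_algebra B" and CK: "CK_family F B P S" using i by (auto simp: CK_reps_def)
    show "CK_P F x i \<in> carrier (fst i)" using CK_family_closed(1)[OF CK x] i r by (simp add: CK_P_def)
    show "cnorm (fst i) (CK_P F x i) \<le> 1"
      using cstar_algebra.CK_family_norm_le(1)[OF B CK tail_in_verts x] i r by (simp add: CK_P_def)
  qed (simp add: CK_P_def)
  show "CK_S F f \<in> carrier (cstar_prod (CK_reps F) fst)" if f: "f \<in> arcs F"
  proof (rule cstar_prod_carrierI[where c = 1])
    fix i assume i: "i \<in> CK_reps F"
    obtain B P S where r: "i = (B, P, S)" by (cases i)
    then have B: "cstar_algebra B" and CK: "CK_family F B P S" using i by (auto simp: CK_reps_def)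
    show "CK_S F f i \<in> carrier (fst i)" using CK_family_closed(2)[OF CK f] i r by (simp add: CK_S_def)
    show "cnorm (fst i) (CK_S F f i) \<le> 1"
      using cstar_algebra.CK_family_norm_le(2)[OF B CK tail_in_verts f] i r by (simp add: CK_S_def)
  qed (simp add: CK_S_def)
qed

lemma CK_reps_algebra: "i \<in> CK_reps F \<Longrightarrow> cstar_algebra (fst i)"
  by (auto simp: CK_reps_def)

lemma CK_prod_algebra: "cstar_algebra (cstar_prod (CK_reps F) fst)"
  by (rule cstar_prod_algebra[OF CK_reps_algebra])

lemma CK_gen_subset:
  assumes "fin_digraph F"
  shows "CK_P F ` verts F \<union> CK_S F ` arcs F \<subseteq> carrier (cstar_prod (CK_reps F) fst)"
  using CK_gen_closed[OF assms] by (simp add: image_subset_iff del: cstar_prod_simps)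

lemma CK_algebra_cstar: "fin_digraph F \<Longrightarrow> cstar_algebra (CK_algebra F)"
  unfolding CK_algebra_def
  by (rule cstar_algebra.generated_cstar_algebra[OF CK_prod_algebra CK_gen_subset])

lemma CK_algebra_proj_hom:
  assumes "fin_digraph F" "i \<in> CK_reps F"
  shows "star_hom (CK_algebra F) (fst i) (\<lambda>x. x i)"
  unfolding CK_algebra_def
  by (rule generated_hom_restrict[OF CK_prod_algebra CK_gen_subset[OF assms(1)]
    cstar_prod_proj_hom[OF assms(2)]])

lemma CK_algebra_carrier_subset:
  assumes "fin_digraph F"
  shows "carrier (CK_algebra F) \<subseteq> carrier (cstar_prod (CK_reps F) fst)"
  unfolding CK_algebra_def
  by (rule cstar_algebra.generated_least[OF CK_prod_algebra
    cstar_algebra.cstar_closed_carrier[OF CK_prod_algebra] CK_gen_subset[OF assms]])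

theorem CK_algebra_family:
  assumes "fin_digraph F"
  shows "CK_family F (CK_algebra F) (CK_P F) (CK_S F)"
proof -
  interpret fin_digraph F by fact
  interpret prd: cstar_algebra "cstar_prod (CK_reps F) fst"
    by (rule CK_prod_algebra)
  have sup: "CK_P F ` verts F \<union> CK_S F ` arcs F \<subseteq> carrier (CK_algebra F)"
    unfolding CK_algebra_def by (rule prd.generated_superset)
  show ?thesis
  proof (rule CK_family_reflect[where I = "CK_reps F" and B = fst and \<phi> = "\<lambda>i x. x i"])
    fix x y assume "x \<in> carrier (CK_algebra F)" "y \<in> carrier (CK_algebra F)" "\<And>i. i \<in> CK_reps F \<Longrightarrow> x i = y i"
    then show "x = y"
      using CK_algebra_carrier_subset[OF assms] by (intro cstar_prod_eqI[of x "CK_reps F" fst y]) (blast+)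
  next
    fix i assume i: "i \<in> CK_reps F"
    obtain B P S where r: "i = (B, P, S)" by (cases i)
    show "CK_family F (fst i) (\<lambda>x. CK_P F x i) (\<lambda>f. CK_S F f i)"
      using i unfolding r CK_P_def CK_S_def by (simp add: CK_reps_def)
  next
    show "x \<in> verts F \<Longrightarrow> CK_P F x \<in> carrier (CK_algebra F)" for x using sup by blast
    show "f \<in> arcs F \<Longrightarrow> CK_S F f \<in> carrier (CK_algebra F)" for f using sup by blast
  qed (fact CK_algebra_cstar[OF assms] finite_arcs tail_in_verts CK_reps_algebra CK_algebra_proj_hom[OF assms])+
qed

lemma star_hom_trans: "star_hom A B \<phi> \<Longrightarrow> star_hom B C \<psi> \<Longrightarrow> star_hom A C (\<lambda>x. \<psi> (\<phi> x))"
  unfolding star_hom_def image_subset_iff by simp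

theorem CK_algebra_universal:
  fixes B :: "'b cstar"
  assumes F: "fin_digraph F" and B: "cstar_algebra B" and CK: "CK_family F B P S"
  shows "\<exists>\<phi>. star_hom (CK_algebra F) B \<phi> \<and>
    (\<forall>x\<in>verts F. \<phi> (CK_P F x) = P x) \<and> (\<forall>f\<in>arcs F. \<phi> (CK_S F f) = S f) \<and>
    (\<forall>y\<in>carrier (CK_algebra F). cnorm B (\<phi> y) \<le> cnorm (CK_algebra F) y)"
proof -
  interpret fin_digraph F by fact
  interpret B: cstar_algebra B by fact
  define G where "G = P ` verts F \<union> S ` arcs F"
  define B0 where "B0 = cstar_generated B G"
  have G: "G \<subseteq> carrier B" using CK_family_closed[OF CK] by (auto simp: G_def)
  have cG: "countable G" by (auto simp: G_def intro: countable_finite)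
  have B0: "cstar_algebra B0" unfolding B0_def by (rule B.generated_cstar_algebra[OF G])
  have GB0: "G \<subseteq> carrier B0" unfolding B0_def by (rule B.generated_superset)
  have B0B: "carrier B0 \<subseteq> carrier B" unfolding B0_def
    by (rule B.generated_least[OF B.cstar_closed_carrier G])
  have "star_hom B B (\<lambda>x. x)" by (simp add: star_hom_def)
  then have incl: "star_hom B0 B (\<lambda>x. x)" unfolding B0_def by (rule generated_hom_restrict[OF B G])
  have CK0: "CK_family F B0 P S"
  proof (rule CK_family_reflect[where I = "{()}" and B = "\<lambda>_. B" and \<phi> = "\<lambda>_ x. x"])
    show "x \<in> verts F \<Longrightarrow> P x \<in> carrier B0" for x using GB0 by (auto simp: G_def)
    show "f \<in> arcs F \<Longrightarrow> S f \<in> carrier B0" for f using GB0 by (auto simp: G_def)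
  qed (fact B0 B incl CK finite_arcs tail_in_verts | simp)+
  obtain j :: "'b \<Rightarrow> nat \<Rightarrow> real" where j: "inj_on j (carrier B0)"
    using B.generated_inj_real_seq[OF G cG] unfolding B0_def by blast
  define T where "T = cstar_transport j B0"
  have T: "cstar_algebra T" unfolding T_def by (rule cstar_transport_algebra[OF B0 j])
  have jT: "star_hom B0 T j" and iT: "star_hom T B0 (inv_into (carrier B0) j)"
    unfolding T_def by (rule cstar_transport_hom[OF B0 j])+
  have CKT: "CK_family F T (\<lambda>x. j (P x)) (\<lambda>f. j (S f))"
    by (rule CK_family_image[OF B0 T finite_arcs tail_in_verts jT CK0])
  define r where "r = (T, (\<lambda>x. j (P x)), (\<lambda>f. j (S f)))"
  have r: "r \<in> CK_reps F" using T CKT by (simp add: r_def CK_reps_def)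
  have pr: "star_hom (CK_algebra F) T (\<lambda>y. y r)"
    using CK_algebra_proj_hom[OF F r] by (simp add: r_def)
  define \<phi> where "\<phi> y = inv_into (carrier B0) j (y r)" for y
  have "star_hom (CK_algebra F) B \<phi>"
    using star_hom_trans[OF star_hom_trans[OF pr iT] incl] unfolding \<phi>_def .
  moreover have "\<phi> (CK_P F x) = P x" if "x \<in> verts F" for x
  proof -
    have "P x \<in> carrier B0" using GB0 that by (auto simp: G_def)
    then show ?thesis using r j by (simp add: \<phi>_def CK_P_def r_def)
  qed
  moreover have "\<phi> (CK_S F f) = S f" if "f \<in> arcs F" for f
  proof -
    have "S f \<in> carrier B0" using GB0 that by (auto simp: G_def)
    then show ?thesis using r j by (simp add: \<phi>_def CK_S_def r_def)
  qed
  moreover have "cnorm B (\<phi> y) \<le> cnorm (CK_algebra F) y" if y: "y \<in> carrier (CK_algebra F)" for y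
  proof -
    have yp: "y \<in> carrier (cstar_prod (CK_reps F) fst)" using y CK_algebra_carrier_subset[OF F] by blast
    have "y r \<in> carrier T" using pr y by (auto simp: star_hom_def)
    then have "cnorm T (y r) = cnorm B (\<phi> y)"
      by (simp add: T_def cstar_transport_def Let_def \<phi>_def B0_def cstar_generated_def)
    moreover have "cnorm (CK_algebra F) y = cnorm (cstar_prod (CK_reps F) fst) y"
      by (simp add: CK_algebra_def cstar_generated_def)
    ultimately show ?thesis using cstar_prod_norm_ge[OF yp r] by (simp add: r_def)
  qed
  ultimately show ?thesis by blast
qed

end

theory Submission
  imports Defs
begin

text \<open>
  Let \<open>T\<^bsub>(e,r)\<^esub>\<close> be the shift that maps \<open>\<xi>\<^sub>w\<close> to \<open>\<xi>\<^bsub>ew\<^esub>\<close> if \<open>w(n) = r\<close> and to 0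
  otherwise. These shifts generate the algebra of the shifts of period \<open>n\<close>, and they satisfy the
  Cuntz-Krieger relations of \<open>E(n)\<close> except at the vertices of \<open>E\<close>: the vectors \<open>\<xi>\<^sub>v\<close> for \<open>v \<in> E\<^sup>0\<close> are
  in the range of no shift. The remedy is to give each \<open>\<xi>\<^sub>v\<close> a vertex \<open>c(v)\<close> of its own. Then every
  path of positive length with residue \<open>r\<close> belongs to the vertex \<open>r\<close>, the vertex path \<open>v\<close> belongs to
  \<open>c(v)\<close>, and appending edges to paths is exactly the combinatorics of \<open>E[n]\<close>. Such a branching
  system on the index set gives a Cuntz-Krieger family of \<open>E[n]\<close> on \<open>\<ell>\<^sup>2(E\<^sup>*)\<close>
  (\<open>CK_family_branching\<close>). It generates the same C*-algebra as the shifts, because the projection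
  onto the paths of positive length is a sum of products \<open>T T\<^sup>\<star>\<close> (\<open>shift_in_generated\<close>,
  \<open>S_in_generated\<close>).

  It remains to see that this family generates a faithful copy of the universal algebra. This is
  \<open>gauge_invariant_uniqueness\<close>: the projections are nonzero, and the unitaries
  \<open>\<xi>\<^sub>w \<mapsto> z\<^bsup>|w|\<^esup> \<xi>\<^sub>w\<close> implement a gauge action. The usual argument first shows injectivity and then uses
  that injective *-homomorphisms are isometric. Here the isometry is proved directly, with elementary
  norm estimates and without spectral theory. The tool is \<open>isometric_of_linear_growth\<close>: by the
  C*-identity, an estimate \<open>\<parallel>a\<parallel> \<le> C \<parallel>\<phi>(a)\<parallel>\<close> improves to \<open>C = 1\<close> if it also holds for the iterated
  squares \<open>a\<^sup>\<star> a, (a\<^sup>\<star> a)\<^sup>2, \<dots>\<close> with constants that grow at most linearly with the exponent. It is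
  used twice. For elements of degree 0, which lie in algebras spanned by finitely many matrix units,
  the matrix entries give a fixed constant (\<open>norm_hom_core\<close>). An element with components of degrees
  \<open>-L, \<dots>, L\<close> is the sum of these components, each of which is at most as large as the element
  because it is a mean over the gauge action; so \<open>2 L + 1\<close> is a constant for it
  (\<open>norm_hom_filt\<close>). These elements are dense.

  The operator algebra on \<open>\<ell>\<^sup>2\<close> is shown to satisfy the axioms of a C*-algebra in
  \<open>B_ell2_cstar_algebra\<close>.
\<close>

section \<open>Sums, spans and closures in C*-algebras\<close>

context cstar_algebra
begin

lemma csum_cong:
  assumes "\<And>k. k \<in> K \<Longrightarrow> f k = g k" "\<And>k. k \<in> K \<Longrightarrow> g k \<in> carrier A"
  shows "csum A f K = csum A g K"
proof -
  interpret add: comm_group "additive A" by (rule add_comm_group)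
  show ?thesis unfolding csum_def by (rule add.finprod_cong') (use assms in auto)
qed

lemma csum_zero:
  assumes "\<And>k. k \<in> K \<Longrightarrow> f k = czero A"
  shows "csum A f K = czero A"
proof -
  interpret add: comm_group "additive A" by (rule add_comm_group)
  show ?thesis unfolding csum_def using add.finprod_one_eqI[of K f] assms by simp
qed

lemma csum_single:
  assumes "finite K" "k \<in> K" "f k \<in> carrier A" "\<And>i. i \<in> K \<Longrightarrow> i \<noteq> k \<Longrightarrow> f i = czero A"
  shows "csum A f K = f k"
proof -
  have "csum A f (insert k (K - {k})) = cadd A (f k) (csum A f (K - {k}))"
    by (rule csum_insert) (use assms zero_closed in \<open>auto, metis\<close>)
  moreover have "csum A f (K - {k}) = czero A" by (rule csum_zero) (use assms(4) in auto)
  ultimately show ?thesis using assms(2,3) by (simp add: add_zero insert_absorb)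
qed

lemma csum_add:
  assumes "\<And>k. k \<in> K \<Longrightarrow> f k \<in> carrier A" "\<And>k. k \<in> K \<Longrightarrow> g k \<in> carrier A"
  shows "csum A (\<lambda>k. cadd A (f k) (g k)) K = cadd A (csum A f K) (csum A g K)"
proof -
  interpret add: comm_group "additive A" by (rule add_comm_group)
  show ?thesis unfolding csum_def using add.finprod_multf[of f K g] assms by (simp add: Pi_def)
qed

lemma csum_map:
  assumes "finite K" "\<And>k. k \<in> K \<Longrightarrow> f k \<in> carrier A"
    and "\<And>x. x \<in> carrier A \<Longrightarrow> h x \<in> carrier A" "h (czero A) = czero A"
    and "\<And>x y. x \<in> carrier A \<Longrightarrow> y \<in> carrier A \<Longrightarrow> h (cadd A x y) = cadd A (h x) (h y)"
  shows "h (csum A f K) = csum A (\<lambda>k. h (f k)) K"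
  using assms(1,2)
proof (induction K)
  case (insert k K)
  have "csum A f (insert k K) = cadd A (f k) (csum A f K)"
    "csum A (\<lambda>k. h (f k)) (insert k K) = cadd A (h (f k)) (csum A (\<lambda>k. h (f k)) K)"
    by (rule csum_insert; use insert assms(3) in auto)+
  then show ?case using insert assms(5)[of "f k" "csum A f K"] csum_closed[of K f] by simp
qed (simp add: csum_empty assms(4))

lemma mul_csum:
  assumes "finite K" "\<And>k. k \<in> K \<Longrightarrow> f k \<in> carrier A" "x \<in> carrier A"
  shows "cmul A x (csum A f K) = csum A (\<lambda>k. cmul A x (f k)) K"
    and "cmul A (csum A f K) x = csum A (\<lambda>k. cmul A (f k) x) K"
  by (rule csum_map[where h = "cmul A x", OF assms(1,2)]
      csum_map[where h = "\<lambda>y. cmul A y x", OF assms(1,2)];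
      simp add: assms(3) mul_closed mul_zero_left mul_zero_right mul_add_left mul_add_right)+

lemma smul_csum:
  assumes "finite K" "\<And>k. k \<in> K \<Longrightarrow> f k \<in> carrier A"
  shows "csmul A a (csum A f K) = csum A (\<lambda>k. csmul A a (f k)) K"
  by (rule csum_map[where h = "csmul A a", OF assms])
    (simp_all add: smul_closed smul_zero smul_add_right)

lemma norm_csum_le:
  assumes "finite K" "\<And>k. k \<in> K \<Longrightarrow> f k \<in> carrier A"
  shows "cnorm A (csum A f K) \<le> (\<Sum>k\<in>K. cnorm A (f k))"
  using assms
proof (induction K)
  case (insert k K)
  have "csum A f (insert k K) = cadd A (f k) (csum A f K)"
    by (rule csum_insert) (use insert in auto)
  then show ?case
    using insert norm_triangle[of "f k" "csum A f K"] csum_closed[of K f] by fastforce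
qed (simp add: csum_empty norm_zero)

end

inductive_set lspan :: "'a cstar \<Rightarrow> 'a set \<Rightarrow> 'a set" for A G where
  zero: "czero A \<in> lspan A G"
| gen: "x \<in> G \<Longrightarrow> x \<in> lspan A G"
| add: "x \<in> lspan A G \<Longrightarrow> y \<in> lspan A G \<Longrightarrow> cadd A x y \<in> lspan A G"
| smul: "x \<in> lspan A G \<Longrightarrow> csmul A a x \<in> lspan A G"

lemma lspan_least:
  assumes "G \<subseteq> lspan A H" shows "lspan A G \<subseteq> lspan A H"
proof
  show "x \<in> lspan A H" if "x \<in> lspan A G" for x
    using that by (induction) (use assms in \<open>auto intro: lspan.intros\<close>)
qed

context cstar_algebra
begin

lemma lspan_closed: "x \<in> lspan A G \<Longrightarrow> G \<subseteq> carrier A \<Longrightarrow> x \<in> carrier A"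
  by (induction rule: lspan.induct) (auto simp: zero_closed add_closed smul_closed)

lemma csum_lspan:
  assumes "G \<subseteq> carrier A" "finite K" "\<And>k. k \<in> K \<Longrightarrow> f k \<in> lspan A G"
  shows "csum A f K \<in> lspan A G"
  using assms(2,3)
proof (induction K)
  case (insert k K)
  have "csum A f (insert k K) = cadd A (f k) (csum A f K)"
    by (rule csum_insert) (use insert lspan_closed[OF _ assms(1)] in auto)
  then show ?case using insert by (simp add: lspan.add)
qed (simp add: csum_empty lspan.zero)

text \<open>The existential scalar makes the rule apply to conjugate-linear maps, such as the adjoint, as well
  as to linear ones.\<close>

lemma lspan_map:
  assumes "x \<in> lspan A G" "G \<subseteq> carrier A" "h (czero A) = czero A"
    and "\<And>x y. x \<in> carrier A \<Longrightarrow> y \<in> carrier A \<Longrightarrow> h (cadd A x y) = cadd A (h x) (h y)"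
    and "\<And>a x. x \<in> carrier A \<Longrightarrow> \<exists>b. h (csmul A a x) = csmul A b (h x)"
    and "\<And>g. g \<in> G \<Longrightarrow> h g \<in> lspan A H"
  shows "h x \<in> lspan A H"
  using assms(1)
proof induction
  case (add x y)
  then show ?case using assms(4) lspan_closed[OF _ assms(2)] by (auto intro: lspan.add)
next
  case (smul x a)
  then show ?case using assms(5)[of x a] lspan_closed[OF _ assms(2)] by (auto intro: lspan.smul)
qed (auto intro: lspan.zero simp: assms)

lemma lspan_mul_left:
  assumes "x \<in> lspan A G" "G \<subseteq> carrier A" "y \<in> carrier A" "\<And>g. g \<in> G \<Longrightarrow> cmul A y g \<in> lspan A H"
  shows "cmul A y x \<in> lspan A H"
  by (rule lspan_map[where h = "cmul A y", OF assms(1,2)])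
    (use assms(3,4) in \<open>auto simp: mul_zero_right mul_add_right mul_smul_right\<close>)

lemma lspan_mul_right:
  assumes "x \<in> lspan A G" "G \<subseteq> carrier A" "y \<in> carrier A" "\<And>g. g \<in> G \<Longrightarrow> cmul A g y \<in> lspan A H"
  shows "cmul A x y \<in> lspan A H"
  by (rule lspan_map[where h = "\<lambda>x. cmul A x y", OF assms(1,2)])
    (use assms(3,4) in \<open>auto simp: mul_zero_left mul_add_left mul_smul_left\<close>)

lemma lspan_adj:
  assumes "x \<in> lspan A G" "G \<subseteq> carrier A" "\<And>g. g \<in> G \<Longrightarrow> cadj A g \<in> lspan A H"
  shows "cadj A x \<in> lspan A H"
  by (rule lspan_map[where h = "cadj A", OF assms(1,2)])
    (use assms(3) in \<open>auto simp: adj_zero adj_add adj_smul\<close>)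

definition star_subalgebra :: "'a set \<Rightarrow> bool" where
  "star_subalgebra D \<longleftrightarrow> D \<subseteq> carrier A \<and> czero A \<in> D \<and>
    (\<forall>x\<in>D. \<forall>y\<in>D. cadd A x y \<in> D) \<and> (\<forall>a. \<forall>x\<in>D. csmul A a x \<in> D) \<and>
    (\<forall>x\<in>D. \<forall>y\<in>D. cmul A x y \<in> D) \<and> (\<forall>x\<in>D. cadj A x \<in> D)"

definition norm_closure :: "'a set \<Rightarrow> 'a set" where
  "norm_closure D = {x \<in> carrier A. \<exists>X. (\<forall>k. X k \<in> D) \<and> cconv A X x}"

lemma norm_closureI:
  assumes "D \<subseteq> carrier A" "x \<in> carrier A" "\<And>e. e > 0 \<Longrightarrow> \<exists>d\<in>D. cnorm A (csub A d x) < e"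
  shows "x \<in> norm_closure D"
proof -
  have "\<forall>k. \<exists>d\<in>D. cnorm A (csub A d x) < 1 / real (Suc k)" using assms(3) by simp
  then obtain X where X: "\<And>k. X k \<in> D" "\<And>k. cnorm A (csub A (X k) x) < 1 / real (Suc k)" by metis
  have "cconv A X x"
    unfolding conv_iff
  proof (rule tendsto_sandwich[OF _ _ tendsto_const])
    show "(\<lambda>k. 1 / real (Suc k)) \<longlonglongrightarrow> 0"
      using LIMSEQ_inverse_real_of_nat by (simp add: inverse_eq_divide)
    show "\<forall>\<^sub>F k in sequentially. cnorm A (csub A (X k) x) \<le> 1 / real (Suc k)"
      using X(2) by (intro always_eventually allI) (simp add: less_imp_le)
    show "\<forall>\<^sub>F k in sequentially. 0 \<le> cnorm A (csub A (X k) x)"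
      using X(1) assms(1,2) by (intro always_eventually allI norm_nonneg sub_closed) auto
  qed
  then show ?thesis using X(1) assms(2) by (auto simp: norm_closure_def)
qed

lemma convD: "cconv A X x \<Longrightarrow> e > 0 \<Longrightarrow> \<exists>N. \<forall>k\<ge>N. cnorm A (csub A (X k) x) < e"
  unfolding conv_iff LIMSEQ_def dist_real_def by fastforce

lemma subset_norm_closure:
  assumes D: "D \<subseteq> carrier A" shows "D \<subseteq> norm_closure D"
proof
  fix x assume x: "x \<in> D"
  then have "cnorm A (csub A x x) = 0" using D by (auto simp: sub_self norm_zero)
  then show "x \<in> norm_closure D" using x D by (intro norm_closureI) (auto intro!: bexI[of _ x])
qed

text \<open>The operations are continuous, so they pass to limits of sequences in \<open>D\<close>; a limit of such
  limits is approximated by elements of \<open>D\<close> up to \<open>e / 2 + e / 2\<close>.\<close>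

lemma closed_norm_closure:
  assumes D: "star_subalgebra D"
  shows "cstar_closed A (norm_closure D)"
proof -
  note D' = D[unfolded star_subalgebra_def]
  have DA: "D \<subseteq> carrier A" "\<And>x. x \<in> D \<Longrightarrow> x \<in> carrier A" using D' by auto
  have seq: "\<exists>X. (\<forall>k. X k \<in> D) \<and> (\<forall>k. X k \<in> carrier A) \<and> x \<in> carrier A \<and> cconv A X x"
    if "x \<in> norm_closure D" for x
    using that DA(2) unfolding norm_closure_def by blast
  have I: "x \<in> norm_closure D" if "x \<in> carrier A" "cconv A X x" "\<And>k. X k \<in> D" for x X
    using that unfolding norm_closure_def by blast
  show ?thesis
    unfolding cstar_closed_def
  proof (intro conjI ballI allI impI)
    show "norm_closure D \<subseteq> carrier A" by (auto simp: norm_closure_def)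
    show "czero A \<in> norm_closure D" using subset_norm_closure[OF DA(1)] D' by blast
  next
    fix x y assume xy: "x \<in> norm_closure D" "y \<in> norm_closure D"
    obtain X where X: "\<forall>k. X k \<in> D" "\<forall>k. X k \<in> carrier A" "x \<in> carrier A" "cconv A X x"
      using seq[OF xy(1)] by blast
    obtain Y where Y: "\<forall>k. Y k \<in> D" "\<forall>k. Y k \<in> carrier A" "y \<in> carrier A" "cconv A Y y"
      using seq[OF xy(2)] by blast
    show "cadd A x y \<in> norm_closure D"
      by (rule I[OF add_closed conv_add[of X Y]]) (use X Y D' in auto)
    show "cmul A x y \<in> norm_closure D"
      by (rule I[OF mul_closed conv_mul[of X Y]]) (use X Y D' in auto)
  next
    fix x a assume x: "x \<in> norm_closure D"
    obtain X where X: "\<forall>k. X k \<in> D" "\<forall>k. X k \<in> carrier A" "x \<in> carrier A" "cconv A X x"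
      using seq[OF x] by blast
    show "cadj A x \<in> norm_closure D"
      by (rule I[OF adj_closed conv_adj[of X]]) (use X D' in auto)
    show "csmul A a x \<in> norm_closure D"
      by (rule I[OF smul_closed conv_smul[of X]]) (use X D' in auto)
  next
    fix X l assume X: "\<forall>k. X k \<in> norm_closure D" and l: "l \<in> carrier A" "cconv A X l"
    show "l \<in> norm_closure D"
    proof (rule norm_closureI[OF DA(1) l(1)])
      fix e :: real assume e: "e > 0"
      obtain k where k: "cnorm A (csub A (X k) l) < e / 2"
        using convD[OF l(2), of "e / 2"] e by auto
      obtain Y where Y: "\<forall>k. Y k \<in> D" "\<forall>k. Y k \<in> carrier A" "X k \<in> carrier A" "cconv A Y (X k)"
        using seq X by blast
      obtain j where j: "cnorm A (csub A (Y j) (X k)) < e / 2"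
        using convD[OF Y(4), of "e / 2"] e by auto
      have "cnorm A (csub A (Y j) l) < e"
        using norm_sub_triangle[of "Y j" "X k" l] Y(2,3) l(1) j k by force
      then show "\<exists>d\<in>D. cnorm A (csub A d l) < e" using Y(1) by blast
    qed
  qed
qed

lemma
  assumes G: "G \<subseteq> carrier A"
  defines "M \<equiv> carrier (cstar_generated A G)"
  shows generated_sub: "x \<in> M \<Longrightarrow> x \<in> carrier A"
    and generated_add: "x \<in> M \<Longrightarrow> y \<in> M \<Longrightarrow> cadd A x y \<in> M"
    and generated_smul: "x \<in> M \<Longrightarrow> csmul A a x \<in> M"
    and generated_mul: "x \<in> M \<Longrightarrow> y \<in> M \<Longrightarrow> cmul A x y \<in> M"
    and generated_adj: "x \<in> M \<Longrightarrow> cadj A x \<in> M"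
    and generated_zero: "czero A \<in> M"
  using generated_closed[OF G] unfolding cstar_closed_def M_def[symmetric] by (simp_all add: subset_eq)

lemma generated_csum:
  assumes G: "G \<subseteq> carrier A" and "finite K" "\<And>k. k \<in> K \<Longrightarrow> f k \<in> carrier (cstar_generated A G)"
  shows "csum A f K \<in> carrier (cstar_generated A G)"
  using assms(2,3)
proof (induction K)
  case empty
  show ?case using generated_zero[OF G] by (simp add: csum_empty)
next
  case (insert k K)
  have "csum A f (insert k K) = cadd A (f k) (csum A f K)"
    by (rule csum_insert) (use insert generated_sub[OF G] in auto)
  then show ?case using insert generated_add[OF G] by simp
qed

lemma generated_eqI:
  assumes "G \<subseteq> carrier A" "H \<subseteq> carrier A"
    and "G \<subseteq> carrier (cstar_generated A H)" "H \<subseteq> carrier (cstar_generated A G)"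
  shows "cstar_generated A G = cstar_generated A H"
proof -
  have "carrier (cstar_generated A G) = carrier (cstar_generated A H)"
    using generated_least[OF generated_closed[OF assms(2)] assms(3)]
      generated_least[OF generated_closed[OF assms(1)] assms(4)] by blast
  then show ?thesis by (simp add: cstar_generated_def)
qed

end

section \<open>Isometric *-homomorphisms\<close>

locale contractive_star_hom = A: cstar_algebra A + B: cstar_algebra B
  for A :: "'a cstar" and B :: "'b cstar" +
  fixes \<phi> :: "'a \<Rightarrow> 'b"
  assumes hom: "star_hom A B \<phi>"
    and contractive: "x \<in> carrier A \<Longrightarrow> cnorm B (\<phi> x) \<le> cnorm A x"
begin

lemma hom_closed: "x \<in> carrier A \<Longrightarrow> \<phi> x \<in> carrier B"
  and hom_add: "x \<in> carrier A \<Longrightarrow> y \<in> carrier A \<Longrightarrow> \<phi> (cadd A x y) = cadd B (\<phi> x) (\<phi> y)"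
  and hom_smul: "x \<in> carrier A \<Longrightarrow> \<phi> (csmul A a x) = csmul B a (\<phi> x)"
  and hom_mul: "x \<in> carrier A \<Longrightarrow> y \<in> carrier A \<Longrightarrow> \<phi> (cmul A x y) = cmul B (\<phi> x) (\<phi> y)"
  and hom_adj: "x \<in> carrier A \<Longrightarrow> \<phi> (cadj A x) = cadj B (\<phi> x)"
  using hom unfolding star_hom_def by auto

lemma hom_zero: "\<phi> (czero A) = czero B"
  by (rule star_hom_zero[OF A.cstar_algebra_axioms B.cstar_algebra_axioms hom])

lemma hom_csum:
  assumes "finite K" "\<And>k. k \<in> K \<Longrightarrow> f k \<in> carrier A"
  shows "\<phi> (csum A f K) = csum B (\<lambda>k. \<phi> (f k)) K"
  by (rule star_hom_csum[OF A.cstar_algebra_axioms B.cstar_algebra_axioms hom]) (fact assms)+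

lemma hom_sub: "x \<in> carrier A \<Longrightarrow> y \<in> carrier A \<Longrightarrow> \<phi> (csub A x y) = csub B (\<phi> x) (\<phi> y)"
  by (simp add: csub_def hom_add hom_smul A.smul_closed)

lemma hom_conv:
  assumes "\<And>k. X k \<in> carrier A" "x \<in> carrier A" "cconv A X x"
  shows "cconv B (\<lambda>k. \<phi> (X k)) (\<phi> x)"
  unfolding B.conv_iff
proof (rule tendsto_sandwich[OF _ _ tendsto_const])
  show "(\<lambda>k. cnorm A (csub A (X k) x)) \<longlonglongrightarrow> 0" using assms(3) by (simp add: A.conv_iff)
qed (use assms(1,2) in \<open>auto intro!: always_eventually B.norm_nonneg B.sub_closed hom_closed
    simp: hom_sub[symmetric] contractive A.sub_closed\<close>)

text \<open>By the C*-identity a lower bound with a slowly growing constant improves to one with constant 1: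
  passing from \<open>x\<close> to \<open>x\<^sup>* x\<close> squares both norms, so after \<open>m\<close> steps the bound reads
  \<open>\<parallel>x\<parallel>\<^bsup>N\<^esup> \<le> C (N L + 1) \<parallel>\<phi> x\<parallel>\<^bsup>N\<^esup>\<close> with \<open>N = 2\<^bsup>m\<^esup>\<close>, and the \<open>N\<close>-th root of the
  constant tends to 1.\<close>

lemma isometric_of_linear_growth:
  assumes V: "\<And>L x. x \<in> V L \<Longrightarrow> x \<in> carrier A"
    "\<And>L x. x \<in> V L \<Longrightarrow> cmul A (cadj A x) x \<in> V (2 * L)"
    and bound: "\<And>L x. x \<in> V L \<Longrightarrow> cnorm A x \<le> C * (real L + 1) * cnorm B (\<phi> x)"
    and x: "x \<in> V L"
  shows "cnorm A x \<le> cnorm B (\<phi> x)"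
proof (rule ccontr)
  define q where "q y = cmul A (cadj A y) y" for y
  have iter: "(q ^^ m) x \<in> V (2 ^ m * L) \<and> cnorm A ((q ^^ m) x) = cnorm A x ^ (2 ^ m) \<and>
    cnorm B (\<phi> ((q ^^ m) x)) = cnorm B (\<phi> x) ^ (2 ^ m)" for m
  proof (induction m)
    case (Suc m)
    let ?y = "(q ^^ m) x"
    have y: "?y \<in> carrier A" using V(1) Suc by blast
    have sq: "(t ^ 2 ^ m)\<^sup>2 = t ^ 2 ^ Suc m" for t :: real
      by (simp add: power_mult[symmetric] mult.commute)
    have "cnorm A (q ?y) = (cnorm A ?y)\<^sup>2" using A.norm_cstar[OF y] by (simp only: q_def[of ?y])
    also have "\<dots> = cnorm A x ^ 2 ^ Suc m" using Suc sq[of "cnorm A x"] by presburger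
    finally have a: "cnorm A (q ?y) = cnorm A x ^ 2 ^ Suc m" .
    have "\<phi> (q ?y) = cmul B (cadj B (\<phi> ?y)) (\<phi> ?y)"
      using y by (simp add: q_def[of ?y] hom_mul hom_adj A.adj_closed)
    then have "cnorm B (\<phi> (q ?y)) = (cnorm B (\<phi> ?y))\<^sup>2"
      using B.norm_cstar[OF hom_closed[OF y]] by presburger
    also have "\<dots> = cnorm B (\<phi> x) ^ 2 ^ Suc m" using Suc sq[of "cnorm B (\<phi> x)"] by presburger
    finally have b: "cnorm B (\<phi> (q ?y)) = cnorm B (\<phi> x) ^ 2 ^ Suc m" .
    have "q ?y \<in> V (2 ^ Suc m * L)"
      using V(2)[of ?y "2 ^ m * L"] Suc by (simp add: q_def[of ?y] mult.assoc)
    then show ?case using a b unfolding funpow.simps comp_apply by blast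
  qed (use x in simp)
  define a b where "a = cnorm A x" and "b = cnorm B (\<phi> x)"
  assume "\<not> ?thesis"
  then have ab: "b < a" by (simp add: a_def b_def)
  have b0: "0 \<le> b" using B.norm_nonneg hom_closed V(1) x by (simp add: b_def)
  define r where "r = b / a"
  have r: "norm r < 1" using ab b0 by (simp add: r_def)
  have *: "1 \<le> C * (real L * (real N * r ^ N) + r ^ N)" if N: "N = 2 ^ m" for N m
  proof -
    have "a ^ N \<le> C * (real N * real L + 1) * b ^ N"
      using bound[of "(q ^^ m) x" "2 ^ m * L"] iter[of m] by (simp add: a_def b_def N)
    then have "1 \<le> C * (real N * real L + 1) * b ^ N / a ^ N"
      unfolding pos_le_divide_eq[OF zero_less_power[OF order_le_less_trans[OF b0 ab]]] by linarith
    also have "\<dots> = C * (real L * (real N * r ^ N) + r ^ N)"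
      unfolding r_def power_divide by (simp add: distrib_left distrib_right add_divide_distrib)
    finally show ?thesis .
  qed
  have "(\<lambda>N. C * (real L * (real N * r ^ N) + r ^ N)) \<longlonglongrightarrow> C * (real L * 0 + 0)"
    by (intro tendsto_intros powser_times_n_limit_0[OF r] LIMSEQ_power_zero[OF r])
  then have "\<forall>\<^sub>F N in sequentially. C * (real L * (real N * r ^ N) + r ^ N) < 1"
    by (rule order_tendstoD) simp
  then obtain N0 where N0: "\<And>N. N \<ge> N0 \<Longrightarrow> C * (real L * (real N * r ^ N) + r ^ N) < 1"
    by (auto simp: eventually_sequentially)
  have "N0 \<le> 2 ^ N0" by (simp add: less_imp_le)
  from N0[OF this] *[OF refl, of N0] show False by linarith
qed

lemma isometric_on_closure:
  assumes "\<And>x. x \<in> D \<Longrightarrow> cnorm A x \<le> cnorm B (\<phi> x)" "D \<subseteq> carrier A" "x \<in> A.norm_closure D"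
  shows "cnorm B (\<phi> x) = cnorm A x"
proof (rule antisym)
  obtain X where X: "\<forall>k. X k \<in> D" "x \<in> carrier A" "cconv A X x"
    using assms(3) by (auto simp: A.norm_closure_def)
  have XA: "X k \<in> carrier A" for k using X(1) assms(2) by blast
  show "cnorm A x \<le> cnorm B (\<phi> x)"
  proof (rule LIMSEQ_le)
    show "(\<lambda>k. cnorm A (X k)) \<longlonglongrightarrow> cnorm A x" by (rule A.conv_norm[OF XA X(2,3)])
    show "(\<lambda>k. cnorm B (\<phi> (X k))) \<longlonglongrightarrow> cnorm B (\<phi> x)"
      by (rule B.conv_norm[OF hom_closed[OF XA] hom_closed[OF X(2)] hom_conv[OF XA X(2,3)]])
  qed (use assms(1) X(1) in auto)
  show "cnorm B (\<phi> x) \<le> cnorm A x" by (rule contractive[OF X(2)])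
qed

text \<open>The image of an isometric *-homomorphism is complete, hence closed. So it is the
  C*-subalgebra that the images of generators generate.\<close>

lemma star_isomorphic_generated:
  assumes iso: "\<And>x. x \<in> carrier A \<Longrightarrow> cnorm B (\<phi> x) = cnorm A x"
    and G: "G \<subseteq> carrier A" "carrier (cstar_generated A G) = carrier A"
  shows "star_isomorphic (cstar_generated B (\<phi> ` G)) A"
proof -
  let ?H = "cstar_generated B (\<phi> ` G)"
  have GB: "\<phi> ` G \<subseteq> carrier B" using G(1) hom_closed by blast
  have inj: "inj_on \<phi> (carrier A)"
  proof (rule inj_onI)
    fix x y assume xy: "x \<in> carrier A" "y \<in> carrier A" "\<phi> x = \<phi> y"
    then have "cnorm A (csub A x y) = 0"
      using iso[of "csub A x y"] by (simp add: A.sub_closed hom_sub B.sub_self hom_closed B.norm_zero)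
    then show "x = y" using A.norm_sub_eq_zero xy by blast
  qed
  have "cstar_closed B (\<phi> ` carrier A)"
    unfolding cstar_closed_def
  proof (intro conjI ballI allI impI)
    fix X l assume X: "\<forall>k. X k \<in> \<phi> ` carrier A" and l: "l \<in> carrier B" "cconv B X l"
    from X have "\<forall>k. \<exists>y\<in>carrier A. X k = \<phi> y" by blast
    then obtain Y where Y: "\<And>k. Y k \<in> carrier A" "\<And>k. X k = \<phi> (Y k)" by metis
    have "\<exists>y\<in>carrier A. cconv A Y y"
    proof (rule A.norm_complete[OF Y(1)])
      fix e :: real assume e: "e > 0"
      obtain N where N: "\<forall>k\<ge>N. cnorm B (csub B (X k) l) < e / 2"
        using B.convD[OF l(2), of "e / 2"] e by auto
      have "cnorm A (csub A (Y m) (Y k)) < e" if "m \<ge> N" "k \<ge> N" for m k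
      proof -
        have cl: "X m \<in> carrier B" "X k \<in> carrier B" using Y hom_closed by auto
        have "cnorm A (csub A (Y m) (Y k)) = cnorm B (csub B (X m) (X k))"
          using iso[of "csub A (Y m) (Y k)"] Y by (simp add: A.sub_closed hom_sub)
        also have "\<dots> < e"
          using B.norm_sub_triangle[OF cl(1) l(1) cl(2)] B.norm_sub_commute[OF cl(2) l(1)]
            N[rule_format, OF that(1)] N[rule_format, OF that(2)] by linarith
        finally show ?thesis .
      qed
      then show "\<exists>N. \<forall>m\<ge>N. \<forall>k\<ge>N. cnorm A (csub A (Y m) (Y k)) < e" by blast
    qed
    then obtain y where y: "y \<in> carrier A" "cconv A Y y" by blast
    have "cconv B X (\<phi> y)" using hom_conv[OF Y(1) y] Y(2) by presburger
    then have "l = \<phi> y"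
      using B.conv_unique[of X l "\<phi> y"] l y(1) Y hom_closed by auto
    then show "l \<in> \<phi> ` carrier A" using y(1) by blast
  next
    show "czero B \<in> \<phi> ` carrier A" using hom_zero A.zero_closed by (metis imageI)
  next
    fix x a assume "x \<in> \<phi> ` carrier A"
    then show "csmul B a x \<in> \<phi> ` carrier A" "cadj B x \<in> \<phi> ` carrier A"
      using A.smul_closed A.adj_closed by (auto simp: hom_smul[symmetric] hom_adj[symmetric])
  next
    fix x y assume "x \<in> \<phi> ` carrier A" "y \<in> \<phi> ` carrier A"
    then show "cadd B x y \<in> \<phi> ` carrier A" "cmul B x y \<in> \<phi> ` carrier A"
      using A.add_closed A.mul_closed by (auto simp: hom_add[symmetric] hom_mul[symmetric])
  qed (use hom_closed in auto)
  then have 1: "carrier ?H \<subseteq> \<phi> ` carrier A" by (rule B.generated_least) (use G(1) in blast)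
  note H' = B.generated_zero[OF GB] B.generated_add[OF GB] B.generated_smul[OF GB]
    B.generated_mul[OF GB] B.generated_adj[OF GB]
  have H_lim: "\<forall>X l. (\<forall>k. X k \<in> carrier ?H) \<longrightarrow> l \<in> carrier B \<longrightarrow> cconv B X l \<longrightarrow> l \<in> carrier ?H"
    using B.generated_closed[OF GB] unfolding cstar_closed_def by simp
  have "cstar_closed A {x \<in> carrier A. \<phi> x \<in> carrier ?H}"
    unfolding cstar_closed_def
  proof (intro conjI ballI allI impI)
    fix X l assume X: "\<forall>k. X k \<in> {x \<in> carrier A. \<phi> x \<in> carrier ?H}"
      and l: "l \<in> carrier A" "cconv A X l"
    have "cconv B (\<lambda>k. \<phi> (X k)) (\<phi> l)" by (rule hom_conv) (use X l in auto)
    then have "\<phi> l \<in> carrier ?H"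
      using H_lim[rule_format, of "\<lambda>k. \<phi> (X k)" "\<phi> l"] X hom_closed[OF l(1)] by simp
    then show "l \<in> {x \<in> carrier A. \<phi> x \<in> carrier ?H}" using l(1) by simp
  qed (use H' in \<open>auto simp: A.zero_closed hom_zero A.add_closed hom_add A.smul_closed hom_smul
      A.mul_closed hom_mul A.adj_closed hom_adj\<close>)
  then have "carrier (cstar_generated A G) \<subseteq> {x \<in> carrier A. \<phi> x \<in> carrier ?H}"
    by (rule A.generated_least) (use G(1) B.generated_superset in blast)
  then have img: "\<phi> ` carrier A = carrier ?H" using 1 G(2) by auto
  have bij: "bij_betw \<phi> (carrier A) (carrier ?H)" using inj img by (simp add: bij_betw_def)
  have ops: "cadd ?H = cadd B" "csmul ?H = csmul B" "cmul ?H = cmul B" "cadj ?H = cadj B"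
    by (simp_all add: cstar_generated_def)
  let ?\<psi> = "inv_into (carrier A) \<phi>"
  have bij': "bij_betw ?\<psi> (carrier ?H) (carrier A)" by (rule bij_betw_inv_into[OF bij])
  have \<psi>: "?\<psi> (\<phi> x) = x" if "x \<in> carrier A" for x using inj that by simp
  have "star_hom ?H A ?\<psi>"
    unfolding star_hom_def ops img[symmetric] ball_simps image_subset_iff
    by (simp add: \<psi> hom_add[symmetric] hom_smul[symmetric] hom_mul[symmetric] hom_adj[symmetric]
        A.add_closed A.smul_closed A.mul_closed A.adj_closed)
  then show ?thesis unfolding star_isomorphic_def using bij' by blast
qed

end

section \<open>The dense *-subalgebra of a Cuntz-Krieger family\<close>

locale CK_system = cstar_algebra A + fin_digraph F
  for A :: "'a cstar" and F :: "('v,'e) pre_digraph" +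
  fixes P :: "'v \<Rightarrow> 'a" and S :: "'e \<Rightarrow> 'a"
  assumes CK: "CK_family F A P S"
begin

abbreviation mul (infixl "\<cdot>" 70) where "x \<cdot> y \<equiv> cmul A x y"
abbreviation adj ("(_\<^sup>\<star>)" [1000] 999) where "x\<^sup>\<star> \<equiv> cadj A x"
abbreviation zero ("\<zero>") where "\<zero> \<equiv> czero A"

lemmas P_closed [simp] = CK_family_closed(1)[OF CK]
lemmas S_closed [simp] = CK_family_closed(2)[OF CK]
lemmas closed_simps [simp] = mul_closed adj_closed add_closed smul_closed zero_closed
lemmas zero_simps [simp] = mul_zero_left mul_zero_right adj_zero adj_adj

lemma P_adj [simp]: "x \<in> verts F \<Longrightarrow> (P x)\<^sup>\<star> = P x"
  and P_idem [simp]: "x \<in> verts F \<Longrightarrow> P x \<cdot> P x = P x"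
  and P_orth: "x \<in> verts F \<Longrightarrow> y \<in> verts F \<Longrightarrow> x \<noteq> y \<Longrightarrow> P x \<cdot> P y = \<zero>"
  and S_orth: "f \<in> arcs F \<Longrightarrow> g \<in> arcs F \<Longrightarrow> f \<noteq> g \<Longrightarrow> (S f)\<^sup>\<star> \<cdot> S g = \<zero>"
  and S_adj_S: "f \<in> arcs F \<Longrightarrow> (S f)\<^sup>\<star> \<cdot> S f = P (tail F f)"
  using CK_familyD(1,2,3,5,6)[OF CK] by simp_all

lemma S_S_adj_S: "f \<in> arcs F \<Longrightarrow> S f \<cdot> ((S f)\<^sup>\<star> \<cdot> S f) = S f"
  using CK_familyD(4)[OF CK] by (simp add: mul_assoc)

lemma S_P: "f \<in> arcs F \<Longrightarrow> S f \<cdot> P (tail F f) = S f"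
  using S_S_adj_S S_adj_S by simp

lemma adj_S_S: "f \<in> arcs F \<Longrightarrow> g \<in> arcs F \<Longrightarrow> (S f)\<^sup>\<star> \<cdot> S g = (if f = g then P (tail F f) else \<zero>)"
  using S_orth S_adj_S by simp

lemma P_csum:
  assumes "f \<in> arcs F"
  shows "P (head F f) = csum A (\<lambda>f. S f \<cdot> (S f)\<^sup>\<star>) {g \<in> arcs F. head F g = head F f}"
  by (subst CK_familyD(7)[OF CK]) (use assms in auto)

text \<open>Multiply \<open>P\<^bsub>r(f)\<^esub> = \<Sum> S\<^sub>g S\<^sub>g\<^sup>\<star>\<close> by \<open>S\<^sub>f\<close>: only the term \<open>g = f\<close> survives.\<close>

lemma P_head_S:
  assumes f: "f \<in> arcs F" shows "P (head F f) \<cdot> S f = S f"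
proof -
  let ?K = "{g \<in> arcs F. head F g = head F f}"
  have "P (head F f) \<cdot> S f = csum A (\<lambda>g. S g \<cdot> (S g)\<^sup>\<star> \<cdot> S f) ?K"
    unfolding P_csum[OF f] by (rule mul_csum) (use f in auto)
  also have "\<dots> = S f \<cdot> (S f)\<^sup>\<star> \<cdot> S f"
    by (rule csum_single) (use f in \<open>auto simp: mul_assoc S_orth\<close>)
  finally show ?thesis using f by (simp add: mul_assoc S_S_adj_S)
qed

lemma P_S:
  assumes "x \<in> verts F" "f \<in> arcs F"
  shows "P x \<cdot> S f = (if x = head F f then S f else \<zero>)"
proof -
  have "P x \<cdot> S f = (P x \<cdot> P (head F f)) \<cdot> S f" using assms by (simp add: mul_assoc P_head_S)
  then show ?thesis using assms by (simp add: P_head_S P_orth)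
qed

lemma P_P: "x \<in> verts F \<Longrightarrow> y \<in> verts F \<Longrightarrow> P x \<cdot> P y = (if x = y then P x else \<zero>)"
  by (simp add: P_orth)

lemma adj_S_P:
  assumes "x \<in> verts F" "f \<in> arcs F"
  shows "(S f)\<^sup>\<star> \<cdot> P x = (if x = head F f then (S f)\<^sup>\<star> else \<zero>)"
proof -
  have "(S f)\<^sup>\<star> \<cdot> P x = (P x \<cdot> S f)\<^sup>\<star>" using assms by (simp add: adj_mul)
  then show ?thesis using P_S[OF assms] by simp
qed

lemma P_adj_S:
  assumes "x \<in> verts F" "f \<in> arcs F"
  shows "P x \<cdot> (S f)\<^sup>\<star> = (if x = tail F f then (S f)\<^sup>\<star> else \<zero>)"
proof -
  have *: "P (tail F f) \<cdot> (S f)\<^sup>\<star> = (S f)\<^sup>\<star>"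
    using arg_cong[OF S_P[OF assms(2)], of "cadj A"] assms by (simp add: adj_mul)
  have "P x \<cdot> (S f)\<^sup>\<star> = P x \<cdot> P (tail F f) \<cdot> (S f)\<^sup>\<star>"
    using assms by (simp add: mul_assoc *)
  then show ?thesis using assms by (simp add: P_P *)
qed

text \<open>The same relations in front of a further factor, for products bracketed to the right.\<close>

lemma rel_assoc:
  assumes "y \<in> carrier A"
  shows "f \<in> arcs F \<Longrightarrow> g \<in> arcs F \<Longrightarrow>
      (S f)\<^sup>\<star> \<cdot> (S g \<cdot> y) = (if f = g then P (tail F f) \<cdot> y else \<zero>)"
    and "x \<in> verts F \<Longrightarrow> f \<in> arcs F \<Longrightarrow> P x \<cdot> (S f \<cdot> y) = (if x = head F f then S f \<cdot> y else \<zero>)"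
    and "x \<in> verts F \<Longrightarrow> z \<in> verts F \<Longrightarrow> P x \<cdot> (P z \<cdot> y) = (if x = z then P x \<cdot> y else \<zero>)"
    and "x \<in> verts F \<Longrightarrow> f \<in> arcs F \<Longrightarrow>
      (S f)\<^sup>\<star> \<cdot> (P x \<cdot> y) = (if x = head F f then (S f)\<^sup>\<star> \<cdot> y else \<zero>)"
    and "x \<in> verts F \<Longrightarrow> f \<in> arcs F \<Longrightarrow>
      P x \<cdot> ((S f)\<^sup>\<star> \<cdot> y) = (if x = tail F f then (S f)\<^sup>\<star> \<cdot> y else \<zero>)"
    and "f \<in> arcs F \<Longrightarrow> S f \<cdot> (P (tail F f) \<cdot> y) = S f \<cdot> y"
  using assms by (simp_all add: mul_assoc[symmetric] adj_S_S P_S P_P adj_S_P P_adj_S S_P)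

lemmas CK_simps = mul_assoc rel_assoc adj_S_S P_S P_P adj_S_P P_adj_S S_P adj_mul

definition sources :: "'v set" where
  "sources = {x \<in> verts F. \<forall>f\<in>arcs F. head F f \<noteq> x}"

lemma sources [simp]: "x \<in> sources \<Longrightarrow> x \<in> verts F"
    "x \<in> sources \<Longrightarrow> f \<in> arcs F \<Longrightarrow> head F f \<noteq> x"
  and finite_sources [simp]: "finite sources"
  by (auto simp: sources_def)

lemma sources_head [simp]: "x \<in> sources \<Longrightarrow> f \<in> arcs F \<Longrightarrow> (x = head F f) = False"
  using sources(2) by metis

text \<open>In path notation \<open>core i\<close> is spanned by the \<open>S\<^bsub>\<mu>\<^esub> S\<^bsub>\<nu>\<^esub>\<^sup>\<star>\<close> where \<open>\<mu>\<close> and \<open>\<nu>\<close> have the same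
  length and the same source, and this length is \<open>i\<close>, or it is less than \<open>i\<close> and the source is a
  vertex that receives no edge. Such products are matrix units, because no path of this kind
  extends another one at its source. The recursion allows induction on \<open>i\<close> without mention of
  paths.\<close>

primrec core_gens :: "nat \<Rightarrow> 'a set" where
  "core_gens 0 = P ` verts F"
| "core_gens (Suc i) = {S f \<cdot> c \<cdot> (S g)\<^sup>\<star> |f g c. f \<in> arcs F \<and> g \<in> arcs F \<and> c \<in> lspan A (core_gens i)}
    \<union> P ` sources"

declare core_gens.simps(2) [simp del]

abbreviation core :: "nat \<Rightarrow> 'a set" where "core i \<equiv> lspan A (core_gens i)"

lemma core_gens_SucE:
  assumes "z \<in> core_gens (Suc i)"
  obtains f g c where "f \<in> arcs F" "g \<in> arcs F" "c \<in> core i" "z = S f \<cdot> c \<cdot> (S g)\<^sup>\<star>"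
    | x where "x \<in> sources" "z = P x"
  using assms by (auto simp: core_gens.simps(2))

lemma core_gens_closed: "core_gens i \<subseteq> carrier A"
proof (induction i)
  case (Suc i)
  show ?case using lspan_closed[OF _ Suc] by (auto elim!: core_gens_SucE)
qed auto

lemma core_closed: "c \<in> core i \<Longrightarrow> c \<in> carrier A"
  using lspan_closed core_gens_closed by blast

lemma core_SucI: "c \<in> core i \<Longrightarrow> f \<in> arcs F \<Longrightarrow> g \<in> arcs F \<Longrightarrow> S f \<cdot> c \<cdot> (S g)\<^sup>\<star> \<in> core (Suc i)"
  by (rule lspan.gen) (auto simp: core_gens.simps(2))

text \<open>At a vertex that receives edges, the equation \<open>P\<^sub>x = \<Sum> S\<^sub>f P\<^bsub>s(f)\<^esub> S\<^sub>f\<^sup>\<star>\<close> moves the projection one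
  level up; at the other vertices the projection is a generator at every level.\<close>

lemma P_in_core: "x \<in> verts F \<Longrightarrow> P x \<in> core i"
proof (induction i arbitrary: x)
  case 0
  then show ?case by (intro lspan.gen) simp
next
  case (Suc i)
  show ?case
  proof (cases "x \<in> sources")
    case True
    then show ?thesis by (intro lspan.gen) (simp add: core_gens.simps(2))
  next
    case False
    then obtain f where f: "f \<in> arcs F" "head F f = x"
      using Suc.prems unfolding sources_def by blast
    have "csum A (\<lambda>f. S f \<cdot> (S f)\<^sup>\<star>) {g \<in> arcs F. head F g = head F f} \<in> core (Suc i)"
    proof (rule csum_lspan[OF core_gens_closed])
      fix g assume "g \<in> {g \<in> arcs F. head F g = head F f}"
      then have g: "g \<in> arcs F" by simp
      then have "S g \<cdot> P (tail F g) \<cdot> (S g)\<^sup>\<star> \<in> core (Suc i)" by (intro core_SucI Suc.IH) auto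
      then show "S g \<cdot> (S g)\<^sup>\<star> \<in> core (Suc i)" using g by (simp only: S_P)
    qed simp
    then show ?thesis using P_csum[OF f(1)] f(2) by simp
  qed
qed

lemma core_Suc_mono: "core i \<subseteq> core (Suc i)"
proof (induction i)
  case 0
  show ?case by (rule lspan_least) (use P_in_core[of _ "Suc 0"] in auto)
next
  case (Suc i)
  show ?case
    by (rule lspan_least) (use Suc core_SucI P_in_core in \<open>blast elim: core_gens_SucE dest: sources(1)\<close>)
qed

lemma core_mono: "i \<le> j \<Longrightarrow> core i \<subseteq> core j"
  by (rule lift_Suc_mono_le[of core]) (rule core_Suc_mono)

lemma core_adj: "c \<in> core i \<Longrightarrow> c\<^sup>\<star> \<in> core i"
proof (induction i arbitrary: c)
  case 0
  show ?case by (rule lspan_adj[OF 0 core_gens_closed]) (auto intro: P_in_core[of _ 0, simplified])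
next
  case (Suc i)
  show ?case
  proof (rule lspan_adj[OF Suc.prems core_gens_closed])
    fix g assume "g \<in> core_gens (Suc i)"
    then show "g\<^sup>\<star> \<in> core (Suc i)"
    proof (cases rule: core_gens_SucE)
      case (1 f h c)
      then have "g\<^sup>\<star> = S h \<cdot> c\<^sup>\<star> \<cdot> (S f)\<^sup>\<star>" using core_closed by (simp add: adj_mul mul_assoc)
      then show ?thesis using core_SucI[OF Suc.IH[OF 1(3)]] 1 by simp
    next
      case (2 x)
      then show ?thesis using P_in_core[of x "Suc i"] by simp
    qed
  qed
qed

lemma core_mul: "b \<in> core i \<Longrightarrow> c \<in> core i \<Longrightarrow> b \<cdot> c \<in> core i"
proof (induction i arbitrary: b c)
  case 0
  have gens: "y \<cdot> z \<in> core 0" if "y \<in> core_gens 0" "z \<in> core_gens 0" for y z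
    using that P_in_core[of _ 0] by (auto simp: P_P lspan.zero)
  then have "b \<cdot> z \<in> core 0" if "z \<in> core_gens 0" for z
    using gens lspan_mul_right[OF 0(1) core_gens_closed, of z] that core_gens_closed[of 0] by blast
  then show ?case
    by (rule lspan_mul_left[OF 0(2) core_gens_closed core_closed[OF 0(1)]])
next
  case (Suc i)
  have gens: "y \<cdot> z \<in> core (Suc i)" if y: "y \<in> core_gens (Suc i)" and z: "z \<in> core_gens (Suc i)" for y z
  proof -
    from y show ?thesis
    proof (cases rule: core_gens_SucE)
      case (1 f g b)
      note y = this
      from z show ?thesis
      proof (cases rule: core_gens_SucE)
        case (1 h k c)
        have "y \<cdot> z = (if g = h then S f \<cdot> (b \<cdot> (P (tail F g) \<cdot> c)) \<cdot> (S k)\<^sup>\<star> else \<zero>)"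
          using y 1 core_closed by (simp add: CK_simps)
        moreover have "b \<cdot> (P (tail F g) \<cdot> c) \<in> core i" using Suc.IH y 1 P_in_core by simp
        then have "S f \<cdot> (b \<cdot> (P (tail F g) \<cdot> c)) \<cdot> (S k)\<^sup>\<star> \<in> core (Suc i)"
          using core_SucI y(1) 1(2) by blast
        ultimately show ?thesis by (simp only: lspan.zero split: if_split) simp
      next
        case (2 x)
        then have "y \<cdot> z = \<zero>" using y core_closed by (simp add: CK_simps)
        then show ?thesis by (simp add: lspan.zero)
      qed
    next
      case (2 x)
      note y = this
      from z have "y \<cdot> z = \<zero> \<or> y \<cdot> z = y"
        by (cases rule: core_gens_SucE) (use y core_closed in \<open>auto simp: CK_simps\<close>)
      then show ?thesis using y P_in_core[of _ "Suc i"] lspan.zero by auto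
    qed
  qed
  have "b \<cdot> z \<in> core (Suc i)" if "z \<in> core_gens (Suc i)" for z
    using gens lspan_mul_right[OF Suc.prems(1) core_gens_closed, of z] that
      core_gens_closed[of "Suc i"] by blast
  then show ?case
    by (rule lspan_mul_left[OF Suc.prems(2) core_gens_closed core_closed[OF Suc.prems(1)]])
qed

definition cores :: "'a set" where "cores = (\<Union>i. core i)"

lemma cores_closed: "c \<in> cores \<Longrightarrow> c \<in> carrier A"
  using core_closed by (auto simp: cores_def)

lemma cores_zero: "\<zero> \<in> cores"
  and cores_smul: "c \<in> cores \<Longrightarrow> csmul A a c \<in> cores"
  and cores_adj: "c \<in> cores \<Longrightarrow> c\<^sup>\<star> \<in> cores"
  and cores_P: "x \<in> verts F \<Longrightarrow> P x \<in> cores"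
  using P_in_core core_adj unfolding cores_def by (blast intro: lspan.intros)+

lemma cores_sandwich: "c \<in> cores \<Longrightarrow> f \<in> arcs F \<Longrightarrow> g \<in> arcs F \<Longrightarrow> S f \<cdot> c \<cdot> (S g)\<^sup>\<star> \<in> cores"
  using core_SucI unfolding cores_def by blast

lemma cores_common:
  assumes "b \<in> cores" "c \<in> cores" obtains i where "b \<in> core i" "c \<in> core i"
proof -
  obtain i j where "b \<in> core i" "c \<in> core j" using assms by (auto simp: cores_def)
  then show thesis using that[of "max i j"] core_mono[of i "max i j"] core_mono[of j "max i j"] by auto
qed

lemma cores_add: "b \<in> cores \<Longrightarrow> c \<in> cores \<Longrightarrow> cadd A b c \<in> cores"
  by (erule (1) cores_common) (auto simp: cores_def intro: lspan.add)

lemma cores_mul: "b \<in> cores \<Longrightarrow> c \<in> cores \<Longrightarrow> b \<cdot> c \<in> cores"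
  by (erule (1) cores_common) (auto simp: cores_def intro: core_mul)

text \<open>A product of generators in which the numbers of factors \<open>S\<close> and \<open>S\<^sup>\<star>\<close> differ by \<open>k\<close> is
  homogeneous of degree \<open>k\<close>. The normal form with an element of the core in the middle, all
  factors \<open>S\<close> on its left if \<open>k \<ge> 0\<close> and all factors \<open>S\<^sup>\<star>\<close> on its right if \<open>k \<le> 0\<close>, is what makes
  the elements of degree 0 coincide with the core.\<close>

inductive graded :: "int \<Rightarrow> 'a \<Rightarrow> bool" where
  core: "c \<in> cores \<Longrightarrow> graded 0 c"
| up: "graded k a \<Longrightarrow> 0 \<le> k \<Longrightarrow> f \<in> arcs F \<Longrightarrow> graded (k + 1) (S f \<cdot> a)"
| down: "graded k a \<Longrightarrow> k \<le> 0 \<Longrightarrow> f \<in> arcs F \<Longrightarrow> graded (k - 1) (a \<cdot> (S f)\<^sup>\<star>)"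
| zero: "graded k \<zero>"
| add: "graded k a \<Longrightarrow> graded k b \<Longrightarrow> graded k (cadd A a b)"
| smul: "graded k a \<Longrightarrow> graded k (csmul A \<alpha> a)"

lemma graded_closed: "graded k a \<Longrightarrow> a \<in> carrier A"
  by (induction rule: graded.induct) (auto simp: cores_closed)

lemma graded_0: "graded 0 a \<Longrightarrow> a \<in> cores"
  by (induction "0 :: int" a rule: graded.induct) (auto intro: cores_zero cores_add cores_smul)

lemma graded_adj: "graded k a \<Longrightarrow> graded (- k) (a\<^sup>\<star>)"
proof (induction rule: graded.induct)
  case (up k a f)
  have "graded (- k - 1) (a\<^sup>\<star> \<cdot> (S f)\<^sup>\<star>)" by (rule graded.down) (use up in auto)
  then show ?case using up graded_closed by (simp add: adj_mul)
next
  case (down k a f)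
  have "graded (- k + 1) (S f \<cdot> a\<^sup>\<star>)" by (rule graded.up) (use down in auto)
  then show ?case using down graded_closed by (simp add: adj_mul)
qed (auto simp: graded_closed adj_add adj_smul intro: cores_adj graded.intros)

lemma graded_P_mul: "graded k a \<Longrightarrow> x \<in> verts F \<Longrightarrow> graded k (P x \<cdot> a)"
proof (induction rule: graded.induct)
  case (up k a f)
  then show ?case using graded_closed by (auto simp: CK_simps intro: graded.intros)
next
  case (down k a f)
  then have "graded (k - 1) (P x \<cdot> a \<cdot> (S f)\<^sup>\<star>)" by (intro graded.down) auto
  then show ?case using down graded_closed by (simp add: mul_assoc)
qed (auto simp: graded_closed mul_add_right mul_smul_right intro: cores_mul cores_P graded.intros)

text \<open>The critical case is \<open>S\<^sub>f (a S\<^sub>g\<^sup>\<star>)\<close> with \<open>a\<close> of degree 0. There \<open>a\<close> is in the core, and the core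
  absorbs the pair \<open>S\<^sub>f\<close>, \<open>S\<^sub>g\<^sup>\<star>\<close>.\<close>

lemma graded_S_mul: "graded k a \<Longrightarrow> f \<in> arcs F \<Longrightarrow> graded (k + 1) (S f \<cdot> a)"
proof (induction rule: graded.induct)
  case (down k a g)
  have "graded k (S f \<cdot> a \<cdot> (S g)\<^sup>\<star>)"
  proof (cases "k = 0")
    case True
    then have "S f \<cdot> a \<cdot> (S g)\<^sup>\<star> \<in> cores" using down graded_0 cores_sandwich by blast
    then show ?thesis using True graded.core by simp
  next
    case False
    then have "graded (k + 1 - 1) (S f \<cdot> a \<cdot> (S g)\<^sup>\<star>)" using down by (intro graded.down) auto
    then show ?thesis by simp
  qed
  then show ?case using down graded_closed by (simp add: mul_assoc)
next
  case (core c)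
  then show ?case using graded.up[OF graded.core, of c f] by simp
next
  case (up k a g)
  then show ?case using graded.up[OF graded.up, of k a g f] by simp
qed (auto simp: graded_closed mul_add_right mul_smul_right intro: graded.intros)

lemma graded_adj_S: "f \<in> arcs F \<Longrightarrow> graded (- 1) ((S f)\<^sup>\<star>)"
  using graded.down[OF graded.core[OF cores_P], of "tail F f" f] by (simp add: CK_simps)

lemma core_adj_S_mul:
  assumes "c \<in> core i" "f \<in> arcs F" shows "graded (- 1) ((S f)\<^sup>\<star> \<cdot> c)"
  using assms(1)
proof induction
  case (gen c)
  consider x where "x \<in> verts F" "c = P x"
    | g h d j where "g \<in> arcs F" "h \<in> arcs F" "d \<in> core j" "c = S g \<cdot> d \<cdot> (S h)\<^sup>\<star>"
    using gen by (cases i) (auto elim!: core_gens_SucE dest: sources(1))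
  then show ?case
  proof cases
    case 1
    then show ?thesis using assms(2) by (auto simp: CK_simps graded_adj_S intro: graded.zero)
  next
    case 2
    then have "P (tail F f) \<cdot> d \<in> cores" using assms(2) by (intro cores_mul cores_P) (auto simp: cores_def)
    then have "graded (- 1) (P (tail F f) \<cdot> d \<cdot> (S h)\<^sup>\<star>)"
      using graded.down[OF graded.core, of "P (tail F f) \<cdot> d" h] 2 by simp
    then show ?thesis using 2 assms(2) core_closed by (auto simp: CK_simps intro: graded.zero)
  qed
qed (use assms(2) core_closed in \<open>auto simp: mul_add_right mul_smul_right intro: graded.intros\<close>)

lemma graded_adj_S_mul: "graded k a \<Longrightarrow> f \<in> arcs F \<Longrightarrow> graded (k - 1) ((S f)\<^sup>\<star> \<cdot> a)"
proof (induction rule: graded.induct)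
  case (core c)
  then show ?case using core_adj_S_mul by (auto simp: cores_def)
next
  case (up k a g)
  then show ?case using graded_closed graded_P_mul
    by (auto simp: CK_simps intro: graded.zero)
next
  case (down k a g)
  then have "graded (k - 1 - 1) ((S f)\<^sup>\<star> \<cdot> a \<cdot> (S g)\<^sup>\<star>)" by (intro graded.down) auto
  then show ?case using down graded_closed by (simp add: mul_assoc)
qed (auto simp: graded_closed mul_add_right mul_smul_right intro: graded.intros)

lemma core_graded_mul: "c \<in> core i \<Longrightarrow> graded l b \<Longrightarrow> graded l (c \<cdot> b)"
proof (induction i arbitrary: c b l)
  case 0
  from 0(1) show ?case
    by induction (use 0(2) core_closed[of _ 0] graded_closed in
      \<open>auto simp: mul_add_left mul_smul_left graded_P_mul intro: graded.intros\<close>)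
next
  case (Suc i)
  have b: "b \<in> carrier A" using Suc.prems(2) graded_closed by blast
  from Suc.prems(1) show ?case
  proof induction
    case (gen c)
    then show ?case
    proof (cases rule: core_gens_SucE)
      case (1 f g d)
      then have "graded (l - 1 + 1) (S f \<cdot> (d \<cdot> ((S g)\<^sup>\<star> \<cdot> b)))"
        by (intro graded_S_mul Suc.IH graded_adj_S_mul Suc.prems)
      then show ?thesis using 1 b core_closed by (simp add: mul_assoc)
    qed (use Suc.prems graded_P_mul in auto)
  next
    case (add x y)
    then show ?case using b core_closed[of _ "Suc i"] by (simp add: mul_add_left graded.add)
  next
    case (smul x a)
    then show ?case using b core_closed[of _ "Suc i"] by (simp add: mul_smul_left graded.smul)
  qed (use b in \<open>simp add: graded.zero\<close>)
qed

text \<open>The left factor is consumed from the outside by associativity, so only multiplication by a single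
  generator from the left has to respect the normal form.\<close>

lemma graded_mul: "graded k a \<Longrightarrow> graded l b \<Longrightarrow> graded (k + l) (a \<cdot> b)"
proof (induction arbitrary: l b rule: graded.induct)
  case (core c)
  then show ?case using core_graded_mul by (auto simp: cores_def)
next
  case (up k a f)
  then have "graded (k + l + 1) (S f \<cdot> (a \<cdot> b))" by (intro graded_S_mul) auto
  then show ?case using up graded_closed by (simp add: mul_assoc algebra_simps)
next
  case (down k a f)
  then have "graded (k + (l - 1)) (a \<cdot> ((S f)\<^sup>\<star> \<cdot> b))" by (intro down.IH graded_adj_S_mul)
  then show ?case using down graded_closed by (simp add: mul_assoc algebra_simps)
qed (auto simp: graded_closed mul_add_left mul_smul_left intro: graded.intros)

text \<open>The norm estimate for sums of homogeneous elements depends only on the number of degrees that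
  occur, which is at most \<open>2 L + 1\<close> here.\<close>

inductive filt :: "nat \<Rightarrow> 'a \<Rightarrow> bool" where
  graded: "graded k a \<Longrightarrow> \<bar>k\<bar> \<le> int L \<Longrightarrow> filt L a"
| add: "filt L a \<Longrightarrow> filt L b \<Longrightarrow> filt L (cadd A a b)"

lemma filt_closed: "filt L a \<Longrightarrow> a \<in> carrier A"
  by (induction rule: filt.induct) (auto simp: graded_closed)

lemma filt_mono: "filt L a \<Longrightarrow> L \<le> M \<Longrightarrow> filt M a"
  by (induction rule: filt.induct) (auto intro: filt.intros)

lemma filt_adj: "filt L a \<Longrightarrow> filt L (a\<^sup>\<star>)"
  by (induction rule: filt.induct)
    (auto simp: adj_add filt_closed intro: filt.intros graded_adj)

lemma filt_smul: "filt L a \<Longrightarrow> filt L (csmul A \<alpha> a)"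
  by (induction rule: filt.induct)
    (auto simp: smul_add_right filt_closed intro: filt.intros graded.smul)

lemma filt_mul: "filt L a \<Longrightarrow> filt M b \<Longrightarrow> filt (L + M) (a \<cdot> b)"
proof (induction arbitrary: b rule: filt.induct)
  case (graded k a L)
  from graded(3,1,2) show ?case
  proof (induction rule: filt.induct)
    case (graded l b M)
    then show ?case using filt.graded[OF graded_mul, of k a l b] by simp
  qed (auto simp: mul_add_right filt_closed graded_closed intro: filt.add)
qed (auto simp: mul_add_left filt_closed intro: filt.add)

lemma filt_decompose:
  assumes "filt L a"
  shows "\<exists>c. (\<forall>k. graded k (c k)) \<and> a = csum A c {- int L..int L}"
  using assms
proof (induction rule: filt.induct)
  case (graded k a L)
  define c where "c j = (if j = k then a else \<zero>)" for j
  have "csum A c {- int L..int L} = c k"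
    by (rule csum_single) (use graded graded_closed in \<open>auto simp: c_def\<close>)
  moreover have "\<forall>j. graded j (c j)" using graded by (auto simp: c_def intro: graded.zero)
  moreover have "c k = a" by (simp add: c_def)
  ultimately show ?case by (intro exI[of _ c]) simp
next
  case (add L a b)
  then obtain c d where cd: "\<forall>k. graded k (c k)" "a = csum A c {- int L..int L}"
    "\<forall>k. graded k (d k)" "b = csum A d {- int L..int L}" by blast
  have "cadd A a b = csum A (\<lambda>k. cadd A (c k) (d k)) {- int L..int L}"
    unfolding cd(2,4) by (rule csum_add[symmetric]) (use cd graded_closed in blast)+
  then show ?case using cd graded.add by (intro exI[of _ "\<lambda>k. cadd A (c k) (d k)"]) auto
qed

lemma star_subalgebra_filt: "star_subalgebra {a. \<exists>L. filt L a}"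
proof -
  have "\<exists>N. filt N (cadd A a b)" if "filt L a" "filt M b" for L M a b
    using filt.add[OF filt_mono[OF that(1)] filt_mono[OF that(2)], of "max L M"] by auto
  moreover have "filt 0 \<zero>" by (rule filt.graded[OF graded.zero[of 0]]) simp
  ultimately show ?thesis
    unfolding star_subalgebra_def by (auto intro: filt_closed filt_smul filt_mul filt_adj)
qed

lemma generators_filt: "P ` verts F \<union> S ` arcs F \<subseteq> {a. \<exists>L. filt L a}"
proof -
  have "filt 0 (P x)" if "x \<in> verts F" for x
    by (rule filt.graded[OF graded.core[OF cores_P]]) (use that in auto)
  moreover have "filt 1 (S f)" if f: "f \<in> arcs F" for f
  proof -
    have "graded 1 (S f)"
      using graded.up[OF graded.core[OF cores_P], of "tail F f" f] f by (simp add: S_P)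
    then show ?thesis by (rule filt.graded) simp
  qed
  ultimately show ?thesis by blast
qed

end

section \<open>Gauge-invariant uniqueness\<close>

context cstar_algebra
begin

text \<open>If \<open>\<Sum>\<^sub>u s\<^sub>u s\<^sub>u\<^sup>\<star>\<close> acts as a unit on \<open>a\<close>, then \<open>a\<close> is the sum of the
  \<open>s\<^sub>u (s\<^sub>u\<^sup>\<star> a s\<^sub>v) s\<^sub>v\<^sup>\<star>\<close>, so it is controlled by its matrix entries.\<close>

lemma norm_le_matrix_entries:
  assumes U: "finite U" and s: "\<And>u. u \<in> U \<Longrightarrow> s u \<in> carrier A" "\<And>u. u \<in> U \<Longrightarrow> cnorm A (s u) \<le> 1"
    and a: "a \<in> carrier A"
    and unit: "cmul A (csum A (\<lambda>u. cmul A (s u) (cadj A (s u))) U) a = a"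
      "cmul A a (csum A (\<lambda>u. cmul A (s u) (cadj A (s u))) U) = a"
  shows "cnorm A a \<le> (\<Sum>u\<in>U. \<Sum>v\<in>U. cnorm A (cmul A (cmul A (cadj A (s u)) a) (s v)))"
proof -
  let ?e = "csum A (\<lambda>u. cmul A (s u) (cadj A (s u))) U"
  note cl = mul_closed adj_closed csum_closed s(1) a
  have e: "?e \<in> carrier A" by (intro cl)
  have "cnorm A a = cnorm A (csum A (\<lambda>u. cmul A (cmul A (s u) (cadj A (s u))) a) U)"
    by (subst mul_csum(2)[symmetric]) (use U cl unit in auto)
  also have "\<dots> \<le> (\<Sum>u\<in>U. cnorm A (cmul A (cmul A (s u) (cadj A (s u))) a))"
    by (rule norm_csum_le) (use U cl in auto)
  also have "\<dots> \<le> (\<Sum>u\<in>U. \<Sum>v\<in>U. cnorm A (cmul A (cmul A (cadj A (s u)) a) (s v)))"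
  proof (rule sum_mono)
    fix u assume u: "u \<in> U"
    let ?b = "cmul A (cadj A (s u)) a"
    have b: "?b \<in> carrier A" using u cl by blast
    have "cnorm A (cmul A (cmul A (s u) (cadj A (s u))) a) = cnorm A (cmul A (s u) ?b)"
      using u cl by (simp add: mul_assoc)
    also have "\<dots> \<le> cnorm A (s u) * cnorm A ?b" by (rule norm_mul) (use u cl b in auto)
    also have "\<dots> \<le> cnorm A ?b" using s(2)[OF u] norm_nonneg[OF b] by (simp add: mult_left_le_one_le norm_nonneg s u)
    also have "?b = cmul A ?b ?e"
      using mul_assoc[OF adj_closed[OF s(1)[OF u]] a e] unit(2) by simp
    also have "\<dots> = csum A (\<lambda>v. cmul A ?b (cmul A (s v) (cadj A (s v)))) U"
      by (rule mul_csum) (use U u cl in auto)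
    also have "cnorm A \<dots> \<le> (\<Sum>v\<in>U. cnorm A (cmul A ?b (cmul A (s v) (cadj A (s v)))))"
      by (rule norm_csum_le) (use U u cl in auto)
    also have "\<dots> \<le> (\<Sum>v\<in>U. cnorm A (cmul A ?b (s v)))"
    proof (rule sum_mono)
      fix v assume v: "v \<in> U"
      have "cnorm A (cmul A ?b (cmul A (s v) (cadj A (s v)))) = cnorm A (cmul A (cmul A ?b (s v)) (cadj A (s v)))"
        using u v cl by (simp add: mul_assoc)
      also have "\<dots> \<le> cnorm A (cmul A ?b (s v)) * cnorm A (cadj A (s v))"
        by (rule norm_mul) (use u v cl in auto)
      also have "\<dots> \<le> cnorm A (cmul A ?b (s v))"
        using s(2)[OF v] norm_nonneg[OF mul_closed[OF b s(1)[OF v]]]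
        by (simp add: norm_adj s v mult_left_le)
      finally show "cnorm A (cmul A ?b (cmul A (s v) (cadj A (s v)))) \<le> cnorm A (cmul A ?b (s v))" .
    qed
    finally show "cnorm A (cmul A (cmul A (s u) (cadj A (s u))) a)
      \<le> (\<Sum>v\<in>U. cnorm A (cmul A ?b (s v)))" .
  qed
  finally show ?thesis .
qed

text \<open>The component of degree \<open>k\<close> is a mean of rotated elements \<open>z\<^bsup>-k\<^esup> \<beta>\<^sub>z(b)\<close>. The mean over
  the \<open>2\<^bsup>r\<^esup>\<close>-th roots of unity is taken one halving at a time: the mean of \<open>b\<close> and
  \<open>z\<^bsup>-k\<^esup> \<beta>\<^sub>z(b)\<close> for \<open>z = exp (\<pi> \<i> / 2\<^bsup>r\<^esup>)\<close> removes the degrees congruent to \<open>k\<close> modulo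
  \<open>2\<^bsup>r\<^esup>\<close> but not modulo \<open>2\<^bsup>r+1\<^esup>\<close>.\<close>

lemma norm_homogeneous_component_le:
  fixes \<beta> :: "complex \<Rightarrow> 'a \<Rightarrow> 'a" and c :: "int \<Rightarrow> 'a"
  assumes hom: "\<And>z. cmod z = 1 \<Longrightarrow> star_hom A A (\<beta> z)"
    and contr: "\<And>z x. cmod z = 1 \<Longrightarrow> x \<in> carrier A \<Longrightarrow> cnorm A (\<beta> z x) \<le> cnorm A x"
    and K: "finite K" "k \<in> K" and c: "\<And>l. c l \<in> carrier A"
    and degree: "\<And>z l. cmod z = 1 \<Longrightarrow> \<beta> z (c l) = csmul A (z powi l) (c l)"
  shows "cnorm A (c k) \<le> cnorm A (csum A c K)"
proof -
  define d where "d r l = (if (2 ^ r :: int) dvd l - k then c l else czero A)" for r :: nat and l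
  have d: "d r l \<in> carrier A" for r l using c zero_closed by (simp add: d_def)
  have dK: "csum A (d r) K \<in> carrier A" for r by (rule csum_closed) (rule d)
  have bound: "cnorm A (csum A (d r) K) \<le> cnorm A (csum A c K)" for r
  proof (induction r)
    case 0
    have "d 0 = c" by (auto simp: d_def)
    then show ?case by simp
  next
    case (Suc r)
    define z where "z = cis (pi / 2 ^ r)"
    have z: "cmod z = 1" and z0: "z \<noteq> 0" by (simp_all add: z_def)
    have "z ^ 2 ^ r = cis (real (2 ^ r) * (pi / 2 ^ r))" unfolding z_def by (rule Complex.DeMoivre)
    then have z2: "z ^ 2 ^ r = - 1" by simp
    have hz: "\<beta> z x \<in> carrier A" if "x \<in> carrier A" for x
      using hom[OF z] that by (auto simp: star_hom_def)
    have \<beta>d: "\<beta> z (d r l) = csmul A (z powi l) (d r l)" for l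
      using degree[OF z, of l] star_hom_zero[OF cstar_algebra_axioms cstar_algebra_axioms hom[OF z]]
      by (simp add: d_def smul_zero)
    have mean: "csmul A (1/2) (cadd A (d r l) (csmul A (z powi (- k)) (\<beta> z (d r l)))) = d (Suc r) l" for l
    proof -
      have "csmul A (1/2) (cadd A (d r l) (csmul A (z powi (- k)) (\<beta> z (d r l)))) =
          csmul A ((1 + z powi (l - k)) / 2) (d r l)"
      proof -
        have "z powi (- k) * z powi l = z powi (l - k)"
          using z0 by (simp add: power_int_add[symmetric])
        then show ?thesis
          using smul_add_left[OF d[of r l], of 1 "z powi (l - k)"]
            smul_smul[OF d[of r l], of "1 / 2" "1 + z powi (l - k)"]
          by (simp add: \<beta>d smul_smul d smul_one smul_closed)
      qed
      also have "\<dots> = d (Suc r) l"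
      proof (cases "(2 ^ r :: int) dvd l - k")
        case True
        then obtain m where m: "l - k = 2 ^ r * m" by blast
        have "z powi (l - k) = (z powi (int (2 ^ r))) powi m"
          unfolding m power_int_mult[symmetric] by simp
        also have "\<dots> = (- 1) powi m" unfolding power_int_of_nat z2 ..
        finally have *: "z powi (l - k) = (if even m then 1 else - 1)"
          by (simp add: power_int_minus_left)
        have "(2 ^ Suc r :: int) dvd l - k \<longleftrightarrow> even m" unfolding m by simp
        then show ?thesis using True c by (simp add: * d_def smul_one smul_0)
      next
        case False
        then have "\<not> (2 ^ Suc r :: int) dvd l - k" using dvd_trans le_imp_power_dvd[of r "Suc r"] by fastforce
        then show ?thesis using False by (simp add: d_def smul_zero)
      qed
      finally show ?thesis .
    qed
    let ?b = "csum A (d r) K"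
    have "\<beta> z ?b = csum A (\<lambda>l. \<beta> z (d r l)) K"
      by (rule star_hom_csum[OF cstar_algebra_axioms cstar_algebra_axioms hom[OF z]]) (use K d in auto)
    then have "csmul A (1/2) (cadd A ?b (csmul A (z powi (- k)) (\<beta> z ?b))) =
        csum A (\<lambda>l. csmul A (1/2) (cadd A (d r l) (csmul A (z powi (- k)) (\<beta> z (d r l))))) K"
      by (simp add: smul_csum K d hz smul_closed csum_add[symmetric] add_closed)
    also have "\<dots> = csum A (d (Suc r)) K" unfolding mean ..
    finally have "cnorm A (csum A (d (Suc r)) K) =
        cnorm A (csmul A (1/2) (cadd A ?b (csmul A (z powi (- k)) (\<beta> z ?b))))" by simp
    also have "\<dots> = cnorm A (cadd A ?b (csmul A (z powi (- k)) (\<beta> z ?b))) / 2"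
      by (subst norm_smul) (auto intro!: add_closed smul_closed hz dK)
    also have "\<dots> \<le> (cnorm A ?b + cnorm A (csmul A (z powi (- k)) (\<beta> z ?b))) / 2"
      by (intro divide_right_mono norm_triangle smul_closed hz dK) simp
    also have "\<dots> = (cnorm A ?b + cnorm A (\<beta> z ?b)) / 2"
      by (simp add: norm_smul hz dK norm_power_int z)
    also have "\<dots> \<le> cnorm A ?b" using contr[OF z dK, of r] by simp
    finally show ?case using Suc by simp
  qed
  define M where "M = Max ((\<lambda>l. \<bar>l - k\<bar>) ` K)"
  define r where "r = nat M"
  have "M \<le> int r" by (simp add: r_def)
  also have "int r < 2 ^ r" by (rule of_nat_less_two_power)
  finally have r: "M < 2 ^ r" .
  have "csum A (d r) K = d r k"
  proof (rule csum_single[OF K d])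
    fix l assume l: "l \<in> K" "l \<noteq> k"
    have "\<bar>l - k\<bar> \<le> M" using K l by (simp add: M_def)
    then have "\<bar>l - k\<bar> < 2 ^ r" using r by simp
    then have "\<not> 2 ^ r dvd l - k" using l(2) zdvd_not_zless[of "\<bar>l - k\<bar>" "2 ^ r"] by auto
    then show "d r l = czero A" by (simp add: d_def)
  qed
  then show ?thesis using bound[of r] by (simp add: d_def)
qed

end

text \<open>In this setting \<open>\<phi>\<close> turns out to preserve norms on the dense *-subalgebra.\<close>

locale gauged_CK_system = CK_system A F P S + contractive_star_hom A B \<phi>
  for A :: "'a cstar" and F :: "('v,'e) pre_digraph" and P :: "'v \<Rightarrow> 'a" and S :: "'e \<Rightarrow> 'a"
    and B :: "'b cstar" and \<phi> :: "'a \<Rightarrow> 'b" +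
  fixes \<beta> :: "complex \<Rightarrow> 'b \<Rightarrow> 'b"
  assumes nonzero: "x \<in> verts F \<Longrightarrow> \<phi> (P x) \<noteq> czero B"
    and gauge_hom: "cmod z = 1 \<Longrightarrow> star_hom B B (\<beta> z)"
    and gauge_contractive: "cmod z = 1 \<Longrightarrow> y \<in> carrier B \<Longrightarrow> cnorm B (\<beta> z y) \<le> cnorm B y"
    and gauge_P: "cmod z = 1 \<Longrightarrow> x \<in> verts F \<Longrightarrow> \<beta> z (\<phi> (P x)) = \<phi> (P x)"
    and gauge_S: "cmod z = 1 \<Longrightarrow> f \<in> arcs F \<Longrightarrow> \<beta> z (\<phi> (S f)) = csmul B z (\<phi> (S f))"
begin

lemma norm_P: "x \<in> verts F \<Longrightarrow> cnorm A (P x) \<le> 1"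
  and norm_S: "f \<in> arcs F \<Longrightarrow> cnorm A (S f) \<le> 1"
  using CK_family_norm_le[OF CK tail_in_verts] by auto

text \<open>A projection of norm less than 1 is 0 by the C*-identity.\<close>

lemma norm_hom_P:
  assumes "x \<in> verts F" shows "1 \<le> cnorm B (\<phi> (P x))"
proof -
  have cl: "\<phi> (P x) \<in> carrier B" using assms hom_closed by simp
  have "cmul B (cadj B (\<phi> (P x))) (\<phi> (P x)) = \<phi> (P x)"
    using assms by (simp add: hom_adj[symmetric] hom_mul[symmetric])
  then have "(cnorm B (\<phi> (P x)))\<^sup>2 = cnorm B (\<phi> (P x))" using B.norm_cstar[OF cl] by simp
  moreover have "cnorm B (\<phi> (P x)) \<noteq> 0" using B.norm_eq_zero cl nonzero assms by blast
  ultimately show ?thesis by (simp add: power2_eq_square)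
qed

text \<open>Matrix entries with respect to a finite frame give a bound with the constant \<open>|U|\<^sup>2\<close>, and
  since \<open>core i\<close> is a *-algebra the constant can be improved to 1.\<close>

lemma core_isometric_of_frame:
  assumes U: "finite U" and s: "\<And>u. u \<in> U \<Longrightarrow> s u \<in> carrier A" "\<And>u. u \<in> U \<Longrightarrow> cnorm A (s u) \<le> 1"
    and unit: "\<And>g. g \<in> core_gens i \<Longrightarrow> csum A (\<lambda>u. s u \<cdot> (s u)\<^sup>\<star>) U \<cdot> g = g"
    and entries: "\<And>c u v. c \<in> core i \<Longrightarrow> u \<in> U \<Longrightarrow> v \<in> U \<Longrightarrow>
      cnorm A ((s u)\<^sup>\<star> \<cdot> c \<cdot> s v) \<le> cnorm B (\<phi> ((s u)\<^sup>\<star> \<cdot> c \<cdot> s v))"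
    and c: "c \<in> core i"
  shows "cnorm A c \<le> cnorm B (\<phi> c)"
proof (rule isometric_of_linear_growth[where V = "\<lambda>_. core i" and C = "real (card U * card U)"])
  let ?e = "csum A (\<lambda>u. s u \<cdot> (s u)\<^sup>\<star>) U"
  have e: "?e \<in> carrier A" by (rule csum_closed) (use s in simp)
  have sa: "?e\<^sup>\<star> = csum A (\<lambda>u. (s u \<cdot> (s u)\<^sup>\<star>)\<^sup>\<star>) U"
    by (rule csum_map[where h = "cadj A", OF U]) (use s in \<open>auto simp: adj_add\<close>)
  also have "\<dots> = ?e" by (rule csum_cong) (use s in \<open>auto simp: adj_mul\<close>)
  finally have sa: "?e\<^sup>\<star> = ?e" .
  have left: "?e \<cdot> b = b" if "b \<in> core i" for b
    using that by induction (use e unit core_closed in \<open>auto simp: mul_add_right mul_smul_right\<close>)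
  have right: "b \<cdot> ?e = b" if b: "b \<in> core i" for b
    using arg_cong[OF left[OF core_adj[OF b]], of "cadj A"] e core_closed[OF b]
    by (simp add: adj_mul sa)
  fix L b assume b: "b \<in> core i"
  have bA: "b \<in> carrier A" by (rule core_closed[OF b])
  have entry: "cnorm A ((s u)\<^sup>\<star> \<cdot> b \<cdot> s v) \<le> cnorm B (\<phi> b)" if uv: "u \<in> U" "v \<in> U" for u v
  proof -
    have le1: "cnorm B (\<phi> (s w)) \<le> 1" if "w \<in> U" for w
      using contractive[OF s(1)[OF that]] s(2)[OF that] by simp
    note cl = hom_closed[OF bA] hom_closed[OF s(1)[OF uv(1)]] hom_closed[OF s(1)[OF uv(2)]]
    have "cnorm B (\<phi> ((s u)\<^sup>\<star> \<cdot> b \<cdot> s v)) = cnorm B (cmul B (cmul B (cadj B (\<phi> (s u))) (\<phi> b)) (\<phi> (s v)))"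
      using uv s bA by (simp add: hom_mul hom_adj)
    also have "\<dots> \<le> cnorm B (cmul B (cadj B (\<phi> (s u))) (\<phi> b)) * cnorm B (\<phi> (s v))"
      by (intro B.norm_mul B.mul_closed B.adj_closed cl)
    also have "\<dots> \<le> (cnorm B (cadj B (\<phi> (s u))) * cnorm B (\<phi> b)) * 1"
      by (intro mult_mono le1 uv B.norm_mul B.mul_closed B.adj_closed cl B.norm_nonneg mult_nonneg_nonneg)
    also have "\<dots> \<le> cnorm B (\<phi> b)"
      using le1[OF uv(1)] B.norm_nonneg cl by (simp add: B.norm_adj mult_left_le_one_le)
    finally show ?thesis using entries[OF b uv] by linarith
  qed
  have "cnorm A b \<le> (\<Sum>u\<in>U. \<Sum>v\<in>U. cnorm A ((s u)\<^sup>\<star> \<cdot> b \<cdot> s v))"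
    by (rule norm_le_matrix_entries[OF U s bA left[OF b] right[OF b]])
  also have "\<dots> \<le> (\<Sum>u\<in>U. \<Sum>v\<in>U. cnorm B (\<phi> b))" by (intro sum_mono entry)
  also have "\<dots> = real (card U * card U) * cnorm B (\<phi> b)" by simp
  also have "\<dots> \<le> real (card U * card U) * (real L + 1) * cnorm B (\<phi> b)"
    using B.norm_nonneg[OF hom_closed[OF bA]] by (intro mult_right_mono) (simp_all add: mult_le_cancel_left1)
  finally show "cnorm A b \<le> real (card U * card U) * (real L + 1) * cnorm B (\<phi> b)" .
qed (use c core_mul core_adj core_closed in auto)

text \<open>At level 0 the frame consists of the vertex projections, and the entries \<open>P\<^sub>x c P\<^sub>y\<close> are multiples
  of \<open>P\<^sub>x\<close>, on which \<open>\<phi>\<close> is isometric since \<open>\<phi>(P\<^sub>x) \<noteq> 0\<close>. At level \<open>i + 1\<close> the frame consists of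
  the \<open>S\<^sub>f\<close> and the projections of the vertices that receive no edge, and all entries are in
  \<open>core i\<close>.\<close>

lemma norm_hom_core: "c \<in> core i \<Longrightarrow> cnorm A c \<le> cnorm B (\<phi> c)"
proof (induction i arbitrary: c)
  case 0
  show ?case
  proof (rule core_isometric_of_frame[OF _ _ _ _ _ 0])
    fix g assume "g \<in> core_gens 0"
    then obtain x where x: "x \<in> verts F" "g = P x" by auto
    have "csum A (\<lambda>x. P x \<cdot> (P x)\<^sup>\<star>) (verts F) \<cdot> g = csum A (\<lambda>y. P y \<cdot> (P y)\<^sup>\<star> \<cdot> g) (verts F)"
      by (rule mul_csum) (use x in auto)
    also have "\<dots> = P x \<cdot> (P x)\<^sup>\<star> \<cdot> g" by (rule csum_single) (use x in \<open>auto simp: P_P\<close>)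
    finally show "csum A (\<lambda>x. P x \<cdot> (P x)\<^sup>\<star>) (verts F) \<cdot> g = g" using x by simp
  next
    fix c x y assume c: "c \<in> core 0" and xy: "x \<in> verts F" "y \<in> verts F"
    have "(P x)\<^sup>\<star> \<cdot> c \<cdot> P y \<in> lspan A {P x}"
    proof (rule lspan_map[where h = "\<lambda>c. (P x)\<^sup>\<star> \<cdot> c \<cdot> P y", OF c core_gens_closed])
      fix g assume "g \<in> core_gens 0"
      then obtain z where "z \<in> verts F" "g = P z" by auto
      then show "(P x)\<^sup>\<star> \<cdot> g \<cdot> P y \<in> lspan A {P x}"
        using xy by (auto simp: CK_simps intro: lspan.intros)
    qed (use xy in \<open>auto simp: mul_add_left mul_add_right mul_smul_left mul_smul_right\<close>)
    then have "\<exists>\<alpha>. (P x)\<^sup>\<star> \<cdot> c \<cdot> P y = csmul A \<alpha> (P x)"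
    proof induction
      case zero
      show ?case using smul_0[of "P x"] xy by (intro exI[of _ 0]) simp
    next
      case (gen p)
      then show ?case using smul_one[of "P x"] xy by (intro exI[of _ 1]) simp
    next
      case (add p q)
      then obtain a b where "p = csmul A a (P x)" "q = csmul A b (P x)" by blast
      then show ?case using smul_add_left[of "P x" a b] xy by (intro exI[of _ "a + b"]) simp
    next
      case (smul p a)
      then obtain b where "p = csmul A b (P x)" by blast
      then show ?case using smul_smul[of "P x" a b] xy by (intro exI[of _ "a * b"]) simp
    qed
    then obtain \<alpha> where \<alpha>: "(P x)\<^sup>\<star> \<cdot> c \<cdot> P y = csmul A \<alpha> (P x)" by blast
    have "cmod \<alpha> * cnorm A (P x) \<le> cmod \<alpha> * cnorm B (\<phi> (P x))"
      using norm_P[OF xy(1)] norm_hom_P[OF xy(1)] by (intro mult_left_mono) auto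
    then show "cnorm A ((P x)\<^sup>\<star> \<cdot> c \<cdot> P y) \<le> cnorm B (\<phi> ((P x)\<^sup>\<star> \<cdot> c \<cdot> P y))"
      using xy by (simp only: \<alpha>) (simp add: norm_smul hom_smul B.norm_smul hom_closed)
  qed (simp_all add: norm_P)
next
  case (Suc i)
  define s where "s = case_sum S P"
  let ?U = "arcs F <+> sources"
  have s: "s u \<in> carrier A" "cnorm A (s u) \<le> 1" if "u \<in> ?U" for u
    using that norm_S norm_P by (auto simp: s_def)
  show ?case
  proof (rule core_isometric_of_frame[OF _ s _ _ Suc.prems])
    fix g assume g: "g \<in> core_gens (Suc i)"
    have gA: "g \<in> carrier A" using g core_gens_closed by blast
    have sum: "csum A (\<lambda>u. s u \<cdot> (s u)\<^sup>\<star>) ?U \<cdot> g = csum A (\<lambda>u. s u \<cdot> (s u)\<^sup>\<star> \<cdot> g) ?U"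
      by (rule mul_csum) (use s gA in auto)
    have single: "csum A (\<lambda>u. s u \<cdot> (s u)\<^sup>\<star> \<cdot> g) ?U = s w \<cdot> (s w)\<^sup>\<star> \<cdot> g"
      if "w \<in> ?U" "\<And>u. u \<in> ?U \<Longrightarrow> u \<noteq> w \<Longrightarrow> s u \<cdot> (s u)\<^sup>\<star> \<cdot> g = \<zero>" for w
      by (rule csum_single) (use that s gA in auto)
    show "csum A (\<lambda>u. s u \<cdot> (s u)\<^sup>\<star>) ?U \<cdot> g = g"
      using g
    proof (cases rule: core_gens_SucE)
      case (1 f h c)
      have "csum A (\<lambda>u. s u \<cdot> (s u)\<^sup>\<star> \<cdot> g) ?U = s (Inl f) \<cdot> (s (Inl f))\<^sup>\<star> \<cdot> g"
        by (rule single) (use 1 core_closed in \<open>auto simp: s_def CK_simps split: if_splits\<close>)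
      then show ?thesis
        unfolding sum using 1 core_closed by (simp add: s_def CK_simps)
    next
      case (2 x)
      have "csum A (\<lambda>u. s u \<cdot> (s u)\<^sup>\<star> \<cdot> g) ?U = s (Inr x) \<cdot> (s (Inr x))\<^sup>\<star> \<cdot> g"
        by (rule single) (use 2 in \<open>auto simp: s_def CK_simps split: if_splits\<close>)
      then show ?thesis
        unfolding sum using 2 by (simp add: s_def CK_simps)
    qed
  next
    fix c u v assume c: "c \<in> core (Suc i)" and uv: "u \<in> ?U" "v \<in> ?U"
    have "(s u)\<^sup>\<star> \<cdot> c \<cdot> s v \<in> core i"
    proof (rule lspan_map[where h = "\<lambda>c. (s u)\<^sup>\<star> \<cdot> c \<cdot> s v", OF c core_gens_closed])
      fix g assume "g \<in> core_gens (Suc i)"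
      then show "(s u)\<^sup>\<star> \<cdot> g \<cdot> s v \<in> core i"
      proof (cases rule: core_gens_SucE)
        case (1 f h d)
        have "P (tail F f) \<cdot> (d \<cdot> P (tail F h)) \<in> core i"
          using 1 by (intro core_mul P_in_core) auto
        then show ?thesis
          using uv 1 core_closed by (auto simp: s_def CK_simps lspan.zero)
      next
        case (2 x)
        then show ?thesis using uv P_in_core by (auto simp: s_def CK_simps lspan.zero)
      qed
    qed (use s uv in \<open>auto simp: mul_add_left mul_add_right mul_smul_left mul_smul_right\<close>)
    then show "cnorm A ((s u)\<^sup>\<star> \<cdot> c \<cdot> s v) \<le> cnorm B (\<phi> ((s u)\<^sup>\<star> \<cdot> c \<cdot> s v))" by (rule Suc.IH)
  qed (simp_all add: finite_Plus)
qed

text \<open>\<open>\<parallel>a\<parallel>\<^sup>2 = \<parallel>a\<^sup>\<star> a\<parallel>\<close>, and \<open>a\<^sup>\<star> a\<close> has degree 0.\<close>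

lemma norm_hom_graded:
  assumes "graded k a" shows "cnorm A a \<le> cnorm B (\<phi> a)"
proof (rule power2_le_imp_le)
  have a: "a \<in> carrier A" using assms graded_closed by blast
  have "graded 0 (a\<^sup>\<star> \<cdot> a)" using graded_mul[OF graded_adj[OF assms] assms] by simp
  then obtain i where "a\<^sup>\<star> \<cdot> a \<in> core i" using graded_0 by (auto simp: cores_def)
  then have "cnorm A (a\<^sup>\<star> \<cdot> a) \<le> cnorm B (\<phi> (a\<^sup>\<star> \<cdot> a))" by (rule norm_hom_core)
  then show "(cnorm A a)\<^sup>2 \<le> (cnorm B (\<phi> a))\<^sup>2"
    using a by (simp add: hom_mul hom_adj norm_cstar B.norm_cstar hom_closed)
  show "0 \<le> cnorm B (\<phi> a)" using a B.norm_nonneg hom_closed by blast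
qed

lemma
  assumes z: "cmod z = 1"
  shows gauge_add: "x \<in> carrier B \<Longrightarrow> y \<in> carrier B \<Longrightarrow> \<beta> z (cadd B x y) = cadd B (\<beta> z x) (\<beta> z y)"
    and gauge_smul: "x \<in> carrier B \<Longrightarrow> \<beta> z (csmul B a x) = csmul B a (\<beta> z x)"
    and gauge_mul: "x \<in> carrier B \<Longrightarrow> y \<in> carrier B \<Longrightarrow> \<beta> z (cmul B x y) = cmul B (\<beta> z x) (\<beta> z y)"
    and gauge_adj: "x \<in> carrier B \<Longrightarrow> \<beta> z (cadj B x) = cadj B (\<beta> z x)"
    and gauge_zero: "\<beta> z (czero B) = czero B"
  using gauge_hom[OF z] star_hom_zero[OF B.cstar_algebra_axioms B.cstar_algebra_axioms gauge_hom[OF z]]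
  unfolding star_hom_def by simp_all

text \<open>The factors \<open>z\<close> and \<open>cnj z\<close> from \<open>S\<^sub>f\<close> and \<open>S\<^sub>g\<^sup>\<star>\<close> cancel on the unit circle.\<close>

lemma gauge_sandwich:
  assumes z: "cmod z = 1" and fg: "f \<in> arcs F" "g \<in> arcs F" and c: "c \<in> carrier A"
    and fixed: "\<beta> z (\<phi> c) = \<phi> c"
  shows "\<beta> z (\<phi> (S f \<cdot> c \<cdot> (S g)\<^sup>\<star>)) = \<phi> (S f \<cdot> c \<cdot> (S g)\<^sup>\<star>)"
proof -
  have "z * cnj z = 1" using z complex_norm_square[of z] by simp
  then show ?thesis using assms
    by (simp add: gauge_mul gauge_adj gauge_S hom_mul hom_adj B.adj_smul B.mul_smul_left
        B.mul_smul_right B.smul_smul B.smul_one hom_closed B.mul_closed B.adj_closed B.smul_closed mult.commute)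
qed

lemma gauge_core: "cmod z = 1 \<Longrightarrow> c \<in> core i \<Longrightarrow> \<beta> z (\<phi> c) = \<phi> c"
proof (induction i arbitrary: c)
  case 0
  from 0(2) show ?case
    by induction (use 0(1) core_closed[of _ 0] in
      \<open>auto simp: gauge_P gauge_add gauge_smul gauge_zero hom_add hom_smul hom_zero hom_closed\<close>)
next
  case (Suc i)
  from Suc.prems(2) show ?case
  proof induction
    case (gen c)
    then show ?case
    proof (cases rule: core_gens_SucE)
      case (1 f h d)
      then show ?thesis using gauge_sandwich Suc.IH Suc.prems(1) core_closed by simp
    qed (use Suc.prems(1) gauge_P in auto)
  qed (use Suc.prems(1) core_closed[of _ "Suc i"] in
      \<open>auto simp: gauge_add gauge_smul gauge_zero hom_add hom_smul hom_zero hom_closed\<close>)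
qed

lemma gauge_graded:
  assumes "graded k a" and z: "cmod z = 1"
  shows "\<beta> z (\<phi> a) = csmul B (z powi k) (\<phi> a)"
  using assms(1)
proof induction
  case (core c)
  then show ?case using z gauge_core by (auto simp: cores_def B.smul_one hom_closed core_closed)
next
  case (up k a f)
  have "z \<noteq> 0" using z by auto
  then have "z powi (k + 1) = z * z powi k" by (simp add: power_int_add mult.commute)
  then show ?case
    using up z graded_closed[OF up(1)]
    by (simp add: gauge_mul gauge_S hom_mul B.mul_smul_left B.mul_smul_right B.smul_smul hom_closed
        B.mul_closed B.smul_closed mult.commute)
next
  case (down k a f)
  have "cnj z = inverse z" using z complex_norm_square[of z] by (simp add: inverse_unique)
  moreover have "z \<noteq> 0" using z by auto
  ultimately have "z powi (k - 1) = cnj z * z powi k"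
    by (simp add: power_int_diff divide_inverse mult.commute)
  then show ?case
    using down z graded_closed[OF down(1)]
    by (simp add: gauge_mul gauge_adj gauge_S hom_mul hom_adj B.adj_smul B.mul_smul_left
        B.mul_smul_right B.smul_smul hom_closed B.mul_closed B.adj_closed B.smul_closed)
next
  case (zero k)
  then show ?case using z by (simp add: gauge_zero hom_zero B.smul_zero)
next
  case (add k a b)
  then show ?case using z graded_closed
    by (simp add: gauge_add hom_add B.smul_add_right hom_closed)
next
  case (smul k a \<alpha>)
  then show ?case using z graded_closed
    by (simp add: gauge_smul hom_smul B.smul_smul hom_closed mult.commute)
qed

text \<open>An element \<open>a\<close> with homogeneous components of degrees \<open>-L, \<dots>, L\<close> is a sum of \<open>2 L + 1\<close> terms on
  which \<open>\<phi>\<close> is isometric and whose images are not larger than \<open>\<phi>(a)\<close>. The degrees of \<open>a\<^sup>\<star> a\<close> are at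
  most \<open>2 L\<close>, so the constant grows only linearly.\<close>

lemma norm_hom_filt:
  assumes "filt L a" shows "cnorm A a \<le> cnorm B (\<phi> a)"
proof (rule isometric_of_linear_growth[where V = "\<lambda>L. {a. filt L a}" and C = 2])
  fix L a assume a: "a \<in> {a. filt L a}"
  show "a \<in> carrier A" using a filt_closed by simp
  show "a\<^sup>\<star> \<cdot> a \<in> {a. filt (2 * L) a}" using a filt_mul[OF filt_adj, of L a L a] by (simp add: mult_2)
  obtain c where c: "\<And>k. graded k (c k)" "a = csum A c {- int L..int L}"
    using filt_decompose a by blast
  have cA: "c k \<in> carrier A" for k using c(1) graded_closed by blast
  have "cnorm A a \<le> (\<Sum>k\<in>{- int L..int L}. cnorm A (c k))"
    unfolding c(2) by (rule norm_csum_le) (use cA in auto)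
  also have "\<dots> \<le> (\<Sum>k\<in>{- int L..int L}. cnorm B (\<phi> a))"
  proof (rule sum_mono)
    fix k assume k: "k \<in> {- int L..int L}"
    have "cnorm A (c k) \<le> cnorm B (\<phi> (c k))" by (rule norm_hom_graded[OF c(1)])
    also have "\<dots> \<le> cnorm B (csum B (\<lambda>k. \<phi> (c k)) {- int L..int L})"
      by (rule B.norm_homogeneous_component_le[where \<beta> = \<beta> and c = "\<lambda>k. \<phi> (c k)"])
        (use k gauge_hom gauge_contractive hom_closed[OF cA] gauge_graded[OF c(1)] in auto)
    also have "csum B (\<lambda>k. \<phi> (c k)) {- int L..int L} = \<phi> a"
      unfolding c(2) by (rule hom_csum[symmetric]) (use cA in auto)
    finally show "cnorm A (c k) \<le> cnorm B (\<phi> a)" .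
  qed
  also have "\<dots> \<le> 2 * (real L + 1) * cnorm B (\<phi> a)"
  proof -
    have "0 \<le> cnorm B (\<phi> a)" using a filt_closed hom_closed B.norm_nonneg by blast
    then show ?thesis by (auto intro!: mult_right_mono)
  qed
  finally show "cnorm A a \<le> 2 * (real L + 1) * cnorm B (\<phi> a)" .
qed (use assms in simp)

end

lemma (in cstar_algebra) generated_generated:
  assumes G: "G \<subseteq> carrier A"
  shows "carrier (cstar_generated (cstar_generated A G) G) = carrier (cstar_generated A G)"
proof -
  let ?H = "cstar_generated A G"
  have H: "cstar_closed A (carrier ?H)" by (rule generated_closed[OF G])
  interpret H: cstar_algebra ?H by (rule generated_cstar_algebra[OF G])
  have GH: "G \<subseteq> carrier ?H" by (rule generated_superset)
  have ops: "czero ?H = czero A" "cadd ?H = cadd A" "csmul ?H = csmul A" "cmul ?H = cmul A"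
    "cadj ?H = cadj A" "cnorm ?H = cnorm A" by (simp_all add: cstar_generated_def)
  have conv: "cconv ?H = cconv A" unfolding cconv_def csub_def ops ..
  let ?M = "carrier (cstar_generated ?H G)"
  have M: "cstar_closed ?H ?M" by (rule H.generated_closed[OF GH])
  have M_sub: "?M \<subseteq> carrier ?H"
    and M_lim: "\<forall>X l. (\<forall>k. X k \<in> ?M) \<longrightarrow> l \<in> carrier ?H \<longrightarrow> cconv A X l \<longrightarrow> l \<in> ?M"
    using M unfolding cstar_closed_def conv by simp_all
  have H_sub: "carrier ?H \<subseteq> carrier A"
    and H_lim: "\<forall>X l. (\<forall>k. X k \<in> carrier ?H) \<longrightarrow> l \<in> carrier A \<longrightarrow> cconv A X l \<longrightarrow> l \<in> carrier ?H"
    using H unfolding cstar_closed_def by simp_all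
  have lim: "l \<in> ?M" if X: "\<forall>k. X k \<in> ?M" and l: "l \<in> carrier A" "cconv A X l" for X l
  proof -
    have "X k \<in> carrier ?H" for k using M_sub X[rule_format, of k] by (rule subsetD)
    then have "l \<in> carrier ?H" by (rule H_lim[rule_format, OF _ l])
    with X[rule_format] show ?thesis by (rule M_lim[rule_format, OF _ _ l(2)])
  qed
  have "cstar_closed A ?M"
    unfolding cstar_closed_def
  proof (intro conjI)
    show "?M \<subseteq> carrier A" using M_sub H_sub by (rule subset_trans)
    show "\<forall>X l. (\<forall>k. X k \<in> ?M) \<longrightarrow> l \<in> carrier A \<longrightarrow> cconv A X l \<longrightarrow> l \<in> ?M"
      by (intro allI impI, rule lim)
  qed (use M in \<open>simp_all add: cstar_closed_def ops\<close>)
  then show ?thesis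
    using generated_least[OF _ H.generated_superset] H.generated_least[OF H.cstar_closed_carrier GH]
    by blast
qed

text \<open>Universality provides a contractive *-homomorphism from the Cuntz-Krieger algebra that maps
  generators to generators. It is isometric on the dense *-subalgebra of the elements of bounded
  degree, hence everywhere.\<close>

theorem gauge_invariant_uniqueness:
  fixes B :: "'b cstar"
  assumes F: "fin_digraph F" and B: "cstar_algebra B" and CK: "CK_family F B Q T"
    and nonzero: "\<And>x. x \<in> verts F \<Longrightarrow> Q x \<noteq> czero B"
    and gauge_hom: "\<And>z. cmod z = 1 \<Longrightarrow> star_hom B B (\<beta> z)"
    and gauge_contractive: "\<And>z y. cmod z = 1 \<Longrightarrow> y \<in> carrier B \<Longrightarrow> cnorm B (\<beta> z y) \<le> cnorm B y"
    and gauge: "\<And>z x. cmod z = 1 \<Longrightarrow> x \<in> verts F \<Longrightarrow> \<beta> z (Q x) = Q x"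
      "\<And>z f. cmod z = 1 \<Longrightarrow> f \<in> arcs F \<Longrightarrow> \<beta> z (T f) = csmul B z (T f)"
  shows "star_isomorphic (cstar_generated B (Q ` verts F \<union> T ` arcs F)) (CK_algebra F)"
proof -
  let ?A = "CK_algebra F"
  let ?G = "CK_P F ` verts F \<union> CK_S F ` arcs F"
  obtain \<phi> where \<phi>: "star_hom ?A B \<phi>" "\<And>x. x \<in> verts F \<Longrightarrow> \<phi> (CK_P F x) = Q x"
    "\<And>f. f \<in> arcs F \<Longrightarrow> \<phi> (CK_S F f) = T f"
    "\<And>y. y \<in> carrier ?A \<Longrightarrow> cnorm B (\<phi> y) \<le> cnorm ?A y"
    using CK_algebra_universal[OF F B CK] by blast
  interpret fin_digraph F by fact
  interpret A: cstar_algebra ?A by (rule CK_algebra_cstar[OF F])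
  interpret B: cstar_algebra B by fact
  interpret gauged_CK_system ?A F "CK_P F" "CK_S F" B \<phi> \<beta>
    by unfold_locales (use \<phi> assms CK_algebra_family[OF F] in auto)
  have gen: "carrier (cstar_generated ?A ?G) = carrier ?A"
    unfolding CK_algebra_def
    by (rule cstar_algebra.generated_generated[OF CK_prod_algebra CK_gen_subset[OF F]])
  let ?D = "{a. \<exists>L. filt L a}"
  have D: "?D \<subseteq> carrier ?A" using filt_closed by blast
  have "carrier (cstar_generated ?A ?G) \<subseteq> A.norm_closure ?D"
    by (rule A.generated_least[OF A.closed_norm_closure[OF star_subalgebra_filt]
          subset_trans[OF generators_filt A.subset_norm_closure[OF D]]])
  then have "cnorm B (\<phi> x) = cnorm ?A x" if "x \<in> carrier ?A" for x
    using that gen D norm_hom_filt by (intro isometric_on_closure[of ?D]) auto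
  then have "star_isomorphic (cstar_generated B (\<phi> ` ?G)) ?A"
    by (rule star_isomorphic_generated[OF _ subset_trans[OF generators_filt D] gen])
  moreover have "\<phi> ` CK_P F ` verts F = Q ` verts F" "\<phi> ` CK_S F ` arcs F = T ` arcs F"
    unfolding image_image by (rule image_cong[OF refl], erule \<phi>)+
  ultimately show ?thesis by (simp add: image_Un)
qed

section \<open>The C*-algebra of bounded operators on \<open>\<ell>\<^sup>2\<close>\<close>

lemma le_of_mult_self_le: "x * x \<le> c * x \<Longrightarrow> 0 \<le> c \<Longrightarrow> 0 \<le> x \<Longrightarrow> x \<le> (c::real)"
  by (cases "x = 0") auto

text \<open>Norms in \<open>\<ell>\<^sup>2(X)\<close> are suprema of Euclidean norms over finite subsets, so estimates are
  reduced to finite sums.\<close>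

lemma ell2_off: "f \<in> ell2 X \<Longrightarrow> w \<notin> X \<Longrightarrow> f w = 0"
  by (simp add: ell2_def)

lemma ell2_norm_nonneg: "0 \<le> ell2_norm X f"
  by (simp add: ell2_norm_def infsum_nonneg)

lemma ell2_norm_sq: "(ell2_norm X f)\<^sup>2 = (\<Sum>\<^sub>\<infinity>w\<in>X. (cmod (f w))\<^sup>2)"
  by (simp add: ell2_norm_def infsum_nonneg)

lemma L2_set_le_ell2_norm:
  assumes "f \<in> ell2 X" "finite F" "F \<subseteq> X"
  shows "L2_set (\<lambda>w. cmod (f w)) F \<le> ell2_norm X f"
  unfolding L2_set_def ell2_norm_def
  by (intro real_sqrt_le_mono finite_sum_le_infsum) (use assms in \<open>auto simp: ell2_def\<close>)

lemma ell2_boundedI: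
  assumes "\<And>w. w \<notin> X \<Longrightarrow> f w = 0" and "0 \<le> c"
    and "\<And>F. finite F \<Longrightarrow> F \<subseteq> X \<Longrightarrow> L2_set (\<lambda>w. cmod (f w)) F \<le> c"
  shows "f \<in> ell2 X" and "ell2_norm X f \<le> c"
proof -
  have *: "(\<Sum>w\<in>F. (cmod (f w))\<^sup>2) \<le> c\<^sup>2" if "finite F" "F \<subseteq> X" for F
    using power_mono[OF assms(3)[OF that], of 2] by (simp add: L2_set_def sum_nonneg)
  have s: "(\<lambda>w. (cmod (f w))\<^sup>2) summable_on X"
    by (rule nonneg_bdd_above_summable_on) (auto intro!: bdd_aboveI2[of _ _ "c\<^sup>2"] *)
  then show "f \<in> ell2 X" using assms(1) by (simp add: ell2_def)
  have "(ell2_norm X f)\<^sup>2 \<le> c\<^sup>2" unfolding ell2_norm_sq by (rule infsum_le_finite_sums[OF s *])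
  then show "ell2_norm X f \<le> c" using assms(2) by (rule power2_le_imp_le)
qed

lemma
  assumes f: "f \<in> ell2 X" and g: "g \<in> ell2 X"
  shows ell2_add: "(\<lambda>w. f w + g w) \<in> ell2 X"
    and ell2_norm_triangle: "ell2_norm X (\<lambda>w. f w + g w) \<le> ell2_norm X f + ell2_norm X g"
proof -
  have "L2_set (\<lambda>w. cmod (f w + g w)) F \<le> ell2_norm X f + ell2_norm X g" if F: "finite F" "F \<subseteq> X" for F
  proof -
    have "L2_set (\<lambda>w. cmod (f w + g w)) F \<le> L2_set (\<lambda>w. cmod (f w) + cmod (g w)) F"
      by (rule L2_set_mono) (simp_all add: norm_triangle_ineq)
    also have "\<dots> \<le> L2_set (\<lambda>w. cmod (f w)) F + L2_set (\<lambda>w. cmod (g w)) F"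
      by (rule L2_set_triangle_ineq)
    also have "\<dots> \<le> ell2_norm X f + ell2_norm X g"
      by (intro add_mono L2_set_le_ell2_norm f g F)
    finally show ?thesis .
  qed
  then show "(\<lambda>w. f w + g w) \<in> ell2 X"
    "ell2_norm X (\<lambda>w. f w + g w) \<le> ell2_norm X f + ell2_norm X g"
    by (intro ell2_boundedI[where c = "ell2_norm X f + ell2_norm X g"];
        simp add: ell2_off[OF f] ell2_off[OF g] ell2_norm_nonneg add_nonneg_nonneg)+
qed

lemma ell2_smul: "f \<in> ell2 X \<Longrightarrow> (\<lambda>w. a * f w) \<in> ell2 X"
  by (auto simp: ell2_def norm_mult power_mult_distrib intro: summable_on_cmult_right)

lemma ell2_norm_smul: "ell2_norm X (\<lambda>w. a * f w) = cmod a * ell2_norm X f"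
  by (simp add: ell2_norm_def norm_mult power_mult_distrib infsum_cmult_right' real_sqrt_mult)

lemma ell2_zero [simp]: "(\<lambda>_. 0) \<in> ell2 X" and ell2_norm_zero [simp]: "ell2_norm X (\<lambda>_. 0) = 0"
  by (simp_all add: ell2_def ell2_norm_def)

lemma ell2_diff: "f \<in> ell2 X \<Longrightarrow> g \<in> ell2 X \<Longrightarrow> (\<lambda>w. f w - g w) \<in> ell2 X"
  using ell2_add[of f X "\<lambda>w. - 1 * g w"] ell2_smul[of g X "- 1"] by simp

lemma cmod_le_ell2_norm:
  assumes "f \<in> ell2 X" shows "cmod (f w) \<le> ell2_norm X f"
proof (cases "w \<in> X")
  case True
  then show ?thesis using L2_set_le_ell2_norm[OF assms, of "{w}"] by (simp add: L2_set_def)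
qed (simp add: ell2_off[OF assms] ell2_norm_nonneg)

lemma ell2_norm_eq_0: "f \<in> ell2 X \<Longrightarrow> ell2_norm X f = 0 \<Longrightarrow> f = (\<lambda>_. 0)"
  using cmod_le_ell2_norm by fastforce

lemma ell2_finite_support:
  assumes "finite F" "F \<subseteq> X" "\<And>w. w \<notin> F \<Longrightarrow> f w = 0"
  shows "f \<in> ell2 X" and "ell2_norm X f = L2_set (\<lambda>w. cmod (f w)) F"
proof -
  have "(\<lambda>w. (cmod (f w))\<^sup>2) summable_on X \<longleftrightarrow> (\<lambda>w. (cmod (f w))\<^sup>2) summable_on F"
    "(\<Sum>\<^sub>\<infinity>w\<in>X. (cmod (f w))\<^sup>2) = (\<Sum>\<^sub>\<infinity>w\<in>F. (cmod (f w))\<^sup>2)"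
    by (rule summable_on_cong_neutral infsum_cong_neutral; use assms in auto)+
  then show "f \<in> ell2 X" "ell2_norm X f = L2_set (\<lambda>w. cmod (f w)) F"
    using assms by (auto simp: ell2_def ell2_norm_def L2_set_def)
qed

lemma basis_vec_ell2: "w \<in> X \<Longrightarrow> basis_vec w \<in> ell2 X"
  by (rule ell2_finite_support(1)[of "{w}"]) (auto simp: basis_vec_def)

lemma ell2_inner_abs_summable:
  assumes f: "f \<in> ell2 X" and g: "g \<in> ell2 X"
  shows "(\<lambda>w. cmod (cnj (f w) * g w)) summable_on X"
    and "(\<Sum>\<^sub>\<infinity>w\<in>X. cmod (cnj (f w) * g w)) \<le> ell2_norm X f * ell2_norm X g"
proof -
  have *: "(\<Sum>w\<in>F. cmod (cnj (f w) * g w)) \<le> ell2_norm X f * ell2_norm X g"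
    if F: "finite F" "F \<subseteq> X" for F
  proof -
    have "(\<Sum>w\<in>F. cmod (cnj (f w) * g w)) = (\<Sum>w\<in>F. \<bar>cmod (f w)\<bar> * \<bar>cmod (g w)\<bar>)"
      by (simp add: norm_mult)
    also have "\<dots> \<le> L2_set (\<lambda>w. cmod (f w)) F * L2_set (\<lambda>w. cmod (g w)) F"
      by (rule L2_set_mult_ineq)
    also have "\<dots> \<le> ell2_norm X f * ell2_norm X g"
      by (intro mult_mono L2_set_le_ell2_norm f g F ell2_norm_nonneg L2_set_nonneg)
    finally show ?thesis .
  qed
  show s: "(\<lambda>w. cmod (cnj (f w) * g w)) summable_on X"
    unfolding abs_summable_iff_bdd_above by (auto intro!: bdd_aboveI2 *)
  show "(\<Sum>\<^sub>\<infinity>w\<in>X. cmod (cnj (f w) * g w)) \<le> ell2_norm X f * ell2_norm X g"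
    by (rule infsum_le_finite_sums[OF s *])
qed

lemma ell2_inner_summable: "f \<in> ell2 X \<Longrightarrow> g \<in> ell2 X \<Longrightarrow> (\<lambda>w. cnj (f w) * g w) summable_on X"
  by (rule abs_summable_summable[OF ell2_inner_abs_summable(1)])

lemma ell2_Cauchy_Schwarz:
  assumes "f \<in> ell2 X" "g \<in> ell2 X"
  shows "cmod (ell2_inner X f g) \<le> ell2_norm X f * ell2_norm X g"
  unfolding ell2_inner_def
  using norm_infsum_bound[OF ell2_inner_abs_summable(1)[OF assms]] ell2_inner_abs_summable(2)[OF assms]
  by linarith

lemma ell2_inner_add:
  assumes "f \<in> ell2 X" "g \<in> ell2 X" "h \<in> ell2 X"
  shows "ell2_inner X f (\<lambda>w. g w + h w) = ell2_inner X f g + ell2_inner X f h"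
  unfolding ell2_inner_def distrib_left
  by (rule infsum_add; rule ell2_inner_summable[OF assms(1)]; fact)

lemma ell2_inner_smul: "ell2_inner X f (\<lambda>w. a * g w) = a * ell2_inner X f g"
  unfolding ell2_inner_def mult.left_commute[of _ a] by (rule infsum_cmult_right')

lemma ell2_inner_cnj: "ell2_inner X g f = cnj (ell2_inner X f g)"
  unfolding ell2_inner_def infsum_cnj[symmetric] by (simp add: mult.commute)

lemma ell2_inner_diff:
  assumes "f \<in> ell2 X" "g \<in> ell2 X" "h \<in> ell2 X"
  shows "ell2_inner X f (\<lambda>w. g w - h w) = ell2_inner X f g - ell2_inner X f h"
  using ell2_inner_add[OF assms(1,2) ell2_smul[OF assms(3), of "- 1"]] ell2_inner_smul[of X f "- 1" h]
  by simp

lemma ell2_inner_zero [simp]: "ell2_inner X f (\<lambda>_. 0) = 0" "ell2_inner X (\<lambda>_. 0) f = 0"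
  by (simp_all add: ell2_inner_def)

lemma ell2_inner_self: "f \<in> ell2 X \<Longrightarrow> ell2_inner X f f = of_real ((ell2_norm X f)\<^sup>2)"
proof -
  have "ell2_inner X f f = (\<Sum>\<^sub>\<infinity>w\<in>X. of_real ((cmod (f w))\<^sup>2))"
    unfolding ell2_inner_def by (intro infsum_cong) (simp only: complex_norm_square mult.commute)
  also have "\<dots> = of_real (\<Sum>\<^sub>\<infinity>w\<in>X. (cmod (f w))\<^sup>2)" if "f \<in> ell2 X"
    using that by (intro infsumI has_sum_of_real has_sum_infsum) (simp add: ell2_def)
  finally show "f \<in> ell2 X \<Longrightarrow> ?thesis" by (simp add: ell2_norm_sq)
qed

lemma ell2_inner_basis_vec:
  assumes "w \<in> X" shows "ell2_inner X f (basis_vec w) = cnj (f w)"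
proof -
  have "ell2_inner X f (basis_vec w) = (\<Sum>\<^sub>\<infinity>u\<in>{w}. cnj (f u) * basis_vec w u)"
    unfolding ell2_inner_def by (rule infsum_cong_neutral) (use assms in \<open>auto simp: basis_vec_def\<close>)
  then show ?thesis by (simp add: basis_vec_def)
qed

lemma ell2_approx:
  assumes f: "f \<in> ell2 X" and e: "e > 0"
  shows "\<exists>F. finite F \<and> F \<subseteq> X \<and> ell2_norm X (\<lambda>w. f w - (if w \<in> F then f w else 0)) < e"
proof -
  have s: "(\<lambda>w. (cmod (f w))\<^sup>2) summable_on X" using f by (simp add: ell2_def)
  obtain F where F: "finite F" "F \<subseteq> X"
    "dist (\<Sum>w\<in>F. (cmod (f w))\<^sup>2) (\<Sum>\<^sub>\<infinity>w\<in>X. (cmod (f w))\<^sup>2) \<le> (e/2)\<^sup>2"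
    using infsum_finite_approximation[OF s, of "(e/2)\<^sup>2"] e by auto
  let ?g = "\<lambda>w. f w - (if w \<in> F then f w else 0)"
  have "ell2_norm X ?g \<le> e/2"
  proof (rule ell2_boundedI(2))
    fix H assume H: "finite H" "H \<subseteq> X"
    have "(\<Sum>w\<in>H. (cmod (?g w))\<^sup>2) = (\<Sum>w\<in>H - F. (cmod (f w))\<^sup>2)"
      by (rule sum.mono_neutral_cong_right) (use H in auto)
    also have "\<dots> = (\<Sum>w\<in>H \<union> F. (cmod (f w))\<^sup>2) - (\<Sum>w\<in>F. (cmod (f w))\<^sup>2)"
      using sum.subset_diff[of F "H \<union> F" "\<lambda>w. (cmod (f w))\<^sup>2"] H F(1) by (simp add: Un_Diff)
    also have "\<dots> \<le> (e/2)\<^sup>2"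
      using finite_sum_le_infsum[OF s, of "H \<union> F"] H F by (simp add: dist_real_def)
    finally have "sqrt (\<Sum>w\<in>H. (cmod (?g w))\<^sup>2) \<le> sqrt ((e/2)\<^sup>2)" by (rule real_sqrt_le_mono)
    then show "L2_set (\<lambda>w. cmod (?g w)) H \<le> e/2" using e by (simp add: L2_set_def)
  qed (use e ell2_off[OF f] in auto)
  then show ?thesis using F e by (intro exI[of _ F]) auto
qed

lemma bounded_opsD:
  assumes "T \<in> bounded_ops X"
  shows "f \<in> ell2 X \<Longrightarrow> T f \<in> ell2 X" "f \<notin> ell2 X \<Longrightarrow> T f = (\<lambda>_. 0)"
    "f \<in> ell2 X \<Longrightarrow> g \<in> ell2 X \<Longrightarrow> T (\<lambda>w. f w + g w) = (\<lambda>w. T f w + T g w)"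
    "f \<in> ell2 X \<Longrightarrow> T (\<lambda>w. a * f w) = (\<lambda>w. a * T f w)"
  using assms unfolding bounded_ops_def by blast+

lemma bounded_ops_range: "T \<in> bounded_ops X \<Longrightarrow> T f \<in> ell2 X"
  by (cases "f \<in> ell2 X") (simp_all add: bounded_opsD(1,2))

lemma bounded_ops_zero: "T \<in> bounded_ops X \<Longrightarrow> T (\<lambda>_. 0) = (\<lambda>_. 0)"
  using bounded_opsD(4)[of T X "\<lambda>_. 0" 0] by simp

lemma bounded_ops_bound:
  assumes "T \<in> bounded_ops X"
  obtains K where "0 \<le> K" "\<And>f. f \<in> ell2 X \<Longrightarrow> ell2_norm X (T f) \<le> K * ell2_norm X f"
proof -
  obtain K where K: "\<And>f. f \<in> ell2 X \<Longrightarrow> ell2_norm X (T f) \<le> K * ell2_norm X f"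
    using assms unfolding bounded_ops_def by blast
  have "ell2_norm X (T f) \<le> max 0 K * ell2_norm X f" if "f \<in> ell2 X" for f
    using K[OF that] mult_right_mono[of K "max 0 K" "ell2_norm X f"] ell2_norm_nonneg[of X f] by simp
  then show thesis by (intro that[of "max 0 K"]) auto
qed

lemma bounded_ops_diff:
  assumes T: "T \<in> bounded_ops X" and "f \<in> ell2 X" "g \<in> ell2 X"
  shows "T (\<lambda>w. f w - g w) = (\<lambda>w. T f w - T g w)"
  using bounded_opsD(3)[OF T assms(2) ell2_smul[OF assms(3), of "- 1"]] bounded_opsD(4)[OF T assms(3), of "- 1"]
  by simp

lemma bounded_ops_sum:
  assumes T: "T \<in> bounded_ops X" and "finite F" "\<And>i. i \<in> F \<Longrightarrow> g i \<in> ell2 X"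
  shows "(\<lambda>w. \<Sum>i\<in>F. a i * g i w) \<in> ell2 X \<and>
    T (\<lambda>w. \<Sum>i\<in>F. a i * g i w) = (\<lambda>w. \<Sum>i\<in>F. a i * T (g i) w)"
  using assms(2,3)
proof (induction F)
  case empty
  show ?case by (simp add: bounded_ops_zero[OF T])
next
  case (insert i F)
  then show ?case
    using bounded_opsD(3)[OF T ell2_smul[of "g i" X "a i"], of "\<lambda>w. \<Sum>i\<in>F. a i * g i w"]
      ell2_add[OF ell2_smul[of "g i" X "a i"], of "\<lambda>w. \<Sum>i\<in>F. a i * g i w"]
    by (simp add: bounded_opsD(4)[OF T])
qed

lemma truncation_eq_sum:
  "finite F \<Longrightarrow> (\<lambda>w. if w \<in> F then f w else 0) = (\<lambda>w. \<Sum>u\<in>F. f u * basis_vec u w)"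
  by (auto simp: basis_vec_def fun_eq_iff if_distrib[of "\<lambda>x. _ * x"] cong: if_cong)

lemma bounded_ops_truncation:
  assumes T: "T \<in> bounded_ops X" and F: "finite F" "F \<subseteq> X"
  shows "T (\<lambda>w. if w \<in> F then f w else 0) = (\<lambda>w. \<Sum>u\<in>F. f u * T (basis_vec u) w)"
proof -
  have "basis_vec u \<in> ell2 X" if "u \<in> F" for u
    by (rule basis_vec_ell2[OF subsetD[OF F(2) that]])
  then show ?thesis
    unfolding truncation_eq_sum[OF F(1)]
    by (rule bounded_ops_sum[OF T F(1), of basis_vec f, THEN conjunct2])
qed

text \<open>Both operators agree on finitely supported vectors, and these approximate every vector.\<close>

lemma bounded_ops_eqI:
  assumes S: "S \<in> bounded_ops X" and T: "T \<in> bounded_ops X"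
    and eq: "\<And>w. w \<in> X \<Longrightarrow> S (basis_vec w) = T (basis_vec w)"
  shows "S = T"
proof
  fix f
  show "S f = T f"
  proof (cases "f \<in> ell2 X")
    case True
    obtain K where K: "0 \<le> K" "\<And>f. f \<in> ell2 X \<Longrightarrow> ell2_norm X (S f) \<le> K * ell2_norm X f"
      using bounded_ops_bound[OF S] by blast
    obtain L where L: "0 \<le> L" "\<And>f. f \<in> ell2 X \<Longrightarrow> ell2_norm X (T f) \<le> L * ell2_norm X f"
      using bounded_ops_bound[OF T] by blast
    show ?thesis
    proof
      fix w
      have "cmod (S f w - T f w) \<le> 0"
      proof (rule field_le_epsilon)
        fix e :: real assume e: "e > 0"
        define d where "d = e / (K + L + 1)"
        have d: "d > 0" using e K(1) L(1) by (simp add: d_def)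
        obtain F where F: "finite F" "F \<subseteq> X" "ell2_norm X (\<lambda>w. f w - (if w \<in> F then f w else 0)) < d"
          using ell2_approx[OF True d] by blast
        let ?h = "\<lambda>w. if w \<in> F then f w else 0"
        let ?g = "\<lambda>w. f w - ?h w"
        have h: "?h \<in> ell2 X" by (rule ell2_finite_support(1)[OF F(1,2)]) simp
        have g: "?g \<in> ell2 X" by (rule ell2_diff[OF True h])
        have "S ?h = T ?h"
          unfolding bounded_ops_truncation[OF S F(1,2)] bounded_ops_truncation[OF T F(1,2)]
          using eq F(2) by (intro ext sum.cong) auto
        then have "S f w - T f w = S ?g w - T ?g w"
          using bounded_ops_diff[OF S True h] bounded_ops_diff[OF T True h] by simp
        also have "cmod \<dots> \<le> cmod (S ?g w) + cmod (T ?g w)" by (rule norm_triangle_ineq4)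
        also have "\<dots> \<le> K * ell2_norm X ?g + L * ell2_norm X ?g"
          using cmod_le_ell2_norm[OF bounded_opsD(1)[OF S g], of w] K(2)[OF g]
            cmod_le_ell2_norm[OF bounded_opsD(1)[OF T g], of w] L(2)[OF g] by linarith
        also have "\<dots> = (K + L) * ell2_norm X ?g" by (simp add: distrib_right)
        also have "\<dots> \<le> (K + L + 1) * d"
          using F(3) K(1) L(1) ell2_norm_nonneg by (intro mult_mono) auto
        also have "\<dots> = e" using K(1) L(1) by (simp add: d_def add_nonneg_pos[THEN less_imp_neq, symmetric])
        finally show "cmod (S f w - T f w) \<le> 0 + e" by simp
      qed
      then show "S f w = T f w" by simp
    qed
  qed (simp add: bounded_opsD(2)[OF S] bounded_opsD(2)[OF T])
qed

text \<open>The coordinates of \<open>T\<^sup>\<star> f\<close> have to be \<open>\<langle>T \<xi>\<^sub>w, f\<rangle>\<close>; testing \<open>T\<close> against the finite part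
  \<open>h\<close> of the vector of these coordinates gives \<open>\<parallel>h\<parallel>\<^sup>2 = \<langle>T h, f\<rangle> \<le> K \<parallel>h\<parallel> \<parallel>f\<parallel>\<close>, so the vector is
  in \<open>\<ell>\<^sup>2\<close>.\<close>

lemma adjoint_exists:
  assumes T: "T \<in> bounded_ops X"
  shows "\<exists>S. S \<in> bounded_ops X \<and> (\<forall>f\<in>ell2 X. \<forall>g\<in>ell2 X. ell2_inner X (S f) g = ell2_inner X f (T g))"
proof -
  obtain K where K: "0 \<le> K" "\<And>f. f \<in> ell2 X \<Longrightarrow> ell2_norm X (T f) \<le> K * ell2_norm X f"
    using bounded_ops_bound[OF T] by blast
  define S where "S f = (\<lambda>w. if f \<in> ell2 X \<and> w \<in> X then ell2_inner X (T (basis_vec w)) f else 0)" for f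
  have TB: "T (basis_vec w) \<in> ell2 X" if "w \<in> X" for w
    by (intro bounded_opsD(1)[OF T] basis_vec_ell2 that)
  \<comment> \<open>The entries of \<open>S f\<close> are chosen so that the adjoint relation holds on basis vectors.\<close>
  have fin: "ell2_inner X f (T (\<lambda>w. if w \<in> F then h w else 0)) = (\<Sum>w\<in>F. cnj (S f w) * h w)"
    if f: "f \<in> ell2 X" and F: "finite F" "F \<subseteq> X" for f h F
  proof -
    have "ell2_inner X f (T (\<lambda>w. if w \<in> F then h w else 0)) =
        ell2_inner X f (\<lambda>u. \<Sum>w\<in>F. h w * T (basis_vec w) u)"
      unfolding bounded_ops_truncation[OF T F] ..
    also have "\<dots> = (\<Sum>w\<in>F. h w * ell2_inner X f (T (basis_vec w)))"
      using F
    proof (induction F)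
      case (insert w F)
      have "(\<lambda>u. \<Sum>w\<in>F. h w * T (basis_vec w) u) \<in> ell2 X"
        using bounded_opsD(1)[OF T ell2_finite_support(1), of F "\<lambda>w. if w \<in> F then h w else 0"]
          bounded_ops_truncation[OF T, of F h] insert by simp
      then show ?case using insert ell2_inner_add[OF f ell2_smul[OF TB[of w], of "h w"]]
        by (simp add: ell2_inner_smul)
    qed simp
    also have "\<dots> = (\<Sum>w\<in>F. cnj (S f w) * h w)"
      using F(2) f by (intro sum.cong) (auto simp: S_def ell2_inner_cnj[of X f])
    finally show ?thesis .
  qed
  have S: "S f \<in> ell2 X \<and> ell2_norm X (S f) \<le> K * ell2_norm X f" if f: "f \<in> ell2 X" for f
  proof -
    have "L2_set (\<lambda>w. cmod (S f w)) F \<le> K * ell2_norm X f" if F: "finite F" "F \<subseteq> X" for F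
    proof -
      let ?h = "\<lambda>w. if w \<in> F then S f w else 0"
      let ?N = "L2_set (\<lambda>w. cmod (S f w)) F"
      have h: "?h \<in> ell2 X" and hn: "ell2_norm X ?h = ?N"
        using ell2_finite_support[OF F, of ?h] by (auto cong: L2_set_cong)
      have "?N\<^sup>2 = cmod (\<Sum>w\<in>F. of_real ((cmod (S f w))\<^sup>2))"
        unfolding of_real_sum[symmetric] norm_of_real by (simp add: L2_set_def sum_nonneg)
      also have "(\<Sum>w\<in>F. of_real ((cmod (S f w))\<^sup>2)) = ell2_inner X f (T ?h)"
        unfolding fin[OF f F] by (intro sum.cong refl) (simp only: complex_norm_square mult.commute)
      also have "cmod \<dots> \<le> ell2_norm X f * ell2_norm X (T ?h)"
        by (rule ell2_Cauchy_Schwarz[OF f bounded_opsD(1)[OF T h]])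
      also have "\<dots> \<le> ell2_norm X f * (K * ?N)"
        using K(2)[OF h] hn by (intro mult_left_mono ell2_norm_nonneg) simp
      finally have "?N * ?N \<le> (K * ell2_norm X f) * ?N" by (simp add: power2_eq_square mult_ac)
      then show ?thesis
        by (rule le_of_mult_self_le) (simp_all add: K(1) ell2_norm_nonneg L2_set_nonneg)
    qed
    then show ?thesis
      using ell2_boundedI[of X "S f" "K * ell2_norm X f"] K(1) ell2_norm_nonneg[of X f]
      by (simp add: S_def[of f])
  qed
  have adj: "ell2_inner X (S f) g = ell2_inner X f (T g)" if f: "f \<in> ell2 X" and g: "g \<in> ell2 X" for f g
  proof -
    have "cmod (ell2_inner X (S f) g - ell2_inner X f (T g)) \<le> 0"
    proof (rule field_le_epsilon)
      fix e :: real assume e: "e > 0"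
      let ?C = "2 * (K * ell2_norm X f)"
      have C: "0 \<le> ?C" using K(1) by (simp add: mult_nonneg_nonneg ell2_norm_nonneg)
      define d where "d = e / (?C + 1)"
      have d: "d > 0" using e C by (simp add: d_def)
      obtain F where F: "finite F" "F \<subseteq> X" "ell2_norm X (\<lambda>w. g w - (if w \<in> F then g w else 0)) < d"
        using ell2_approx[OF g d] by blast
      let ?h = "\<lambda>w. if w \<in> F then g w else 0"
      let ?r = "\<lambda>w. g w - ?h w"
      have h: "?h \<in> ell2 X" by (rule ell2_finite_support(1)[OF F(1,2)]) simp
      have r: "?r \<in> ell2 X" by (rule ell2_diff[OF g h])
      have "ell2_inner X (S f) ?h = (\<Sum>\<^sub>\<infinity>w\<in>F. cnj (S f w) * ?h w)"
        unfolding ell2_inner_def by (rule infsum_cong_neutral) (use F(2) in auto)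
      also have "\<dots> = ell2_inner X f (T ?h)" using fin[OF f F(1,2), of g] F(1) by simp
      finally have "ell2_inner X (S f) g - ell2_inner X f (T g) = ell2_inner X (S f) ?r - ell2_inner X f (T ?r)"
        using S[OF f] bounded_opsD(1)[OF T] f g h
        by (simp add: ell2_inner_diff bounded_ops_diff[OF T])
      also have "cmod \<dots> \<le> cmod (ell2_inner X (S f) ?r) + cmod (ell2_inner X f (T ?r))"
        by (rule norm_triangle_ineq4)
      also have "\<dots> \<le> ell2_norm X (S f) * ell2_norm X ?r + ell2_norm X f * ell2_norm X (T ?r)"
        by (intro add_mono ell2_Cauchy_Schwarz f r bounded_opsD(1)[OF T] S[THEN conjunct1])
      also have "\<dots> \<le> (K * ell2_norm X f) * ell2_norm X ?r + ell2_norm X f * (K * ell2_norm X ?r)"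
        by (intro add_mono mult_right_mono mult_left_mono S[OF f, THEN conjunct2] K(2) r ell2_norm_nonneg)
      also have "\<dots> = ?C * ell2_norm X ?r" by simp
      also have "\<dots> \<le> (?C + 1) * d"
        using F(3) C ell2_norm_nonneg by (intro mult_mono) auto
      also have "\<dots> = e" using C by (simp add: d_def)
      finally show "cmod (ell2_inner X (S f) g - ell2_inner X f (T g)) \<le> 0 + e" by simp
    qed
    then show ?thesis by simp
  qed
  have "S \<in> bounded_ops X"
    unfolding bounded_ops_def
  proof (intro CollectI conjI ballI allI impI exI[of _ K])
    fix f g a assume f: "f \<in> ell2 X"
    show "S f \<in> ell2 X" "ell2_norm X (S f) \<le> K * ell2_norm X f" using S[OF f] by auto
    show "S (\<lambda>w. a * f w) = (\<lambda>w. a * S f w)"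
      by (simp add: S_def f ell2_smul[OF f] ell2_inner_smul fun_eq_iff)
    assume "g \<in> ell2 X"
    then show "S (\<lambda>w. f w + g w) = (\<lambda>w. S f w + S g w)"
      using f TB by (simp add: S_def ell2_add ell2_inner_add fun_eq_iff)
  qed (simp add: S_def)
  then show ?thesis using adj by blast
qed

lemma adjoint_unique:
  assumes "S \<in> bounded_ops X" "S' \<in> bounded_ops X"
    and eq: "\<And>f g. f \<in> ell2 X \<Longrightarrow> g \<in> ell2 X \<Longrightarrow> ell2_inner X (S f) g = ell2_inner X (S' f) g"
  shows "S = S'"
proof (intro ext)
  fix f w
  show "S f w = S' f w"
  proof (cases "f \<in> ell2 X \<and> w \<in> X")
    case True
    then show ?thesis using eq[of f "basis_vec w"] by (simp add: ell2_inner_basis_vec basis_vec_ell2)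
  qed (use assms(1,2) in \<open>metis bounded_opsD(1,2) ell2_off\<close>)
qed

lemma B_ell2_simps [simp]:
  "carrier (B_ell2 X) = bounded_ops X" "czero (B_ell2 X) = (\<lambda>f w. 0)"
  "cadd (B_ell2 X) S T = (\<lambda>f w. S f w + T f w)" "csmul (B_ell2 X) a T = (\<lambda>f w. a * T f w)"
  "cmul (B_ell2 X) S T = (\<lambda>f. S (T f))" "csub (B_ell2 X) S T = (\<lambda>f w. S f w - T f w)"
  by (simp_all add: B_ell2_def csub_def)

lemma B_ell2_adj:
  assumes T: "T \<in> bounded_ops X"
  shows "cadj (B_ell2 X) T \<in> bounded_ops X"
    and "f \<in> ell2 X \<Longrightarrow> g \<in> ell2 X \<Longrightarrow> ell2_inner X (cadj (B_ell2 X) T f) g = ell2_inner X f (T g)"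
proof -
  let ?P = "\<lambda>S. S \<in> bounded_ops X \<and> (\<forall>f\<in>ell2 X. \<forall>g\<in>ell2 X. ell2_inner X (S f) g = ell2_inner X f (T g))"
  have "\<exists>!S. ?P S" using adjoint_exists[OF T] adjoint_unique[of _ X] by (metis (lifting))
  from theI'[OF this] show "cadj (B_ell2 X) T \<in> bounded_ops X"
    "f \<in> ell2 X \<Longrightarrow> g \<in> ell2 X \<Longrightarrow> ell2_inner X (cadj (B_ell2 X) T f) g = ell2_inner X f (T g)"
    by (simp_all add: B_ell2_def)
qed

lemma B_ell2_adj_eqI:
  assumes "S \<in> bounded_ops X" "T \<in> bounded_ops X"
    and "\<And>f g. f \<in> ell2 X \<Longrightarrow> g \<in> ell2 X \<Longrightarrow> ell2_inner X (S f) g = ell2_inner X f (T g)"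
  shows "cadj (B_ell2 X) T = S"
  by (rule adjoint_unique) (use assms B_ell2_adj[OF assms(2)] in auto)

lemma
  assumes T: "T \<in> bounded_ops X"
  shows B_ell2_norm_nonneg: "0 \<le> cnorm (B_ell2 X) T"
    and B_ell2_norm_ge: "f \<in> ell2 X \<Longrightarrow> ell2_norm X (T f) \<le> cnorm (B_ell2 X) T * ell2_norm X f"
proof -
  let ?A = "{ell2_norm X (T f) |f. f \<in> ell2 X \<and> ell2_norm X f \<le> 1}"
  obtain K where K: "0 \<le> K" "\<And>f. f \<in> ell2 X \<Longrightarrow> ell2_norm X (T f) \<le> K * ell2_norm X f"
    using bounded_ops_bound[OF T] by blast
  have bdd: "bdd_above ?A"
  proof (rule bdd_aboveI[of _ K])
    fix x assume "x \<in> ?A"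
    then obtain f where f: "f \<in> ell2 X" "ell2_norm X f \<le> 1" "x = ell2_norm X (T f)" by blast
    have "x \<le> K * ell2_norm X f" using K(2)[OF f(1)] f(3) by simp
    also have "\<dots> \<le> K * 1" by (intro mult_left_mono f K(1))
    finally show "x \<le> K" by simp
  qed
  have up: "ell2_norm X (T f) \<le> cnorm (B_ell2 X) T" if "f \<in> ell2 X" "ell2_norm X f \<le> 1" for f
    unfolding B_ell2_def cstar.simps by (rule cSup_upper[OF _ bdd]) (use that in auto)
  show "0 \<le> cnorm (B_ell2 X) T" using up[of "\<lambda>_. 0"] by (simp add: bounded_ops_zero[OF T])
  show "ell2_norm X (T f) \<le> cnorm (B_ell2 X) T * ell2_norm X f" if f: "f \<in> ell2 X"
  proof (cases "ell2_norm X f = 0")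
    case True
    then show ?thesis using K(2)[OF f] ell2_norm_nonneg[of X "T f"] by simp
  next
    case False
    let ?n = "ell2_norm X f"
    have n: "?n > 0" using False ell2_norm_nonneg[of X f] by simp
    have "ell2_norm X (T (\<lambda>w. of_real (inverse ?n) * f w)) \<le> cnorm (B_ell2 X) T"
      by (rule up) (use ell2_smul[OF f] n in \<open>simp_all add: ell2_norm_smul norm_inverse\<close>)
    then show ?thesis
      using n unfolding bounded_opsD(4)[OF T f] ell2_norm_smul norm_of_real
      by (simp add: field_simps)
  qed
qed

lemma B_ell2_norm_le:
  assumes "\<And>f. f \<in> ell2 X \<Longrightarrow> ell2_norm X (T f) \<le> K * ell2_norm X f" "0 \<le> K"
  shows "cnorm (B_ell2 X) T \<le> K"
  unfolding B_ell2_def cstar.simps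
proof (rule cSup_least)
  fix x assume "x \<in> {ell2_norm X (T f) |f. f \<in> ell2 X \<and> ell2_norm X f \<le> 1}"
  then obtain f where f: "f \<in> ell2 X" "ell2_norm X f \<le> 1" "x = ell2_norm X (T f)" by blast
  have "x \<le> K * ell2_norm X f" using assms(1)[OF f(1)] f(3) by simp
  also have "\<dots> \<le> K * 1" by (intro mult_left_mono f assms(2))
  finally show "x \<le> K" by simp
qed (auto intro: exI[of _ "\<lambda>_. 0"])

lemma bounded_opsI:
  assumes "\<And>f. f \<in> ell2 X \<Longrightarrow> T f \<in> ell2 X" "\<And>f. f \<notin> ell2 X \<Longrightarrow> T f = (\<lambda>_. 0)"
    "\<And>f g. f \<in> ell2 X \<Longrightarrow> g \<in> ell2 X \<Longrightarrow> T (\<lambda>w. f w + g w) = (\<lambda>w. T f w + T g w)"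
    "\<And>a f. f \<in> ell2 X \<Longrightarrow> T (\<lambda>w. a * f w) = (\<lambda>w. a * T f w)"
    "\<And>f. f \<in> ell2 X \<Longrightarrow> ell2_norm X (T f) \<le> K * ell2_norm X f"
  shows "T \<in> bounded_ops X"
  unfolding bounded_ops_def using assms by blast

lemma
  assumes S: "S \<in> bounded_ops X" and T: "T \<in> bounded_ops X"
  shows bounded_ops_add: "(\<lambda>f w. S f w + T f w) \<in> bounded_ops X"
    and B_ell2_norm_triangle: "cnorm (B_ell2 X) (\<lambda>f w. S f w + T f w) \<le> cnorm (B_ell2 X) S + cnorm (B_ell2 X) T"
    and bounded_ops_mul: "(\<lambda>f. S (T f)) \<in> bounded_ops X"
    and B_ell2_norm_mul: "cnorm (B_ell2 X) (\<lambda>f. S (T f)) \<le> cnorm (B_ell2 X) S * cnorm (B_ell2 X) T"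
proof -
  let ?n = "cnorm (B_ell2 X)"
  have add: "ell2_norm X (\<lambda>w. S f w + T f w) \<le> (?n S + ?n T) * ell2_norm X f" if f: "f \<in> ell2 X" for f
    using ell2_norm_triangle[OF bounded_opsD(1)[OF S f] bounded_opsD(1)[OF T f]]
      B_ell2_norm_ge[OF S f] B_ell2_norm_ge[OF T f] by (simp add: distrib_right)
  have mul: "ell2_norm X (S (T f)) \<le> (?n S * ?n T) * ell2_norm X f" if f: "f \<in> ell2 X" for f
    using B_ell2_norm_ge[OF S bounded_opsD(1)[OF T f]]
      mult_left_mono[OF B_ell2_norm_ge[OF T f] B_ell2_norm_nonneg[OF S]] by simp
  show "(\<lambda>f w. S f w + T f w) \<in> bounded_ops X"
    by (rule bounded_opsI[OF _ _ _ _ add])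
      (auto simp: bounded_opsD[OF S] bounded_opsD[OF T] ell2_add algebra_simps)
  show "(\<lambda>f. S (T f)) \<in> bounded_ops X"
    by (rule bounded_opsI[OF _ _ _ _ mul])
      (auto simp: bounded_opsD[OF S] bounded_opsD[OF T] bounded_ops_zero[OF S])
  show "?n (\<lambda>f w. S f w + T f w) \<le> ?n S + ?n T" "?n (\<lambda>f. S (T f)) \<le> ?n S * ?n T"
    by (rule B_ell2_norm_le[OF add] B_ell2_norm_le[OF mul];
        simp add: B_ell2_norm_nonneg[OF S] B_ell2_norm_nonneg[OF T])+
qed

lemma
  assumes T: "T \<in> bounded_ops X"
  shows bounded_ops_smul: "(\<lambda>f w. a * T f w) \<in> bounded_ops X"
    and B_ell2_norm_smul: "cnorm (B_ell2 X) (\<lambda>f w. a * T f w) = cmod a * cnorm (B_ell2 X) T"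
proof -
  have le: "ell2_norm X (\<lambda>w. b * S f w) \<le> (cmod b * cnorm (B_ell2 X) S) * ell2_norm X f"
    if S: "S \<in> bounded_ops X" and f: "f \<in> ell2 X" for f b S
    using mult_left_mono[OF B_ell2_norm_ge[OF S f], of "cmod b"] by (simp add: ell2_norm_smul mult.assoc)
  have bop: "(\<lambda>f w. b * S f w) \<in> bounded_ops X" if S: "S \<in> bounded_ops X" for b S
    by (rule bounded_opsI[OF _ _ _ _ le[OF S]])
      (auto simp: bounded_opsD[OF S] ell2_smul algebra_simps)
  have n: "cnorm (B_ell2 X) (\<lambda>f w. b * S f w) \<le> cmod b * cnorm (B_ell2 X) S" if S: "S \<in> bounded_ops X" for b S
    by (rule B_ell2_norm_le[OF le[OF S]]) (auto simp: B_ell2_norm_nonneg[OF S])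
  show "(\<lambda>f w. a * T f w) \<in> bounded_ops X" by (rule bop[OF T])
  show "cnorm (B_ell2 X) (\<lambda>f w. a * T f w) = cmod a * cnorm (B_ell2 X) T"
  proof (cases "a = 0")
    case True
    then show ?thesis using n[OF T, of 0] B_ell2_norm_nonneg[OF bop[OF T, of 0]] by simp
  next
    case False
    have "cmod a * cnorm (B_ell2 X) T \<le> cmod a * (cmod (inverse a) * cnorm (B_ell2 X) (\<lambda>f w. a * T f w))"
      using n[OF bop[OF T, of a], of "inverse a"] False
      by (intro mult_left_mono) (simp_all add: mult.assoc[symmetric])
    also have "\<dots> = cnorm (B_ell2 X) (\<lambda>f w. a * T f w)"
      using False by (simp add: mult.assoc[symmetric] norm_mult[symmetric])
    finally have "cmod a * cnorm (B_ell2 X) T \<le> cnorm (B_ell2 X) (\<lambda>f w. a * T f w)" .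
    then show ?thesis using n[OF T, of a] by linarith
  qed
qed

lemma B_ell2_norm_adj_le:
  assumes T: "T \<in> bounded_ops X"
  shows "cnorm (B_ell2 X) (cadj (B_ell2 X) T) \<le> cnorm (B_ell2 X) T"
proof (rule B_ell2_norm_le[OF _ B_ell2_norm_nonneg[OF T]])
  fix f assume f: "f \<in> ell2 X"
  let ?g = "cadj (B_ell2 X) T f"
  have g: "?g \<in> ell2 X" by (rule bounded_opsD(1)[OF B_ell2_adj(1)[OF T] f])
  have "(ell2_norm X ?g)\<^sup>2 = cmod (ell2_inner X ?g ?g)" by (simp add: ell2_inner_self[OF g] norm_power ell2_norm_nonneg)
  also have "\<dots> \<le> ell2_norm X f * ell2_norm X (T ?g)"
    unfolding B_ell2_adj(2)[OF T f g] by (rule ell2_Cauchy_Schwarz[OF f bounded_opsD(1)[OF T g]])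
  also have "\<dots> \<le> ell2_norm X f * (cnorm (B_ell2 X) T * ell2_norm X ?g)"
    by (intro mult_left_mono B_ell2_norm_ge[OF T g] ell2_norm_nonneg)
  finally have *: "ell2_norm X ?g * ell2_norm X ?g \<le> (cnorm (B_ell2 X) T * ell2_norm X f) * ell2_norm X ?g"
    by (simp add: power2_eq_square mult_ac)
  show "ell2_norm X ?g \<le> cnorm (B_ell2 X) T * ell2_norm X f"
    by (rule le_of_mult_self_le[OF *]) (simp_all add: B_ell2_norm_nonneg[OF T] ell2_norm_nonneg)
qed

text \<open>\<open>\<parallel>T f\<parallel>\<^sup>2 = \<langle>T\<^sup>\<star> T f, f\<rangle> \<le> \<parallel>T\<^sup>\<star> T\<parallel> \<parallel>f\<parallel>\<^sup>2\<close> by the Cauchy-Schwarz inequality; the converse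
  inequality is \<open>\<parallel>T\<^sup>\<star>\<parallel> \<le> \<parallel>T\<parallel>\<close>.\<close>

lemma B_ell2_norm_cstar:
  assumes T: "T \<in> bounded_ops X"
  shows "cnorm (B_ell2 X) (\<lambda>f. cadj (B_ell2 X) T (T f)) = (cnorm (B_ell2 X) T)\<^sup>2"
proof (rule antisym)
  let ?n = "cnorm (B_ell2 X)" and ?S = "cadj (B_ell2 X) T"
  have S: "?S \<in> bounded_ops X" by (rule B_ell2_adj(1)[OF T])
  have ST: "(\<lambda>f. ?S (T f)) \<in> bounded_ops X" by (rule bounded_ops_mul[OF S T])
  show "?n (\<lambda>f. ?S (T f)) \<le> (?n T)\<^sup>2"
    using B_ell2_norm_mul[OF S T] mult_right_mono[OF B_ell2_norm_adj_le[OF T] B_ell2_norm_nonneg[OF T]]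
    by (simp add: power2_eq_square)
  have "?n T \<le> sqrt (?n (\<lambda>f. ?S (T f)))"
  proof (rule B_ell2_norm_le)
    fix f assume f: "f \<in> ell2 X"
    have Tf: "T f \<in> ell2 X" by (rule bounded_opsD(1)[OF T f])
    have STf: "?S (T f) \<in> ell2 X" by (rule bounded_opsD(1)[OF S Tf])
    have "(ell2_norm X (T f))\<^sup>2 = cmod (ell2_inner X (T f) (T f))"
      by (simp add: ell2_inner_self[OF Tf] norm_power ell2_norm_nonneg)
    also have "\<dots> \<le> ell2_norm X (?S (T f)) * ell2_norm X f"
      unfolding B_ell2_adj(2)[OF T Tf f, symmetric] by (rule ell2_Cauchy_Schwarz[OF STf f])
    also have "\<dots> \<le> (?n (\<lambda>f. ?S (T f)) * ell2_norm X f) * ell2_norm X f"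
      by (intro mult_right_mono B_ell2_norm_ge[OF ST f] ell2_norm_nonneg)
    also have "\<dots> = (sqrt (?n (\<lambda>f. ?S (T f))) * ell2_norm X f)\<^sup>2"
      using B_ell2_norm_nonneg[OF ST] by (simp add: power_mult_distrib) (simp add: power2_eq_square)
    finally show "ell2_norm X (T f) \<le> sqrt (?n (\<lambda>f. ?S (T f))) * ell2_norm X f"
      by (rule power2_le_imp_le) (simp add: ell2_norm_nonneg B_ell2_norm_nonneg[OF ST])
  qed (simp add: B_ell2_norm_nonneg[OF ST])
  then show "(?n T)\<^sup>2 \<le> ?n (\<lambda>f. ?S (T f))"
    using power_mono[OF _ B_ell2_norm_nonneg[OF T], of "sqrt (?n (\<lambda>f. ?S (T f)))" 2]
      B_ell2_norm_nonneg[OF ST] by simp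
qed

lemma bounded_ops_sub: "S \<in> bounded_ops X \<Longrightarrow> T \<in> bounded_ops X \<Longrightarrow> (\<lambda>f w. S f w - T f w) \<in> bounded_ops X"
  using bounded_ops_add[OF _ bounded_ops_smul[of T X "- 1"], of S] by simp

text \<open>A Cauchy sequence of operators converges entrywise, and the finite parts of its tails
  satisfy the Cauchy estimate also in the limit.\<close>

lemma B_ell2_complete:
  assumes X: "\<And>k. Q k \<in> bounded_ops X"
    and cauchy: "\<And>e. e > 0 \<Longrightarrow> \<exists>N. \<forall>m\<ge>N. \<forall>k\<ge>N. cnorm (B_ell2 X) (\<lambda>f w. Q m f w - Q k f w) < e"
  shows "\<exists>T\<in>bounded_ops X. (\<lambda>k. cnorm (B_ell2 X) (\<lambda>f w. Q k f w - T f w)) \<longlonglongrightarrow> 0"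
proof -
  let ?n = "cnorm (B_ell2 X)"
  have D: "(\<lambda>f w. Q m f w - Q k f w) \<in> bounded_ops X" for m k by (rule bounded_ops_sub[OF X X])
  have "Cauchy (\<lambda>k. Q k f w)" if f: "f \<in> ell2 X" for f w
  proof (rule CauchyI)
    fix e :: real assume e: "e > 0"
    then obtain N where N: "\<And>m k. m \<ge> N \<Longrightarrow> k \<ge> N \<Longrightarrow> ?n (\<lambda>f w. Q m f w - Q k f w) < e / (ell2_norm X f + 1)"
      using cauchy[of "e / (ell2_norm X f + 1)"] ell2_norm_nonneg[of X f] by (auto simp: field_simps add_nonneg_pos)
    have "cmod (Q m f w - Q k f w) < e" if "m \<ge> N" "k \<ge> N" for m k
    proof -
      have "cmod (Q m f w - Q k f w) \<le> ?n (\<lambda>f w. Q m f w - Q k f w) * ell2_norm X f"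
        using cmod_le_ell2_norm[OF bounded_opsD(1)[OF D[of m k] f], of w] B_ell2_norm_ge[OF D[of m k] f] by simp
      also have "\<dots> \<le> e / (ell2_norm X f + 1) * ell2_norm X f"
        using N[OF that] by (intro mult_right_mono ell2_norm_nonneg) simp
      also have "\<dots> < e" using e ell2_norm_nonneg[of X f] by (simp add: field_simps add_nonneg_pos)
      finally show ?thesis .
    qed
    then show "\<exists>N. \<forall>m\<ge>N. \<forall>k\<ge>N. norm (Q m f w - Q k f w) < e" by blast
  qed
  then have "\<exists>l. (\<lambda>k. Q k f w) \<longlonglongrightarrow> l" if "f \<in> ell2 X" for f w
    using that Cauchy_convergent unfolding convergent_def by blast
  then obtain T0 where T0: "\<And>f w. f \<in> ell2 X \<Longrightarrow> (\<lambda>k. Q k f w) \<longlonglongrightarrow> T0 f w" by metis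
  define T where "T f w = (if f \<in> ell2 X then T0 f w else 0)" for f w
  have lim: "(\<lambda>k. Q k f w) \<longlonglongrightarrow> T f w" for f w
    using T0 bounded_opsD(2)[OF X] by (cases "f \<in> ell2 X") (simp_all add: T_def)
  have off: "T f w = 0" if "w \<notin> X" for f w
  proof -
    have "Q k f w = 0" for k using ell2_off[OF bounded_opsD(1)[OF X] that] bounded_opsD(2)[OF X]
      by (cases "f \<in> ell2 X") auto
    then show ?thesis using lim[of f w] LIMSEQ_unique[OF _ tendsto_const] by simp
  qed
  have diff: "(\<lambda>w. Q m f w - T f w) \<in> ell2 X \<and> ell2_norm X (\<lambda>w. Q m f w - T f w) \<le> e * ell2_norm X f"
    if f: "f \<in> ell2 X" and e: "e \<ge> 0" and N: "\<And>k. k \<ge> N \<Longrightarrow> ?n (\<lambda>f w. Q m f w - Q k f w) \<le> e" for f m e N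
  proof -
    have "L2_set (\<lambda>w. cmod (Q m f w - T f w)) F \<le> e * ell2_norm X f" if F: "finite F" "F \<subseteq> X" for F
    proof (rule LIMSEQ_le_const2)
      show "(\<lambda>k. L2_set (\<lambda>w. cmod (Q m f w - Q k f w)) F) \<longlonglongrightarrow> L2_set (\<lambda>w. cmod (Q m f w - T f w)) F"
        unfolding L2_set_def by (intro tendsto_intros lim)
      have "L2_set (\<lambda>w. cmod (Q m f w - Q k f w)) F \<le> e * ell2_norm X f" if "k \<ge> N" for k
        using L2_set_le_ell2_norm[OF bounded_opsD(1)[OF D[of m k] f] F] B_ell2_norm_ge[OF D[of m k] f]
          mult_right_mono[OF N[OF that] ell2_norm_nonneg[of X f]] by linarith
      then show "\<exists>N. \<forall>k\<ge>N. L2_set (\<lambda>w. cmod (Q m f w - Q k f w)) F \<le> e * ell2_norm X f" by blast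
    qed
    moreover have "Q m f w - T f w = 0" if "w \<notin> X" for w
      using off[OF that] ell2_off[OF bounded_opsD(1)[OF X f] that] by simp
    ultimately show ?thesis
      using ell2_boundedI[of X "\<lambda>w. Q m f w - T f w" "e * ell2_norm X f"] e ell2_norm_nonneg[of X f] by auto
  qed
  obtain N where N: "\<And>m k. m \<ge> N \<Longrightarrow> k \<ge> N \<Longrightarrow> ?n (\<lambda>f w. Q m f w - Q k f w) < 1"
    using cauchy[of 1] by auto
  have "(\<lambda>f w. Q N f w - T f w) \<in> bounded_ops X"
  proof (rule bounded_opsI[where K = 1])
    fix f assume f: "f \<in> ell2 X"
    show "(\<lambda>w. Q N f w - T f w) \<in> ell2 X" "ell2_norm X (\<lambda>w. Q N f w - T f w) \<le> 1 * ell2_norm X f"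
      using diff[OF f, of 1 N N] N by (auto simp: less_imp_le)
    show "(\<lambda>w. Q N (\<lambda>w. a * f w) w - T (\<lambda>w. a * f w) w) = (\<lambda>w. a * (Q N f w - T f w))" for a
    proof
      fix w
      have "(\<lambda>k. a * Q k f w) \<longlonglongrightarrow> T (\<lambda>w. a * f w) w"
        using lim[of "\<lambda>w. a * f w" w] by (simp add: bounded_opsD(4)[OF X f])
      then have "T (\<lambda>w. a * f w) w = a * T f w" using LIMSEQ_unique tendsto_mult_left[OF lim] by blast
      then show "Q N (\<lambda>w. a * f w) w - T (\<lambda>w. a * f w) w = a * (Q N f w - T f w)"
        by (simp add: bounded_opsD(4)[OF X f] algebra_simps)
    qed
    fix g assume g: "g \<in> ell2 X"
    show "(\<lambda>w. Q N (\<lambda>w. f w + g w) w - T (\<lambda>w. f w + g w) w) = (\<lambda>w. Q N f w - T f w + (Q N g w - T g w))"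
    proof
      fix w
      have "(\<lambda>k. Q k f w + Q k g w) \<longlonglongrightarrow> T (\<lambda>w. f w + g w) w"
        using lim[of "\<lambda>w. f w + g w" w] by (simp add: bounded_opsD(3)[OF X f g])
      then have "T (\<lambda>w. f w + g w) w = T f w + T g w" using LIMSEQ_unique tendsto_add[OF lim lim] by blast
      then show "Q N (\<lambda>w. f w + g w) w - T (\<lambda>w. f w + g w) w = Q N f w - T f w + (Q N g w - T g w)"
        by (simp add: bounded_opsD(3)[OF X f g])
    qed
  next
    fix f assume "f \<notin> ell2 X"
    then show "(\<lambda>w. Q N f w - T f w) = (\<lambda>_. 0)" by (simp add: bounded_opsD(2)[OF X] T_def)
  qed
  from bounded_ops_sub[OF X[of N] this] have T: "T \<in> bounded_ops X" by simp
  have "(\<lambda>k. ?n (\<lambda>f w. Q k f w - T f w)) \<longlonglongrightarrow> 0"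
  proof (rule LIMSEQ_I)
    fix e :: real assume e: "e > 0"
    then obtain N where N: "\<And>m k. m \<ge> N \<Longrightarrow> k \<ge> N \<Longrightarrow> ?n (\<lambda>f w. Q m f w - Q k f w) < e / 2"
      using cauchy[of "e / 2"] by auto
    have "?n (\<lambda>f w. Q m f w - T f w) \<le> e / 2" if "m \<ge> N" for m
      by (rule B_ell2_norm_le) (use diff[of _ "e / 2" N m] N[OF that] e in \<open>auto simp: less_imp_le\<close>)
    then show "\<exists>no. \<forall>m\<ge>no. norm (?n (\<lambda>f w. Q m f w - T f w) - 0) < e"
      using e B_ell2_norm_nonneg[OF bounded_ops_sub[OF X T]] by (intro exI[of _ N]) fastforce
  qed
  then show ?thesis using T by blast
qed

lemma B_ell2_cstar_algebra: "cstar_algebra (B_ell2 X)"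
proof -
  have zero: "(\<lambda>f w. 0) \<in> bounded_ops X"
    by (rule bounded_opsI[where K = 0]) auto
  have grp: "comm_group (additive (B_ell2 X))"
  proof (rule comm_groupI; simp add: additive_def)
    fix T assume T: "T \<in> bounded_ops X"
    have "(\<lambda>f w. - 1 * T f w) \<in> bounded_ops X" by (rule bounded_ops_smul[OF T])
    then show "\<exists>S\<in>bounded_ops X. (\<lambda>f w. S f w + T f w) = (\<lambda>f w. 0)"
      by (intro bexI[of _ "\<lambda>f w. - 1 * T f w"]) auto
  qed (auto simp: zero bounded_ops_add algebra_simps)
  note adj = B_ell2_adj
  show ?thesis
  proof (rule cstar_algebra.intro, unfold B_ell2_simps, goal_cases)
    case (14 T)
    show ?case
    proof (rule B_ell2_adj_eqI)
      fix f g assume "f \<in> ell2 X" "g \<in> ell2 X"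
      then show "ell2_inner X (T f) g = ell2_inner X f (cadj (B_ell2 X) T g)"
        using adj(2)[OF 14, of g f] ell2_inner_cnj by metis
    qed (simp_all add: 14 adj(1))
  next
    case (15 S T)
    show ?case
    proof (rule B_ell2_adj_eqI)
      fix f g assume fg: "f \<in> ell2 X" "g \<in> ell2 X"
      note cl = bounded_opsD(1)[OF adj(1)[OF 15(1)] fg(1)] bounded_opsD(1)[OF adj(1)[OF 15(2)] fg(1)]
      have "ell2_inner X (\<lambda>w. cadj (B_ell2 X) S f w + cadj (B_ell2 X) T f w) g =
          ell2_inner X (cadj (B_ell2 X) S f) g + ell2_inner X (cadj (B_ell2 X) T f) g"
        using ell2_inner_add[OF fg(2) cl] by (simp add: ell2_inner_cnj[of X _ g])
      then show "ell2_inner X (\<lambda>w. cadj (B_ell2 X) S f w + cadj (B_ell2 X) T f w) g =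
          ell2_inner X f (\<lambda>w. S g w + T g w)"
        using fg 15 by (simp add: adj(2) ell2_inner_add bounded_opsD(1))
    qed (simp_all add: 15 adj(1) bounded_ops_add)
  next
    case (16 T a)
    show ?case
    proof (rule B_ell2_adj_eqI)
      fix f g assume fg: "f \<in> ell2 X" "g \<in> ell2 X"
      have "ell2_inner X (\<lambda>w. cnj a * cadj (B_ell2 X) T f w) g = a * ell2_inner X (cadj (B_ell2 X) T f) g"
        using ell2_inner_smul[of X g "cnj a" "cadj (B_ell2 X) T f"] by (simp add: ell2_inner_cnj[of X _ g])
      then show "ell2_inner X (\<lambda>w. cnj a * cadj (B_ell2 X) T f w) g = ell2_inner X f (\<lambda>w. a * T g w)"
        using fg 16 by (simp add: adj(2) ell2_inner_smul)
    qed (simp_all add: 16 adj(1) bounded_ops_smul)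
  next
    case (17 S T)
    show ?case
      by (rule B_ell2_adj_eqI)
        (use 17 in \<open>simp_all add: adj bounded_ops_mul bounded_opsD(1) bounded_opsD(1)[OF adj(1)]\<close>)
  next
    case (19 T)
    have "T f = (\<lambda>w. 0)" for f
    proof (cases "f \<in> ell2 X")
      case True
      have "ell2_norm X (T f) \<le> 0" using B_ell2_norm_ge[OF 19(1) True] 19(2) by simp
      then show ?thesis
        using ell2_norm_eq_0[OF bounded_opsD(1)[OF 19(1) True]] ell2_norm_nonneg[of X "T f"] by linarith
    qed (rule bounded_opsD(2)[OF 19(1)])
    then show ?case by (intro ext) simp
  next
    case (24 Q)
    then show ?case using B_ell2_complete[of Q X] unfolding cconv_def B_ell2_simps by blast
  qed (simp_all add: grp zero bounded_ops_add bounded_ops_smul bounded_ops_mul adj(1) B_ell2_norm_nonneg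
      B_ell2_norm_triangle B_ell2_norm_smul B_ell2_norm_mul B_ell2_norm_cstar algebra_simps
      bounded_opsD(3,4) bounded_ops_range)
qed

section \<open>Cuntz-Krieger families from branching systems\<close>

text \<open>For a partial injection \<open>g : R \<rightarrow> X\<close> of the index set, composition with \<open>g\<close> is a partial
  isometry: if \<open>h\<close> inverts \<open>g\<close> on \<open>g ` R\<close>, it maps \<open>\<xi>\<^sub>w\<close> to \<open>\<xi>\<^bsub>h w\<^esub>\<close> for
  \<open>w \<in> g ` R\<close> and all other basis vectors to 0.\<close>

definition pull_op :: "'p set \<Rightarrow> 'p set \<Rightarrow> ('p \<Rightarrow> 'p) \<Rightarrow> ('p \<Rightarrow> complex) \<Rightarrow> 'p \<Rightarrow> complex" where
  "pull_op X R g f = (\<lambda>u. if f \<in> ell2 X \<and> u \<in> R then f (g u) else 0)"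

lemma pull_op_apply: "f \<in> ell2 X \<Longrightarrow> pull_op X R g f u = (if u \<in> R then f (g u) else 0)"
  by (simp add: pull_op_def)

lemma pull_op_bounded:
  assumes R: "R \<subseteq> X" and g: "g ` R \<subseteq> X" "inj_on g R"
  shows "pull_op X R g \<in> bounded_ops X"
proof (rule bounded_opsI[where K = 1])
  fix f assume f: "f \<in> ell2 X"
  have "L2_set (\<lambda>u. cmod (pull_op X R g f u)) F \<le> ell2_norm X f" if F: "finite F" "F \<subseteq> X" for F
  proof -
    have "(\<Sum>u\<in>F. (cmod (pull_op X R g f u))\<^sup>2) = (\<Sum>u\<in>F \<inter> R. (cmod (f (g u)))\<^sup>2)"
      by (rule sum.mono_neutral_cong_right) (use F f in \<open>auto simp: pull_op_apply\<close>)
    also have "\<dots> = (\<Sum>w\<in>g ` (F \<inter> R). (cmod (f w))\<^sup>2)"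
      by (rule sum.reindex_cong[symmetric]) (use inj_on_subset[OF g(2)] in auto)
    finally have "L2_set (\<lambda>u. cmod (pull_op X R g f u)) F = L2_set (\<lambda>w. cmod (f w)) (g ` (F \<inter> R))"
      by (simp add: L2_set_def)
    also have "\<dots> \<le> ell2_norm X f"
      by (rule L2_set_le_ell2_norm[OF f]) (use F g(1) in auto)
    finally show ?thesis .
  qed
  moreover have "pull_op X R g f u = 0" if "u \<notin> X" for u using that R by (auto simp: pull_op_def)
  ultimately show "pull_op X R g f \<in> ell2 X" "ell2_norm X (pull_op X R g f) \<le> 1 * ell2_norm X f"
    using ell2_boundedI[of X "pull_op X R g f" "ell2_norm X f"] ell2_norm_nonneg by auto
qed (auto simp: pull_op_def ell2_add ell2_smul)

lemma pull_op_adj: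
  assumes D: "D \<subseteq> X" and R: "R \<subseteq> X"
    and h: "\<And>w. w \<in> D \<Longrightarrow> h w \<in> R \<and> g (h w) = w" and g: "\<And>u. u \<in> R \<Longrightarrow> g u \<in> D \<and> h (g u) = u"
  shows "cadj (B_ell2 X) (pull_op X R g) = pull_op X D h"
proof (rule B_ell2_adj_eqI)
  have inj: "inj_on g R" by (rule inj_on_inverseI[of R h]) (use g in simp)
  have inj': "inj_on h D" by (rule inj_on_inverseI[of D g]) (use h in simp)
  show "pull_op X R g \<in> bounded_ops X" "pull_op X D h \<in> bounded_ops X"
    by (rule pull_op_bounded; use D R g h inj inj' in auto)+
  fix f k assume f: "f \<in> ell2 X" and k: "k \<in> ell2 X"
  have gR: "g ` R = D" using g h by force
  have "ell2_inner X (pull_op X D h f) k = (\<Sum>\<^sub>\<infinity>w\<in>D. cnj (f (h w)) * k w)"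
    unfolding ell2_inner_def by (rule infsum_cong_neutral) (use D f in \<open>auto simp: pull_op_apply\<close>)
  also have "\<dots> = (\<Sum>\<^sub>\<infinity>u\<in>R. cnj (f (h (g u))) * k (g u))"
    unfolding gR[symmetric] by (subst infsum_reindex[OF inj]) (simp add: o_def)
  also have "\<dots> = ell2_inner X f (pull_op X R g k)"
    unfolding ell2_inner_def by (rule infsum_cong_neutral) (use R k g in \<open>auto simp: pull_op_apply\<close>)
  finally show "ell2_inner X (pull_op X D h f) k = ell2_inner X f (pull_op X R g k)" .
qed

lemma pull_op_basis_vec:
  assumes "w \<in> X" and h: "w \<in> D \<Longrightarrow> h w \<in> R \<and> g (h w) = w" and g: "\<And>u. u \<in> R \<Longrightarrow> g u \<in> D \<and> h (g u) = u"
  shows "pull_op X R g (basis_vec w) = (if w \<in> D then basis_vec (h w) else (\<lambda>_. 0))"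
proof
  fix u
  have "pull_op X R g (basis_vec w) u = (if u \<in> R \<and> g u = w then 1 else 0)"
    by (simp add: pull_op_apply[OF basis_vec_ell2[OF assms(1)]]) (simp add: basis_vec_def)
  then show "pull_op X R g (basis_vec w) u = (if w \<in> D then basis_vec (h w) else (\<lambda>_. 0)) u"
    using h g[of u] by (auto simp: basis_vec_def)
qed

lemma B_ell2_eqI:
  assumes "S \<in> bounded_ops X" "T \<in> bounded_ops X" "\<And>f u. f \<in> ell2 X \<Longrightarrow> S f u = T f u"
  shows "S = T"
proof (intro ext)
  show "S f u = T f u" for f u
    using assms(3) bounded_opsD(2)[OF assms(1)] bounded_opsD(2)[OF assms(2)] by (cases "f \<in> ell2 X") auto
qed

lemma B_ell2_csum:
  assumes "finite K" "\<And>k. k \<in> K \<Longrightarrow> T k \<in> bounded_ops X"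
  shows "csum (B_ell2 X) T K f u = (\<Sum>k\<in>K. T k f u)"
proof -
  interpret cstar_algebra "B_ell2 X" by (rule B_ell2_cstar_algebra)
  show ?thesis using assms
  proof (induction K)
    case (insert k K)
    have "csum (B_ell2 X) T (insert k K) = cadd (B_ell2 X) (T k) (csum (B_ell2 X) T K)"
      by (rule csum_insert) (use insert in auto)
    then show ?case using insert by simp
  qed (simp add: csum_empty)
qed

definition diag_op :: "'p set \<Rightarrow> ('p \<Rightarrow> complex) \<Rightarrow> ('p \<Rightarrow> complex) \<Rightarrow> 'p \<Rightarrow> complex" where
  "diag_op X d f = (\<lambda>w. if f \<in> ell2 X then d w * f w else 0)"

lemma diag_op_bounded:
  assumes d: "\<And>w. cmod (d w) = 1"
  shows "diag_op X d \<in> bounded_ops X"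
proof (rule bounded_opsI[where K = 1])
  fix f assume f: "f \<in> ell2 X"
  have "(\<lambda>w. cmod (diag_op X d f w)) = (\<lambda>w. cmod (f w))" using f d by (simp add: diag_op_def norm_mult)
  then show "diag_op X d f \<in> ell2 X" "ell2_norm X (diag_op X d f) \<le> 1 * ell2_norm X f"
    using ell2_boundedI[of X "diag_op X d f" "ell2_norm X f"] ell2_norm_nonneg[of X f]
      L2_set_le_ell2_norm[OF f] ell2_off[OF f] by (auto simp: diag_op_def f)
qed (auto simp: diag_op_def ell2_add ell2_smul algebra_simps)

lemma diag_op_adj:
  assumes d: "\<And>w. cmod (d w) = 1"
  shows "cadj (B_ell2 X) (diag_op X d) = diag_op X (\<lambda>w. cnj (d w))"
  by (rule B_ell2_adj_eqI)
    (auto intro!: diag_op_bounded infsum_cong simp: d ell2_inner_def diag_op_def)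

text \<open>The hypothesis says that \<open>u\<^sup>\<star> u\<close> acts as a unit. It is stated in this way because the algebra
  has no designated unit.\<close>

lemma (in cstar_algebra) conjugation_star_hom:
  assumes u: "u \<in> carrier A" and unitary: "\<And>x. x \<in> carrier A \<Longrightarrow> cmul A (cadj A u) (cmul A u x) = x"
  shows "star_hom A A (\<lambda>x. cmul A (cmul A u x) (cadj A u))"
    and "x \<in> carrier A \<Longrightarrow> cnorm A (cmul A (cmul A u x) (cadj A u)) \<le> cnorm A x"
proof -
  note cl = mul_closed adj_closed add_closed smul_closed u
  show "star_hom A A (\<lambda>x. cmul A (cmul A u x) (cadj A u))"
    unfolding star_hom_def
  proof (intro conjI ballI allI)
    fix x y assume xy: "x \<in> carrier A" "y \<in> carrier A"
    have "cmul A (cmul A (cmul A u x) (cadj A u)) (cmul A (cmul A u y) (cadj A u)) =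
        cmul A (cmul A u x) (cmul A (cmul A (cadj A u) (cmul A u y)) (cadj A u))"
      using xy cl by (simp add: mul_assoc)
    then show "cmul A (cmul A u (cmul A x y)) (cadj A u) =
        cmul A (cmul A (cmul A u x) (cadj A u)) (cmul A (cmul A u y) (cadj A u))"
      using xy cl by (simp add: unitary mul_assoc)
    show "cmul A (cmul A u (cadd A x y)) (cadj A u) =
        cadd A (cmul A (cmul A u x) (cadj A u)) (cmul A (cmul A u y) (cadj A u))"
      using xy cl by (simp add: mul_add_left mul_add_right)
  qed (use cl in \<open>auto simp: mul_smul_left mul_smul_right adj_mul adj_adj mul_assoc\<close>)
  assume x: "x \<in> carrier A"
  have "cproj A (cmul A (cadj A u) u)"
    unfolding cproj_def using cl by (simp add: adj_mul adj_adj unitary mul_assoc)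
  then have "(cnorm A u)\<^sup>2 \<le> 1" using norm_proj_le norm_cstar[OF u] by fastforce
  then have nu: "cnorm A u \<le> 1" using norm_nonneg[OF u] by (simp add: power_le_one_iff)
  have "cnorm A (cmul A (cmul A u x) (cadj A u)) \<le> cnorm A (cmul A u x) * cnorm A (cadj A u)"
    using x cl by (intro norm_mul)
  also have "\<dots> \<le> cnorm A (cmul A u x)"
    using nu x cl by (simp add: norm_adj mult_left_le norm_nonneg)
  also have "\<dots> \<le> cnorm A u * cnorm A x" using x cl by (intro norm_mul)
  also have "\<dots> \<le> cnorm A x" using nu x cl by (simp add: mult_left_le_one_le norm_nonneg)
  finally show "cnorm A (cmul A (cmul A u x) (cadj A u)) \<le> cnorm A x" .
qed

text \<open>These data describe a representation by partial permutations of the basis: \<open>D x\<close> indexes the basis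
  of the range of \<open>P\<^sub>x\<close> and \<open>R f\<close> that of \<open>S\<^sub>f S\<^sub>f\<^sup>\<star>\<close>, and \<open>S\<^sub>f\<close> maps \<open>\<xi>\<^sub>w\<close> to \<open>\<xi>\<^bsub>h f w\<^esub>\<close>.\<close>

locale branching_system = fin_digraph F for F :: "('v,'e) pre_digraph" +
  fixes X :: "'p set" and D :: "'v \<Rightarrow> 'p set" and R :: "'e \<Rightarrow> 'p set"
    and g :: "'e \<Rightarrow> 'p \<Rightarrow> 'p" and h :: "'e \<Rightarrow> 'p \<Rightarrow> 'p"
  assumes D_sub: "x \<in> verts F \<Longrightarrow> D x \<subseteq> X"
    and D_disjoint: "x \<in> verts F \<Longrightarrow> y \<in> verts F \<Longrightarrow> x \<noteq> y \<Longrightarrow> D x \<inter> D y = {}"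
    and R_sub: "f \<in> arcs F \<Longrightarrow> R f \<subseteq> D (head F f)"
    and R_disjoint: "f \<in> arcs F \<Longrightarrow> f' \<in> arcs F \<Longrightarrow> f \<noteq> f' \<Longrightarrow> R f \<inter> R f' = {}"
    and R_cover: "f \<in> arcs F \<Longrightarrow> D (head F f) \<subseteq> (\<Union>f'\<in>{f' \<in> arcs F. head F f' = head F f}. R f')"
    and h: "f \<in> arcs F \<Longrightarrow> w \<in> D (tail F f) \<Longrightarrow> h f w \<in> R f \<and> g f (h f w) = w"
    and g: "f \<in> arcs F \<Longrightarrow> u \<in> R f \<Longrightarrow> g f u \<in> D (tail F f) \<and> h f (g f u) = u"
begin

definition P :: "'v \<Rightarrow> ('p \<Rightarrow> complex) \<Rightarrow> 'p \<Rightarrow> complex" where "P x = pull_op X (D x) (\<lambda>w. w)"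
definition S :: "'e \<Rightarrow> ('p \<Rightarrow> complex) \<Rightarrow> 'p \<Rightarrow> complex" where "S f = pull_op X (R f) (g f)"

abbreviation B :: "(('p \<Rightarrow> complex) \<Rightarrow> 'p \<Rightarrow> complex) cstar" where "B \<equiv> B_ell2 X"

lemma R_X: "f \<in> arcs F \<Longrightarrow> R f \<subseteq> X"
  using R_sub[of f] D_sub[OF head_in_verts[of f]] by blast

lemma P_bounded: "x \<in> verts F \<Longrightarrow> P x \<in> bounded_ops X"
  unfolding P_def by (rule pull_op_bounded) (use D_sub in auto)

lemma S_bounded:
  assumes f: "f \<in> arcs F" shows "S f \<in> bounded_ops X"
  unfolding S_def
proof (rule pull_op_bounded[OF R_X[OF f]])
  show "g f ` R f \<subseteq> X" using g[OF f] D_sub[OF tail_in_verts[OF f]] by auto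
  show "inj_on (g f) (R f)" by (rule inj_on_inverseI[of _ "h f"]) (use g[OF f] in simp)
qed

lemma P_adj: "x \<in> verts F \<Longrightarrow> cadj B (P x) = P x"
  unfolding P_def by (rule pull_op_adj) (use D_sub in auto)

lemma S_adj: "f \<in> arcs F \<Longrightarrow> cadj B (S f) = pull_op X (D (tail F f)) (h f)"
  unfolding S_def
  by (rule pull_op_adj) (use D_sub[OF tail_in_verts] R_X h g in auto)

lemma S_adj_bounded: "f \<in> arcs F \<Longrightarrow> pull_op X (D (tail F f)) (h f) \<in> bounded_ops X"
  using B_ell2_adj(1)[OF S_bounded] S_adj by metis

lemma P_apply: "f \<in> ell2 X \<Longrightarrow> P x f u = (if u \<in> D x then f u else 0)"
  and S_apply: "f \<in> ell2 X \<Longrightarrow> S e f u = (if u \<in> R e then f (g e u) else 0)"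
  by (simp_all add: P_def S_def pull_op_apply)

lemma S_S_adj_apply:
  assumes e: "e \<in> arcs F" and f: "f \<in> ell2 X"
  shows "S e (pull_op X (D (tail F e)) (h e) f) u = (if u \<in> R e then f u else 0)"
  using bounded_opsD(1)[OF S_adj_bounded[OF e] f] g[OF e, of u] f by (simp add: S_apply pull_op_apply)

text \<open>The operators \<open>S\<^sub>e S\<^sub>e\<^sup>\<star>\<close> and \<open>S\<^sub>e\<^sup>\<star> S\<^sub>e\<close> are the projections onto the functions supported in \<open>R e\<close> and
  in \<open>D (s(e))\<close>, so each relation expresses disjointness or a partition.\<close>

lemma CK_family_branching: "CK_family F B P S"
proof -
  interpret B: cstar_algebra B by (rule B_ell2_cstar_algebra)
  show ?thesis
  proof (rule B.CK_familyI)
    fix x assume x: "x \<in> verts F"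
    have "(\<lambda>f. P x (P x f)) = P x"
      by (rule B_ell2_eqI[where X = X])
        (use x in \<open>auto simp: bounded_ops_mul P_bounded P_apply bounded_ops_range\<close>)
    then show "cproj B (P x)" using x by (simp add: cproj_def P_adj P_bounded)
  next
    fix x y assume xy: "x \<in> verts F" "y \<in> verts F" "x \<noteq> y"
    have "(\<lambda>f. P x (P y f)) = (\<lambda>f w. 0)"
      by (rule B_ell2_eqI[where X = X])
        (use xy D_disjoint[OF xy] B.zero_closed in
          \<open>auto simp: bounded_ops_mul P_bounded P_apply bounded_ops_range\<close>)
    then show "cmul B (P x) (P y) = czero B" by simp
  next
    fix e assume e: "e \<in> arcs F"
    let ?Q = "pull_op X (D (tail F e)) (h e)"
    have "(\<lambda>f. S e (?Q (S e f))) = S e"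
    proof (rule B_ell2_eqI)
      show "(\<lambda>f. S e (?Q (S e f))) \<in> bounded_ops X"
        by (rule bounded_ops_mul[OF S_bounded[OF e] bounded_ops_mul[OF S_adj_bounded[OF e] S_bounded[OF e]]])
      fix f u assume "f \<in> ell2 X"
      then show "S e (?Q (S e f)) u = S e f u"
        using S_S_adj_apply[OF e bounded_ops_range[OF S_bounded[OF e], of f], of u]
        using S_apply[of f e u] by presburger
    qed (rule S_bounded[OF e])
    then show "cpartial_isometry B (S e)" using e by (simp add: cpartial_isometry_def S_adj S_bounded)
    have "(\<lambda>f. ?Q (S e f)) = P (tail F e)"
      by (rule B_ell2_eqI[where X = X])
        (use e h[OF e] in \<open>auto simp: bounded_ops_mul S_bounded P_bounded S_adj_bounded P_apply
          S_apply pull_op_apply bounded_ops_range\<close>)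
    then show "cmul B (cadj B (S e)) (S e) = P (tail F e)" using e by (simp add: S_adj)
  next
    fix e e' assume e: "e \<in> arcs F" "e' \<in> arcs F" "e \<noteq> e'"
    let ?Q = "pull_op X (D (tail F e)) (h e)"
    have "h e w \<notin> R e'" if "w \<in> D (tail F e)" for w
      using h[OF e(1) that] R_disjoint[OF e] by blast
    then have "(\<lambda>f. ?Q (S e' f)) = (\<lambda>f w. 0)"
      by (intro B_ell2_eqI[where X = X])
        (use e B.zero_closed in \<open>auto simp: bounded_ops_mul S_bounded S_adj_bounded
          S_apply pull_op_apply bounded_ops_range\<close>)
    then show "cmul B (cadj B (S e)) (S e') = czero B" using e by (simp add: S_adj)
  next
    fix x assume x: "x \<in> verts F" and "{f \<in> arcs F. head F f = x} \<noteq> {}"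
    then obtain e0 where e0: "e0 \<in> arcs F" "x = head F e0" by auto
    let ?K = "{f \<in> arcs F. head F f = x}"
    let ?Q = "\<lambda>e. pull_op X (D (tail F e)) (h e)"
    have "csum B (\<lambda>f. cmul B (S f) (cadj B (S f))) ?K = csum B (\<lambda>e f. S e (?Q e f)) ?K"
      by (rule B.csum_cong) (auto simp: S_adj bounded_ops_mul S_bounded S_adj_bounded)
    also have "\<dots> = P x"
    proof (rule B_ell2_eqI)
      show "csum B (\<lambda>e f. S e (?Q e f)) ?K \<in> bounded_ops X"
        using B.csum_closed[of ?K "\<lambda>e f. S e (?Q e f)"]
        by (simp add: bounded_ops_mul S_bounded S_adj_bounded)
      fix f u assume f: "f \<in> ell2 X"
      have "csum B (\<lambda>e f. S e (?Q e f)) ?K f u = (\<Sum>e\<in>?K. S e (?Q e f) u)"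
        by (rule B_ell2_csum) (auto simp: bounded_ops_mul S_bounded S_adj_bounded)
      also have "\<dots> = (\<Sum>e\<in>?K. if u \<in> R e then f u else 0)"
        by (rule sum.cong) (auto simp: S_S_adj_apply f)
      also have "\<dots> = P x f u"
      proof (cases "u \<in> D x")
        case True
        then obtain e where e: "e \<in> ?K" "u \<in> R e" using R_cover[OF e0(1)] e0(2) by blast
        have "(\<Sum>e\<in>?K. if u \<in> R e then f u else 0) = (\<Sum>e'\<in>{e}. if u \<in> R e' then f u else 0)"
          by (rule sum.mono_neutral_right) (use e R_disjoint[of e] in auto)
        then show ?thesis using e True f by (simp add: P_apply)
      next
        case False
        have "(\<Sum>e\<in>?K. if u \<in> R e then f u else 0) = 0"
          by (rule sum.neutral) (use False R_sub in auto)
        then show ?thesis using False f by (simp add: P_apply)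
      qed
      finally show "csum B (\<lambda>e f. S e (?Q e f)) ?K f u = P x f u" .
    qed (use x P_bounded in simp)
    finally show "csum B (\<lambda>f. cmul B (S f) (cadj B (S f))) ?K = P x" .
  qed
qed

text \<open>A degree on the index set that each edge raises by 1 gives a gauge action, implemented by the
  diagonal unitaries \<open>\<xi>\<^sub>w \<mapsto> z\<^bsup>deg w\<^esup> \<xi>\<^sub>w\<close>. So gauge-invariant uniqueness applies.\<close>

theorem branching_isomorphic_CK_algebra:
  fixes deg :: "'p \<Rightarrow> nat"
  assumes nonempty: "\<And>x. x \<in> verts F \<Longrightarrow> D x \<noteq> {}"
    and deg: "\<And>f u. f \<in> arcs F \<Longrightarrow> u \<in> R f \<Longrightarrow> deg u = Suc (deg (g f u))"
  shows "star_isomorphic (cstar_generated B (P ` verts F \<union> S ` arcs F)) (CK_algebra F)"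
proof -
  interpret B: cstar_algebra B by (rule B_ell2_cstar_algebra)
  define U where "U z = diag_op X (\<lambda>w. z ^ deg w)" for z
  define V where "V z = diag_op X (\<lambda>w. cnj (z ^ deg w))" for z
  have U: "U z \<in> bounded_ops X" and V: "V z \<in> bounded_ops X" and adj: "cadj B (U z) = V z"
    if "cmod z = 1" for z
    unfolding U_def V_def
    by (rule diag_op_bounded diag_op_adj; simp add: norm_power that)+
  have U_apply: "U z f w = z ^ deg w * f w" and V_apply: "V z f w = cnj (z ^ deg w) * f w"
    if "f \<in> ell2 X" for z f w
    using that by (simp_all add: U_def V_def diag_op_def)
  have unit: "cnj (z ^ k) * z ^ k = 1" if "cmod z = 1" for z k
  proof -
    have "cmod (z ^ k) = 1" using that by (simp add: norm_power)
    then show ?thesis using complex_norm_square[of "z ^ k"] by (simp add: mult.commute del: complex_cnj_power)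
  qed
  have unitary: "cmul B (cadj B (U z)) (cmul B (U z) T) = T" if z: "cmod z = 1" and T: "T \<in> carrier B" for z T
  proof (rule B_ell2_eqI)
    have T': "T \<in> bounded_ops X" using T by simp
    show "T \<in> bounded_ops X" by (rule T')
    show "cmul B (cadj B (U z)) (cmul B (U z) T) \<in> bounded_ops X"
      using bounded_ops_mul[OF V[OF z] bounded_ops_mul[OF U[OF z] T']] by (simp add: adj z)
    fix f u assume "f \<in> ell2 X"
    show "cmul B (cadj B (U z)) (cmul B (U z) T) f u = T f u"
      using bounded_ops_range[OF T', of f] bounded_ops_range[OF U[OF z]] unit[OF z, of "deg u"]
      by (simp add: adj z U_apply V_apply mult.assoc[symmetric] del: complex_cnj_power)
  qed
  let ?\<beta> = "\<lambda>z T. cmul B (cmul B (U z) T) (cadj B (U z))"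
  show ?thesis
  proof (rule gauge_invariant_uniqueness[OF fin_digraph_axioms B_ell2_cstar_algebra CK_family_branching,
      where \<beta> = ?\<beta>])
    fix x assume x: "x \<in> verts F"
    then obtain w where w: "w \<in> D x" using nonempty by blast
    then have "w \<in> X" using D_sub x by blast
    then have "P x (basis_vec w) w = 1" using w by (simp add: P_apply[OF basis_vec_ell2]) (simp add: basis_vec_def)
    then show "P x \<noteq> czero B" by auto
  next
    fix z assume z: "cmod z = 1"
    show "star_hom B B (?\<beta> z)"
      by (rule B.conjugation_star_hom) (use U[OF z] unitary[OF z] in auto)
    show "cnorm B (?\<beta> z T) \<le> cnorm B T" if "T \<in> carrier B" for T
      by (rule B.conjugation_star_hom) (use U[OF z] unitary[OF z] that in auto)
  next
    fix z x assume z: "cmod z = 1" and x: "x \<in> verts F"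
    show "?\<beta> z (P x) = P x"
    proof (rule B_ell2_eqI)
      show "?\<beta> z (P x) \<in> bounded_ops X"
        using bounded_ops_mul[OF U[OF z] bounded_ops_mul[OF P_bounded[OF x] V[OF z]]] by (simp add: adj z)
      fix f u assume f: "f \<in> ell2 X"
      show "?\<beta> z (P x) f u = P x f u"
        using f unit[OF z, of "deg u"] bounded_ops_range[OF P_bounded[OF x]] bounded_ops_range[OF V[OF z]]
        by (simp add: adj z U_apply V_apply P_apply mult.assoc[symmetric] mult.commute[of "z ^ _"] del: complex_cnj_power)
    qed (rule P_bounded[OF x])
  next
    fix z e assume z: "cmod z = 1" and e: "e \<in> arcs F"
    show "?\<beta> z (S e) = csmul B z (S e)"
    proof (rule B_ell2_eqI)
      show "?\<beta> z (S e) \<in> bounded_ops X"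
        using bounded_ops_mul[OF U[OF z] bounded_ops_mul[OF S_bounded[OF e] V[OF z]]] by (simp add: adj z)
      show "csmul B z (S e) \<in> bounded_ops X" using bounded_ops_smul[OF S_bounded[OF e]] by simp
      fix f u assume f: "f \<in> ell2 X"
      show "?\<beta> z (S e) f u = csmul B z (S e) f u"
      proof (cases "u \<in> R e")
        case True
        have "z ^ deg u * (cnj (z ^ deg (g e u)) * f (g e u)) =
            z * (cnj (z ^ deg (g e u)) * z ^ deg (g e u)) * f (g e u)"
          using deg[OF e True] by simp
        then show ?thesis
          using True f unit[OF z, of "deg (g e u)"] bounded_ops_range[OF S_bounded[OF e]] bounded_ops_range[OF V[OF z]]
          by (simp add: adj z U_apply V_apply S_apply del: complex_cnj_power)
      next
        case False
        then show ?thesis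
          using f bounded_ops_range[OF S_bounded[OF e]] bounded_ops_range[OF V[OF z]]
          by (simp add: adj z U_apply S_apply)
      qed
    qed
  qed
qed

end

section \<open>Paths and residues\<close>

lemma plen_pext [simp]: "plen (pext e w) = Suc (plen w)"
  and plen_vpath [simp]: "plen (vpath v) = 0"
  and snd_pext [simp]: "snd (pext e w) \<noteq> []"
  and vpath_eq_iff [simp]: "vpath v = vpath v' \<longleftrightarrow> v = v'"
  and pext_eq_iff [simp]: "pext e w = pext e' w' \<longleftrightarrow> e = e' \<and> w = w'"
  by (auto simp: plen_def pext_def vpath_def prod_eq_iff)

lemma prange_vpath [simp]: "prange E (vpath v) = v"
  and prange_pext [simp]: "prange E (pext e w) = head E e"
  by (simp_all add: prange_def vpath_def pext_def pre_digraph.awalk_verts_conv)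

lemma plen_0: "plen w = 0 \<Longrightarrow> w = vpath (fst w)"
  by (simp add: plen_def vpath_def prod_eq_iff)

definition pbutlast :: "('v,'e) path \<Rightarrow> ('v,'e) path" where
  "pbutlast w = (fst w, butlast (snd w))"

lemma pbutlast_pext [simp]: "pbutlast (pext e w) = w"
  by (simp add: pbutlast_def pext_def)

locale period_graph = fin_digraph E for E :: "('v,'e) pre_digraph" +
  fixes n :: nat
  assumes n: "n \<ge> 1"
begin

lemma paths_iff: "w \<in> paths E \<longleftrightarrow> awalk (fst w) (snd w) (prange E w)"
  by (cases w) (auto simp: paths_def prange_def)

lemma vpath_in_paths: "v \<in> verts E \<Longrightarrow> vpath v \<in> paths E"
  by (simp add: paths_iff awalk_Nil_iff) (simp add: vpath_def awalk_Nil_iff)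

lemma prange_in_verts: "w \<in> paths E \<Longrightarrow> prange E w \<in> verts E"
  unfolding paths_iff by (rule awalk_last_in_verts)

lemma pext_in_paths_iff:
  "pext e w \<in> paths E \<longleftrightarrow> w \<in> paths E \<and> e \<in> arcs E \<and> tail E e = prange E w"
  unfolding paths_iff prange_pext
  by (auto simp: pext_def awalk_simps prange_def)

lemma path_cases:
  assumes "w \<in> paths E"
  obtains (vertex) v where "v \<in> verts E" "w = vpath v"
  | (step) e w' where "e \<in> arcs E" "w' \<in> paths E" "tail E e = prange E w'" "w = pext e w'"
proof (cases "snd w = []")
  case True
  then have "w = vpath (fst w)" by (simp add: vpath_def prod_eq_iff)
  moreover have "fst w \<in> verts E" using assms by (auto simp: paths_iff)
  ultimately show thesis by (rule vertex[rotated])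
next
  case False
  then have "w = pext (last (snd w)) (pbutlast w)" by (simp add: pext_def pbutlast_def prod_eq_iff)
  then show thesis using assms step[of "last (snd w)" "pbutlast w"] pext_in_paths_iff by metis
qed

lemma plen_residue: "plen (residue E n w) = plen w mod n"
  by (simp add: residue_def Let_def plen_def minus_mult_div_eq_mod)

lemma residue_small: "plen w < n \<Longrightarrow> residue E n w = w"
  by (simp add: residue_def Let_def prange_def prod_eq_iff)

lemma residue_in_paths: "w \<in> paths E \<Longrightarrow> residue E n w \<in> paths E"
  and prange_residue: "w \<in> paths E \<Longrightarrow> prange E (residue E n w) = prange E w"
proof -
  assume w: "w \<in> paths E"
  define m where "m = n * (plen w div n)"
  have "awalk (fst w) (take m (snd w) @ drop m (snd w)) (prange E w)" using w by (simp add: paths_iff)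
  then have "awalk (awlast (fst w) (take m (snd w))) (drop m (snd w)) (prange E w)"
    unfolding awalk_append_iff by blast
  moreover have r: "residue E n w = (awlast (fst w) (take m (snd w)), drop m (snd w))"
    by (simp add: residue_def Let_def m_def prange_def)
  ultimately show "residue E n w \<in> paths E" "prange E (residue E n w) = prange E w"
    by (auto simp: paths_def prange_def)
qed

text \<open>If \<open>|w| + 1\<close> is a multiple of \<open>n\<close>, then the new edge completes a block of length \<open>n\<close> and only the
  range is left; otherwise the same edges are removed from \<open>e w\<close> as from \<open>w\<close>.\<close>

lemma residue_pext:
  shows "residue E n (pext e w) =
    (if plen (residue E n w) < n - 1 then pext e (residue E n w) else vpath (head E e))"
proof (cases "Suc (plen w) mod n = 0")
  case True
  then have *: "n * (Suc (plen w) div n) = Suc (plen w)" by auto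
  have "plen w mod n = n - 1"
    using True n by (metis Suc_pred' diff_Suc_1 less_eq_Suc_le mod_Suc nat.distinct(1) One_nat_def)
  moreover have "residue E n (pext e w) = vpath (head E e)"
    unfolding residue_def Let_def plen_pext *
    using prange_pext[of E e w] by (simp add: vpath_def plen_def pext_def)
  ultimately show ?thesis by (simp add: plen_residue)
next
  case False
  then have l: "Suc (plen w mod n) < n" "Suc (plen w) div n = plen w div n"
    using n by (auto simp: mod_Suc div_Suc split: if_splits)
      (metis Suc_lessI le_numeral_extra(4) mod_less_divisor not_le less_eq_Suc_le One_nat_def)
  have "n * (plen w div n) \<le> length (snd w)" by (simp add: plen_def)
  then have "residue E n (pext e w) = pext e (residue E n w)"
    unfolding residue_def Let_def plen_pext l(2) by (simp add: pext_def)
  moreover have "plen (residue E n w) < n - 1" using l(1) by (simp add: plen_residue)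
  ultimately show ?thesis by simp
qed

lemma finite_short_paths: "finite {w \<in> paths E. plen w < n}"
proof (rule finite_subset)
  show "{w \<in> paths E. plen w < n} \<subseteq> verts E \<times> {p. set p \<subseteq> arcs E \<and> length p \<le> n}"
    by (auto simp: paths_iff plen_def awalk_def)
  show "finite (verts E \<times> {p. set p \<subseteq> arcs E \<and> length p \<le> n})"
    by (intro finite_cartesian_product finite_lists_length_le) auto
qed

text \<open>These classes partition the paths and carry the branching system. The vertex paths are kept
  apart because they are the only paths that do not arise from another path by appending an edge:
  the projections onto them are the defect of the shifts from a Cuntz-Krieger family of \<open>E(n)\<close>, and
  the vertices \<open>c(v)\<close>, which receive no edge, account for it.\<close>

fun pclass :: "('v,'e) path + 'v \<Rightarrow> ('v,'e) path set" where
  "pclass (Inl r) = {w \<in> paths E. plen w > 0 \<and> residue E n w = r}"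
| "pclass (Inr v) = {vpath v}"

fun class_range :: "('v,'e) path + 'v \<Rightarrow> 'v" where
  "class_range (Inl r) = prange E r"
| "class_range (Inr v) = v"

abbreviation "F \<equiv> graph_bracket E n"

lemma verts_F: "x \<in> verts F \<longleftrightarrow>
    (case x of Inl r \<Rightarrow> r \<in> paths E \<and> plen r < n | Inr v \<Rightarrow> v \<in> verts E)"
  by (auto simp: graph_bracket_def graph_paren_def split: sum.splits)

lemma arcs_F: "(e, x) \<in> arcs F \<longleftrightarrow> e \<in> arcs E \<and> x \<in> verts F \<and> tail E e = class_range x"
  by (cases x) (auto simp: verts_F graph_bracket_def graph_paren_def)

lemma tail_F [simp]: "tail F (e, x) = x"
  by (cases x) (auto simp: graph_bracket_def graph_paren_def)

lemma head_F: "head F (e, x) = Inl (case x of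
      Inl r \<Rightarrow> if plen r < n - 1 then pext e r else vpath (head E e)
    | Inr v \<Rightarrow> if n > 1 then pext e (vpath v) else vpath (head E e))"
  by (cases x) (auto simp: graph_bracket_def graph_paren_def)

lemma pclass_range: "x \<in> verts F \<Longrightarrow> w \<in> pclass x \<Longrightarrow> w \<in> paths E \<and> prange E w = class_range x"
  by (cases x) (auto simp: verts_F vpath_in_paths dest: prange_residue)

text \<open>Appending an edge to a path has the effect on its class that the range map of the graph
  describes.\<close>

lemma pext_pclass:
  assumes "(e, x) \<in> arcs F" "w \<in> pclass x"
  shows "pext e w \<in> pclass (head F (e, x))"
proof -
  have "pext e w \<in> paths E"
    using assms pclass_range[of x w] by (auto simp: arcs_F pext_in_paths_iff)
  moreover have "head F (e, x) = Inl (residue E n (pext e w))"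
    using assms(2) n by (cases x) (auto simp: head_F residue_pext residue_small)
  ultimately show ?thesis by simp
qed

lemma pclass_ex:
  assumes "w \<in> paths E"
  obtains x where "x \<in> verts F" "w \<in> pclass x"
proof (cases "plen w = 0")
  case True
  then have "w = vpath (fst w)" by (rule plen_0)
  moreover have "fst w \<in> verts E" using assms by (auto simp: paths_iff)
  ultimately show thesis by (intro that[of "Inr (fst w)"]) (auto simp: verts_F)
next
  case False
  then show thesis
    using assms n by (intro that[of "Inl (residue E n w)"]) (auto simp: verts_F residue_in_paths plen_residue)
qed

lemma pclass_unique: "x \<noteq> y \<Longrightarrow> pclass x \<inter> pclass y = {}"
  by (cases x; cases y) auto

lemma fin_digraph_F: "fin_digraph F"
proof -
  have V: "finite (verts F)"
    using finite_short_paths by (simp add: graph_bracket_def graph_paren_def)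
  have "arcs F \<subseteq> arcs E \<times> verts F" using arcs_F by auto
  then have A: "finite (arcs F)" using V by (auto intro: finite_subset)
  have "tail F f \<in> verts F \<and> head F f \<in> verts F" if f: "f \<in> arcs F" for f
  proof -
    obtain e x where fx: "f = (e, x)" by (cases f)
    have ex: "e \<in> arcs E" "x \<in> verts F" "tail E e = class_range x" using f fx arcs_F by auto
    have "head F f \<in> verts F"
      using ex n unfolding fx head_F
      by (cases x) (auto simp: verts_F vpath_in_paths pext_in_paths_iff)
    then show ?thesis using ex fx by simp
  qed
  then show ?thesis using V A by unfold_locales auto
qed

end

section \<open>Periodic weighted shifts\<close>

locale shift_graph = period_graph E n for E :: "('v,'e) pre_digraph" and n :: nat +
  assumes nsns: "no_sinks_no_sources E"
begin

lemma ex_path_to: "v \<in> verts E \<Longrightarrow> \<exists>w\<in>paths E. plen w = k \<and> prange E w = v"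
proof (induction k arbitrary: v)
  case 0
  then show ?case by (intro bexI[of _ "vpath v"]) (auto intro: vpath_in_paths)
next
  case (Suc k)
  then obtain e where e: "e \<in> arcs E" "head E e = v" using nsns by (auto simp: no_sinks_no_sources_def)
  then obtain w where w: "w \<in> paths E" "plen w = k" "prange E w = tail E e"
    using Suc.IH[of "tail E e"] by auto
  show ?case
    by (rule bexI[of _ "pext e w"]) (use e w pext_in_paths_iff in auto)
qed

text \<open>The class of a vertex \<open>v\<close> of \<open>E(n)\<close> contains the paths of length \<open>n\<close> that end in \<open>v\<close>; they exist
  because \<open>E\<close> has no sources.\<close>

lemma pclass_nonempty: "x \<in> verts F \<Longrightarrow> pclass x \<noteq> {}"
proof (cases x)
  case (Inl r)
  assume x: "x \<in> verts F"
  show ?thesis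
  proof (cases "plen r = 0")
    case True
    then have r: "r = vpath (fst r)" by (rule plen_0)
    obtain v where v: "r = vpath v" "v \<in> verts E"
      using r x Inl prange_in_verts[of r] prange_vpath[of E "fst r"] by (auto simp: verts_F)
    obtain w where w: "w \<in> paths E" "plen w = n" "prange E w = v"
      using ex_path_to[OF v(2)] by blast
    have "plen (residue E n w) = 0" using w(2) by (simp add: plen_residue)
    then have "residue E n w = vpath (fst (residue E n w))" by (rule plen_0)
    then have "residue E n w = vpath v"
      using prange_residue[OF w(1)] prange_vpath[of E "fst (residue E n w)"] w(3) by simp
    then have "w \<in> pclass x" using w n v Inl by simp
    then show ?thesis by blast
  next
    case False
    then have "r \<in> pclass x" using x Inl residue_small by (auto simp: verts_F)
    then show ?thesis by blast
  qed
qed simp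

sublocale CK: branching_system F "paths E" pclass "\<lambda>f. pext (fst f) ` pclass (snd f)" "\<lambda>_. pbutlast" "\<lambda>f. pext (fst f)"
proof -
  interpret F: fin_digraph F by (rule fin_digraph_F)
  show "branching_system F (paths E) pclass (\<lambda>f. pext (fst f) ` pclass (snd f)) (\<lambda>_. pbutlast) (\<lambda>f. pext (fst f))"
  proof
    fix x assume "x \<in> verts F"
    then show "pclass x \<subseteq> paths E" using pclass_range by blast
  next
    fix x y :: "('v, 'e) path + 'v" assume "x \<noteq> y"
    then show "pclass x \<inter> pclass y = {}" by (rule pclass_unique)
  next
    fix f assume f: "f \<in> arcs F"
    obtain e x where ex: "f = (e, x)" by (cases f)
    show "pext (fst f) ` pclass (snd f) \<subseteq> pclass (head F f)"
      using pext_pclass f ex by auto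
    show "pext (fst f) w \<in> pext (fst f) ` pclass (snd f) \<and> pbutlast (pext (fst f) w) = w"
      if "w \<in> pclass (tail F f)" for w using that ex by simp
    show "pbutlast u \<in> pclass (tail F f) \<and> pext (fst f) (pbutlast u) = u"
      if "u \<in> pext (fst f) ` pclass (snd f)" for u using that ex by auto
    show "pclass (head F f) \<subseteq> (\<Union>f'\<in>{f' \<in> arcs F. head F f' = head F f}. pext (fst f') ` pclass (snd f'))"
    proof
      fix u assume u: "u \<in> pclass (head F f)"
      then have "u \<in> paths E" "plen u > 0" unfolding ex head_F by auto
      then obtain e' w where w: "e' \<in> arcs E" "w \<in> paths E" "tail E e' = prange E w" "u = pext e' w"
        by (cases u rule: path_cases) auto
      obtain y where y: "y \<in> verts F" "w \<in> pclass y" using w(2) by (rule pclass_ex)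
      have e'y: "(e', y) \<in> arcs F" using w y pclass_range arcs_F by simp
      have "head F (e', y) = head F f"
        using pext_pclass[OF e'y y(2)] u w(4) pclass_unique[of "head F (e', y)" "head F f"] by blast
      then show "u \<in> (\<Union>f'\<in>{f' \<in> arcs F. head F f' = head F f}. pext (fst f') ` pclass (snd f'))"
        using e'y y(2) w(4) by (intro UN_I[of "(e', y)"]) auto
    qed
  next
    fix f f' assume "f \<in> arcs F" "f' \<in> arcs F" and ne: "f \<noteq> f'"
    show "pext (fst f) ` pclass (snd f) \<inter> pext (fst f') ` pclass (snd f') = {}"
    proof (rule ccontr)
      assume "\<not> ?thesis"
      then obtain w where "fst f = fst f'" "w \<in> pclass (snd f)" "w \<in> pclass (snd f')" by auto
      then show False using ne pclass_unique[of "snd f" "snd f'"] by (auto simp: prod_eq_iff)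
    qed
  qed
qed

abbreviation "P \<equiv> CK.P"
abbreviation "S \<equiv> CK.S"
abbreviation "B \<equiv> B_ell2 (paths E)"

abbreviation CK_gens :: "((('v,'e) path \<Rightarrow> complex) \<Rightarrow> ('v,'e) path \<Rightarrow> complex) set" where
  "CK_gens \<equiv> P ` verts F \<union> S ` arcs F"

definition shift_gens :: "((('v,'e) path \<Rightarrow> complex) \<Rightarrow> ('v,'e) path \<Rightarrow> complex) set" where
  "shift_gens = {T e |T lam e. weighted_shift E lam T \<and> period E n lam \<and> e \<in> arcs E}"

abbreviation "CK_alg \<equiv> carrier (cstar_generated B CK_gens)"
abbreviation "shift_alg \<equiv> carrier (cstar_generated B shift_gens)"

lemma CK_gens_bounded: "CK_gens \<subseteq> carrier B"
  using CK.P_bounded CK.S_bounded by auto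

lemma shift_gens_bounded: "shift_gens \<subseteq> carrier B"
  by (auto simp: shift_gens_def weighted_shift_def)

lemma S_basis_vec:
  assumes "(e, x) \<in> arcs F" "w \<in> paths E"
  shows "S (e, x) (basis_vec w) = (if w \<in> pclass x then basis_vec (pext e w) else (\<lambda>_. 0))"
  unfolding CK.S_def by (rule pull_op_basis_vec) (use assms in auto)

fun class_rep :: "('v,'e) path + 'v \<Rightarrow> ('v,'e) path" where
  "class_rep (Inl r) = r"
| "class_rep (Inr v) = vpath v"

text \<open>The weight of a shift of period \<open>n\<close> is constant on classes, so the shift is a linear
  combination of the generators of the Cuntz-Krieger family.\<close>

lemma shift_in_generated:
  assumes T: "weighted_shift E lam T" and lam: "period E n lam" and e: "e \<in> arcs E"
  shows "T e \<in> CK_alg"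
proof -
  interpret B: cstar_algebra B by (rule B_ell2_cstar_algebra)
  let ?K = "{f \<in> arcs F. fst f = e}"
  let ?s = "\<lambda>f. csmul B (lam (pext e (class_rep (snd f)))) (S f)"
  have bdd: "?s f \<in> bounded_ops (paths E)" if "f \<in> ?K" for f
    using that bounded_ops_smul[OF CK.S_bounded[of f]] by simp
  have Te: "T e \<in> bounded_ops (paths E)"
    and T_basis: "\<And>w. w \<in> paths E \<Longrightarrow> T e (basis_vec w) = (if tail E e = prange E w
      then (\<lambda>u. lam (pext e w) * basis_vec (pext e w) u) else (\<lambda>u. 0))"
    using T e by (auto simp: weighted_shift_def)
  have "T e = csum B ?s ?K"
  proof (rule bounded_ops_eqI[OF Te])
    show "csum B ?s ?K \<in> bounded_ops (paths E)" using B.csum_closed[of ?K ?s] bdd by simp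
    fix w assume w: "w \<in> paths E"
    obtain x where x: "x \<in> verts F" "w \<in> pclass x" using w by (rule pclass_ex)
    have S_w: "?s f (basis_vec w) = (if snd f = x
        then (\<lambda>u. lam (pext e (class_rep x)) * basis_vec (pext e w) u) else (\<lambda>u. 0))" if "f \<in> ?K" for f
    proof -
      have "w \<in> pclass (snd f) \<longleftrightarrow> snd f = x" using pclass_unique[of "snd f" x] x(2) by blast
      moreover have "(e, snd f) \<in> arcs F" "f = (e, snd f)" using that by (auto simp: prod_eq_iff)
      ultimately show ?thesis using S_basis_vec[of e "snd f" w] w by simp
    qed
    show "T e (basis_vec w) = csum B ?s ?K (basis_vec w)"
    proof
      fix u
      have "csum B ?s ?K (basis_vec w) u = (\<Sum>f\<in>?K. ?s f (basis_vec w) u)"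
        by (rule B_ell2_csum[OF _ bdd]) auto
      also have "\<dots> = T e (basis_vec w) u"
      proof (cases "tail E e = prange E w")
        case True
        then have ex: "(e, x) \<in> ?K" using e x pclass_range[OF x] arcs_F by simp
        have "(\<Sum>f\<in>?K. ?s f (basis_vec w) u) = (\<Sum>f\<in>{(e, x)}. ?s f (basis_vec w) u)"
          by (rule sum.mono_neutral_right) (use ex S_w in \<open>auto simp: prod_eq_iff\<close>)
        also have "\<dots> = lam (pext e (class_rep x)) * basis_vec (pext e w) u"
          using S_w[OF ex] by simp
        also have "lam (pext e (class_rep x)) = lam (pext e w)"
        proof (cases x)
          case (Inl r)
          then have r: "r \<in> paths E" "residue E n w = residue E n r" "prange E w = prange E r"
            using x w residue_small[of r] by (auto simp: verts_F dest: prange_residue)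
          show ?thesis
            using lam[unfolded period_def, rule_format, OF e w r(1)] r(2,3) True Inl by simp
        next
          case (Inr v)
          then show ?thesis using x by simp
        qed
        finally show ?thesis using T_basis[OF w] True by simp
      next
        case False
        have "snd f \<noteq> x" if "f \<in> ?K" for f
          using that False pclass_range[OF x] arcs_F[of e "snd f"] by (auto simp: prod_eq_iff)
        then have "(\<Sum>f\<in>?K. ?s f (basis_vec w) u) = 0" by (intro sum.neutral) (use S_w in auto)
        then show ?thesis using T_basis[OF w] False by simp
      qed
      finally show "T e (basis_vec w) u = csum B ?s ?K (basis_vec w) u" by simp
    qed
  qed
  also have "csum B ?s ?K \<in> CK_alg"
  proof (rule B.generated_csum[OF CK_gens_bounded])
    fix f assume "f \<in> ?K"
    then have "S f \<in> CK_alg"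
      using B.generated_superset[of CK_gens] by blast
    then show "?s f \<in> CK_alg" by (rule B.generated_smul[OF CK_gens_bounded])
  qed simp
  finally show ?thesis .
qed

abbreviation residue_class :: "('v,'e) path \<Rightarrow> ('v,'e) path set" where
  "residue_class r \<equiv> {w \<in> paths E. residue E n w = r}"

text \<open>These are the operators \<open>T\<^bsub>(e,r)\<^esub>\<close> that map \<open>\<xi>\<^sub>w\<close> to \<open>\<xi>\<^bsub>ew\<^esub>\<close> if \<open>w(n) = r\<close> and to 0 otherwise.\<close>

definition unit_shift :: "'e \<Rightarrow> ('v,'e) path \<Rightarrow> (('v,'e) path \<Rightarrow> complex) \<Rightarrow> ('v,'e) path \<Rightarrow> complex" where
  "unit_shift e r = pull_op (paths E) (pext e ` residue_class r) pbutlast"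

context
  fixes e r assumes er: "e \<in> arcs E" "r \<in> paths E" "plen r < n" "tail E e = prange E r"
begin

lemma residue_class_range: "w \<in> residue_class r \<Longrightarrow> prange E w = tail E e"
  using er prange_residue by fastforce

lemma unit_shift_bounded: "unit_shift e r \<in> bounded_ops (paths E)"
  unfolding unit_shift_def
proof (rule pull_op_bounded)
  show "pext e ` residue_class r \<subseteq> paths E"
    using er residue_class_range by (auto simp: pext_in_paths_iff)
qed (auto intro!: inj_on_inverseI[of _ "pext e"])

text \<open>The shift with weight 1 on the paths \<open>e w\<close> with \<open>w(n) = r\<close> and weight 0 elsewhere has period \<open>n\<close>.\<close>

lemma unit_shift_in_gens: "unit_shift e r \<in> shift_gens"
proof -
  define T where "T e' = (if e' = e then unit_shift e r else (\<lambda>f u. 0))" for e'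
  define lam :: "('v,'e) path \<Rightarrow> complex" where "lam u = (if u \<in> pext e ` residue_class r then 1 else 0)" for u
  interpret B: cstar_algebra B by (rule B_ell2_cstar_algebra)
  have "weighted_shift E lam T"
    unfolding weighted_shift_def
  proof (intro ballI conjI)
    show "T e' \<in> bounded_ops (paths E)" for e'
      using unit_shift_bounded B.zero_closed by (simp add: T_def)
    fix e' w assume e': "e' \<in> arcs E" and w: "w \<in> paths E"
    have "unit_shift e r (basis_vec w) = (if w \<in> residue_class r then basis_vec (pext e w) else (\<lambda>_. 0))"
      unfolding unit_shift_def by (rule pull_op_basis_vec) (use w in auto)
    then show "T e' (basis_vec w) = (if tail E e' = prange E w
        then (\<lambda>u. lam (pext e' w) * basis_vec (pext e' w) u) else (\<lambda>u. 0))"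
      using residue_class_range[of w] by (auto simp: T_def lam_def)
  qed
  moreover have "period E n lam"
    unfolding period_def by (auto simp: lam_def)
  moreover have "unit_shift e r = T e" by (simp add: T_def)
  ultimately show ?thesis using er(1) unfolding shift_gens_def by blast
qed

lemma unit_shift_adj: "cadj B (unit_shift e r) = pull_op (paths E) (residue_class r) (pext e)"
  unfolding unit_shift_def
proof (rule pull_op_adj)
  show "pext e ` residue_class r \<subseteq> paths E"
    using er residue_class_range by (auto simp: pext_in_paths_iff)
qed auto

end

definition step_proj :: "(('v,'e) path \<Rightarrow> complex) \<Rightarrow> ('v,'e) path \<Rightarrow> complex" where
  "step_proj = pull_op (paths E) {w \<in> paths E. plen w > 0} (\<lambda>w. w)"

lemma step_proj_bounded: "step_proj \<in> bounded_ops (paths E)"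
  unfolding step_proj_def by (rule pull_op_bounded) auto

text \<open>Every path of positive length is in the range of exactly one unit shift \<open>T\<^bsub>(e,r)\<^esub>\<close>, so the sum of
  the \<open>T\<^bsub>(e,r)\<^esub> T\<^bsub>(e,r)\<^esub>\<^sup>\<star>\<close> is the projection onto these paths.\<close>

lemma step_proj_in_generated: "step_proj \<in> shift_alg"
proof -
  interpret B: cstar_algebra B by (rule B_ell2_cstar_algebra)
  define K where "K = {(e, r). e \<in> arcs E \<and> r \<in> paths E \<and> plen r < n \<and> tail E e = prange E r}"
  have K: "finite K"
    by (rule finite_subset[of _ "arcs E \<times> {w \<in> paths E. plen w < n}"])
      (use finite_short_paths in \<open>auto simp: K_def\<close>)
  define Q where "Q k = cmul B (case_prod unit_shift k) (cadj B (case_prod unit_shift k))" for k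
  have QM: "Q k \<in> shift_alg" if "k \<in> K" for k
  proof -
    have "case_prod unit_shift k \<in> shift_alg"
      using that unit_shift_in_gens B.generated_superset[of shift_gens] by (auto simp: K_def)
    then show ?thesis unfolding Q_def
      using B.generated_mul[OF shift_gens_bounded] B.generated_adj[OF shift_gens_bounded] by blast
  qed
  have Qb: "Q k \<in> bounded_ops (paths E)" if "k \<in> K" for k
    using B.generated_sub[OF shift_gens_bounded QM[OF that]] by simp
  have Q: "Q k f u = (if u \<in> pext (fst k) ` residue_class (snd k) then f u else 0)"
    if k: "k \<in> K" and f: "f \<in> ell2 (paths E)" for k f u
  proof -
    obtain e r where er: "k = (e, r)" "e \<in> arcs E" "r \<in> paths E" "plen r < n" "tail E e = prange E r"
      using k by (auto simp: K_def)
    note er' = er(2-)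
    have G: "pull_op (paths E) (residue_class r) (pext e) f \<in> ell2 (paths E)"
      using bounded_ops_range[OF B_ell2_adj(1)[OF unit_shift_bounded[OF er']]] unit_shift_adj[OF er'] by simp
    have "Q k f = unit_shift e r (pull_op (paths E) (residue_class r) (pext e) f)"
      by (simp add: Q_def er(1) unit_shift_adj[OF er'])
    then have "Q k f u = (if u \<in> pext e ` residue_class r
        then (if pbutlast u \<in> residue_class r then f (pext e (pbutlast u)) else 0) else 0)"
      by (simp only: unit_shift_def pull_op_apply[OF G] pull_op_apply[OF f])
    also have "\<dots> = (if u \<in> pext e ` residue_class r then f u else 0)"
      by (rule if_cong[OF refl _ refl], erule imageE, simp)
    finally show ?thesis by (simp only: er(1) fst_conv snd_conv)
  qed
  have "step_proj = csum B Q K"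
  proof (rule B_ell2_eqI[OF step_proj_bounded])
    show "csum B Q K \<in> bounded_ops (paths E)" using B.csum_closed[of K Q] Qb by simp
    fix f u assume f: "f \<in> ell2 (paths E)"
    let ?t = "\<lambda>k. if u \<in> pext (fst k) ` residue_class (snd k) then f u else 0"
    have "csum B Q K f u = (\<Sum>k\<in>K. Q k f u)" by (rule B_ell2_csum[OF K Qb])
    also have "\<dots> = sum ?t K"
      by (rule sum.cong) (use Q f in auto)
    also have "\<dots> = step_proj f u"
    proof (cases "u \<in> paths E \<and> plen u > 0")
      case True
      then have "u \<in> paths E" "plen u > 0" by simp_all
      then obtain e w where w: "e \<in> arcs E" "w \<in> paths E" "tail E e = prange E w" "u = pext e w"
        by (cases u rule: path_cases) auto
      let ?k = "(e, residue E n w)"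
      have k: "?k \<in> K"
        using w n by (auto simp: K_def residue_in_paths prange_residue plen_residue)
      have "sum ?t K =
          sum ?t {?k}"
      proof (rule sum.mono_neutral_right[OF K])
        show "\<forall>k\<in>K - {?k}. ?t k = 0"
          unfolding w(4) image_iff by auto
      qed (simp add: k)
      moreover have "u \<in> pext e ` residue_class (residue E n w)" using w by simp
      ultimately show ?thesis using True f by (simp add: step_proj_def pull_op_apply)
    next
      case False
      have "sum ?t K = 0"
      proof (rule sum.neutral, rule ballI)
        fix k assume k: "k \<in> K"
        have "u \<notin> pext (fst k) ` residue_class (snd k)"
        proof
          assume "u \<in> pext (fst k) ` residue_class (snd k)"
          then obtain w where w: "w \<in> paths E" "residue E n w = snd k" "u = pext (fst k) w" by blast
          have "fst k \<in> arcs E" "tail E (fst k) = prange E w"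
            using k prange_residue[OF w(1)] w(2) by (auto simp: K_def)
          then show False using False w(1,3) by (simp add: pext_in_paths_iff)
        qed
        then show "?t k = 0" by simp
      qed
      then show ?thesis using False f by (auto simp: step_proj_def pull_op_apply)
    qed
    finally show "step_proj f u = csum B Q K f u" by simp
  qed
  also have "csum B Q K \<in> shift_alg"
    by (rule B.generated_csum[OF shift_gens_bounded K QM])
  finally show ?thesis .
qed

text \<open>With \<open>N\<close> the projection onto the paths of positive length, the unit shift \<open>T\<^bsub>(e,r)\<^esub>\<close> splits into
  \<open>T\<^bsub>(e,r)\<^esub> N\<close>, which is \<open>S\<^bsub>(e,r)\<^esub>\<close>, and a rest, which vanishes unless \<open>r\<close> is a vertex \<open>v\<close> and is
  \<open>S\<^bsub>(e,c(v))\<^esub>\<close> in this case.\<close>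

lemma S_in_generated:
  assumes "f \<in> arcs F" shows "S f \<in> shift_alg"
proof -
  interpret B: cstar_algebra B by (rule B_ell2_cstar_algebra)
  note ops = B.generated_mul[OF shift_gens_bounded] B.generated_add[OF shift_gens_bounded]
    B.generated_smul[OF shift_gens_bounded]
  have T: "unit_shift e r \<in> shift_alg"
    if "e \<in> arcs E" "r \<in> paths E" "plen r < n" "tail E e = prange E r" for e r
    using unit_shift_in_gens[OF that] B.generated_superset by blast
  have range: "step_proj f \<in> ell2 (paths E)" for f by (rule bounded_ops_range[OF step_proj_bounded])
  obtain e x where ex: "f = (e, x)" by (cases f)
  show ?thesis
  proof (cases x)
    case (Inl r)
    then have er: "e \<in> arcs E" "r \<in> paths E" "plen r < n" "tail E e = prange E r"
      using assms ex by (auto simp: arcs_F verts_F)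
    have "S f = cmul B (unit_shift e r) step_proj"
    proof (rule B_ell2_eqI[OF CK.S_bounded[OF assms]])
      show "cmul B (unit_shift e r) step_proj \<in> bounded_ops (paths E)"
        using bounded_ops_mul[OF unit_shift_bounded[OF er] step_proj_bounded] by simp
      fix k u assume k: "k \<in> ell2 (paths E)"
      show "S f k u = cmul B (unit_shift e r) step_proj k u"
        using k range[of k] unfolding ex Inl
        by (auto simp: CK.S_apply unit_shift_def pull_op_apply) (auto simp: step_proj_def pull_op_apply)
    qed
    then show ?thesis using ops(1)[OF T[OF er] step_proj_in_generated] by simp
  next
    case (Inr v)
    then have v: "e \<in> arcs E" "vpath v \<in> paths E" "plen (vpath v) < n" "tail E e = prange E (vpath v)"
      using assms ex n by (auto simp: arcs_F verts_F vpath_in_paths)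
    let ?R = "csub B (unit_shift e (vpath v)) (cmul B (unit_shift e (vpath v)) step_proj)"
    have "S f = ?R"
    proof (rule B_ell2_eqI[OF CK.S_bounded[OF assms]])
      show "?R \<in> bounded_ops (paths E)"
        using bounded_ops_sub[OF unit_shift_bounded[OF v] bounded_ops_mul[OF unit_shift_bounded[OF v] step_proj_bounded]]
        by simp
      fix k u assume k: "k \<in> ell2 (paths E)"
      have "w = vpath v" if "w \<in> paths E" "residue E n w = vpath v" "plen w = 0" for w
        using that n residue_small[of w] by simp
      moreover have "residue E n (vpath v) = vpath v" using residue_small n by simp
      ultimately show "S f k u = ?R k u"
        using k range[of k] v(2) unfolding ex Inr
        by (auto simp: CK.S_apply unit_shift_def pull_op_apply) (auto simp: step_proj_def pull_op_apply)
    qed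
    also have "\<dots> \<in> shift_alg"
      unfolding csub_def
      by (rule ops(2)[OF T[OF v] ops(3)[OF ops(1)[OF T[OF v] step_proj_in_generated]]])
    finally show ?thesis .
  qed
qed

text \<open>Since \<open>E\<close> has no sinks, every vertex of \<open>E[n]\<close> is the source of an edge \<open>f\<close>, and its projection is
  \<open>S\<^sub>f\<^sup>\<star> S\<^sub>f\<close>.\<close>

lemma P_in_generated:
  assumes x: "x \<in> verts F" shows "P x \<in> shift_alg"
proof -
  interpret B: cstar_algebra B by (rule B_ell2_cstar_algebra)
  have "class_range x \<in> verts E" using x prange_in_verts by (cases x) (auto simp: verts_F)
  then obtain e where "e \<in> arcs E" "tail E e = class_range x"
    using nsns by (auto simp: no_sinks_no_sources_def)
  then have f: "(e, x) \<in> arcs F" using x arcs_F by simp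
  have "P x = cmul B (cadj B (S (e, x))) (S (e, x))"
    using CK_familyD(6)[OF CK.CK_family_branching f] by simp
  also have "\<dots> \<in> shift_alg"
    by (intro B.generated_mul[OF shift_gens_bounded] B.generated_adj[OF shift_gens_bounded]
        S_in_generated[OF f])
  finally show ?thesis .
qed

lemma shift_algebra_isomorphic: "star_isomorphic (shift_algebra E n) (CK_algebra F)"
proof -
  interpret B: cstar_algebra B by (rule B_ell2_cstar_algebra)
  have "shift_algebra E n = cstar_generated B shift_gens"
    by (simp add: shift_algebra_def shift_gens_def)
  also have "\<dots> = cstar_generated B CK_gens"
  proof (rule B.generated_eqI[OF shift_gens_bounded CK_gens_bounded])
    show "shift_gens \<subseteq> CK_alg"
      using shift_in_generated by (auto simp: shift_gens_def)
    show "CK_gens \<subseteq> shift_alg"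
      using P_in_generated S_in_generated by blast
  qed
  finally have eq: "shift_algebra E n = cstar_generated B CK_gens" .
  show ?thesis
    unfolding eq
  proof (rule CK.branching_isomorphic_CK_algebra[OF pclass_nonempty])
    show "plen u = Suc (plen (pbutlast u))" if "u \<in> pext (fst f) ` pclass (snd f)" for f u
      using that by (elim imageE) simp
  qed
qed

end

theorem theorem5p4:
  fixes E :: "('v,'e) pre_digraph" and n :: nat
  assumes "fin_digraph E" and "no_sinks_no_sources E" and "n \<ge> 1"
  shows "star_isomorphic (shift_algebra E n) (CK_algebra (graph_bracket E n))"
proof -
  interpret fin_digraph E by fact
  interpret shift_graph E n by unfold_locales fact+
  show ?thesis by (rule shift_algebra_isomorphic)
qed

end
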